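(* Let $(X,d,\mu)$ be a metric measure space whose Hausdorff dimension $\dim_{\mathrm H}X$ is finite. Suppose that there exists a constant $C\ge 1$ such that, for every Lipschitz function $f\colon X\to\mathbb R$ and every upper gradient $\rho$ of $f$, \[\operatorname{Lip}(f,x)\le C\rho(x)\quad\text{for }\mu\text{-a.e. }x\in X.\] Then $(X,d,\mu)$ is a Lipschitz differentiability space. Further, the Borel sets $U_i$ and Lipschitz maps $\phi_i\colon X\to\mathbb R^{n_i}$ in the definition of a Lipschitz differentiability space can be chosen so that $n_i\le\dim_{\mathrm H}X$ for all $i\in\mathbb N$.
   Context: A metric measure space $(X,d,\mu)$ is a complete and separable metric space $(X,d)$ equipped with a $\sigma$-finite Borel measure $\mu$. For Lipschitz $f\colon X\to\mathbb R$ and $x\in X$, $\operatorname{Lip}(f,x)=\limsup_{y\to x,\,y\ne x}\frac{|f(y)-f(x)|}{d(x,y)}$ is the pointwise Lipschitz constant ($=0$ if $x$ is isolated). Upper gradient: a Borel function $\rho\colon X\to\mathbb R$ is an upper gradient of a Lipschitz $f\colon X\to\mathbb R$ if, for every 1-Lipschitz $\gamma\colon[0,1]\to X$, $|f(\gamma(1))-f(\gamma(0))|\le\int_0^1\rho(\gamma(t))\,dt$ (the integral may equal $+\infty$; taking constant curves shows that $\rho\geq 0$). Differentiability: let $x_0\in X$, let $n\ge 0$ be an integer and $\phi\colon X\to\mathbb R^n$ Lipschitz. A function $f\colon X\to\mathbb R$ is differentiable with respect to $\phi$ at $x_0$ if there exists a unique linear $Df(x_0)\colon\mathbb R^n\to\mathbb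 R$ such that $\lim_{x\to x_0}\frac{|f(x)-f(x_0)-Df(x_0)(\phi(x)-\phi(x_0))|}{d(x,x_0)}=0$ (the limit condition is vacuous at an isolated point). Lipschitz differentiability space: $(X,d,\mu)$ is a Lipschitz differentiability space if there exist a countable Borel decomposition $X=\bigcup_iU_i$ and countably many Lipschitz maps $\phi_i\colon X\to\mathbb R^{n_i}$ (with integers $n_i\ge0$), $i\in\mathbb N$, such that for every Lipschitz $f\colon X\to\mathbb R$ and every $i$, $f$ is differentiable with respect to $\phi_i$ at $\mu$-a.e. point of $U_i$. *)

theory Defs
  imports "HOL-Analysis.Analysis"
begin

text \<open>The metric space $(X,d)$ is a type of class \<open>polish_space\<close>: in the library this is exactly
  \<open>complete_space + second_countable_topology\<close>, so the given metric \<open>dist\<close> itself is complete.\<close>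

definition metric_measure_space :: "'a::polish_space measure \<Rightarrow> bool" where
  "metric_measure_space \<mu> \<longleftrightarrow> sets \<mu> = sets borel \<and> sigma_finite_measure \<mu>"

definition lipschitz_fun :: "('a::metric_space \<Rightarrow> real) \<Rightarrow> bool" where
  "lipschitz_fun f \<longleftrightarrow> (\<exists>L. L-lipschitz_on UNIV f)"


subsection \<open>Hausdorff dimension\<close>

text \<open>The summand $(\mathrm{diam}\,U)^s$, with $0^0 = 1$ for nonempty \<open>U\<close> (whereas \<open>0 powr 0 = 0\<close>).
  Only meaningful for bounded \<open>U\<close>, since \<open>diameter\<close> is real-valued.\<close>
definition diam_pow :: "real \<Rightarrow> 'a::metric_space set \<Rightarrow> ennreal" where
  "diam_pow s U = (if U = {} then 0 else if s = 0 then 1 else ennreal (diameter U powr s))"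

definition hausdorff_premeasure :: "real \<Rightarrow> real \<Rightarrow> 'a::metric_space set \<Rightarrow> ennreal" where
  "hausdorff_premeasure \<delta> s A =
     (INF U \<in> {U :: nat \<Rightarrow> 'a set. A \<subseteq> (\<Union>i. U i) \<and> (\<forall>i. bounded (U i) \<and> diameter (U i) \<le> \<delta>)}.
        \<Sum>i. diam_pow s (U i))"

definition hausdorff_measure :: "real \<Rightarrow> 'a::metric_space set \<Rightarrow> ennreal" where
  "hausdorff_measure s A = (SUP \<delta> \<in> {0<..}. hausdorff_premeasure \<delta> s A)"

definition hausdorff_dim :: "'a::metric_space set \<Rightarrow> ennreal" where
  "hausdorff_dim A = (INF s \<in> {s::real. 0 \<le> s \<and> hausdorff_measure s A = 0}. ennreal s)"


subsection \<open>Pointwise Lipschitz constant and upper gradients\<close>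

text \<open>At an isolated point \<open>at x\<close> is the trivial filter, whose \<open>Limsup\<close> is the bottom element;
  taking the values in \<open>ennreal\<close> makes this \<open>0\<close>.\<close>
definition Lip :: "('a::metric_space \<Rightarrow> real) \<Rightarrow> 'a \<Rightarrow> ennreal" where
  "Lip f x = Limsup (at x) (\<lambda>y. ennreal (\<bar>f y - f x\<bar> / dist x y))"

lemma Lip_isolated: "at x = bot \<Longrightarrow> Lip f x = 0"
  by (simp add: Lip_def Limsup_bot bot_ennreal)

text \<open>Nonnegativity, which follows from the inequality along constant curves, is stated explicitly
  because \<open>ennreal\<close> truncates negative values to \<open>0\<close> inside the nonnegative integral.\<close>
definition upper_gradient :: "('a::metric_space \<Rightarrow> real) \<Rightarrow> ('a \<Rightarrow> real) \<Rightarrow> bool" where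
  "upper_gradient f \<rho> \<longleftrightarrow>
     \<rho> \<in> borel_measurable borel \<and> (\<forall>x. 0 \<le> \<rho> x) \<and>
     (\<forall>\<gamma> :: real \<Rightarrow> 'a. 1-lipschitz_on {0..1} \<gamma> \<longrightarrow>
        ennreal \<bar>f (\<gamma> 1) - f (\<gamma> 0)\<bar> \<le> (\<integral>\<^sup>+t\<in>{0..1}. ennreal (\<rho> (\<gamma> t)) \<partial>lborel))"


subsection \<open>Differentiability with respect to a Lipschitz map into $\mathbb{R}^n$\<close>

text \<open>Since \<open>n\<close> varies with the chart, $\mathbb{R}^n$ is the library's \<open>Euclidean_space n\<close>, whose points
  are the sequences vanishing from index \<open>n\<close> on. Its Euclidean norm is \<open>L2_set _ {..<n}\<close>; the
  \<open>dist\<close> of the type \<open>nat \<Rightarrow> real\<close> is a different (product) metric and is not used.\<close>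
abbreviation Rn :: "nat \<Rightarrow> (nat \<Rightarrow> real) set" where
  "Rn n \<equiv> topspace (Euclidean_space n)"

definition lipschitz_map :: "nat \<Rightarrow> ('a::metric_space \<Rightarrow> nat \<Rightarrow> real) \<Rightarrow> bool" where
  "lipschitz_map n \<phi> \<longleftrightarrow>
     range \<phi> \<subseteq> Rn n \<and>
     (\<exists>L. \<forall>x y. L2_set (\<lambda>j. \<phi> x j - \<phi> y j) {..<n} \<le> L * dist x y)"

text \<open>Linear maps $\mathbb{R}^n \to \mathbb{R}$; \<open>extensional\<close> fixes the values off $\mathbb{R}^n$, so that equality
  of such functions is equality of maps on $\mathbb{R}^n$.\<close>
definition linear_forms :: "nat \<Rightarrow> ((nat \<Rightarrow> real) \<Rightarrow> real) set" where
  "linear_forms n =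
     {D \<in> extensional (Rn n).
        (\<forall>u\<in>Rn n. \<forall>v\<in>Rn n. D (\<lambda>j. u j + v j) = D u + D v) \<and>
        (\<forall>c. \<forall>v\<in>Rn n. D (\<lambda>j. c * v j) = c * D v)}"

text \<open>At an isolated point every \<open>D\<close> satisfies the limit condition, so there the
  uniqueness requirement holds iff \<open>n = 0\<close>.\<close>
definition differentiable_wrt ::
    "nat \<Rightarrow> ('a::metric_space \<Rightarrow> nat \<Rightarrow> real) \<Rightarrow> ('a \<Rightarrow> real) \<Rightarrow> 'a \<Rightarrow> bool" where
  "differentiable_wrt n \<phi> f x0 \<longleftrightarrow>
     (\<exists>!D. D \<in> linear_forms n \<and>
        ((\<lambda>x. \<bar>f x - f x0 - D (\<lambda>j. \<phi> x j - \<phi> x0 j)\<bar> / dist x x0) \<longlongrightarrow> 0) (at x0))"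


subsection \<open>Lipschitz differentiability spaces\<close>

text \<open>The pieces may be empty, so indexing by all of \<open>nat\<close> includes finite decompositions.\<close>
definition lds_decomposition ::
    "'a::polish_space measure \<Rightarrow> (nat \<Rightarrow> 'a set) \<Rightarrow> (nat \<Rightarrow> nat) \<Rightarrow> (nat \<Rightarrow> 'a \<Rightarrow> nat \<Rightarrow> real) \<Rightarrow> bool" where
  "lds_decomposition \<mu> U n \<phi> \<longleftrightarrow>
     (\<forall>i. U i \<in> sets borel) \<and> disjoint_family U \<and> (\<Union>i. U i) = UNIV \<and>
     (\<forall>i. lipschitz_map (n i) (\<phi> i)) \<and>
     (\<forall>f i. lipschitz_fun f \<longrightarrow>
        (AE x in \<mu>. x \<in> U i \<longrightarrow> differentiable_wrt (n i) (\<phi> i) f x))"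

definition lipschitz_differentiability_space :: "'a::polish_space measure \<Rightarrow> bool" where
  "lipschitz_differentiability_space \<mu> \<longleftrightarrow> (\<exists>U n \<phi>. lds_decomposition \<mu> U n \<phi>)"

end

theory Submission
  imports Defs
begin

text \<open>Suppose that $n$ Lipschitz functions $\phi_1,\dots,\phi_n$ are independent, in the sense that
  $\mathrm{Lip}(v\cdot\phi,x)\ge\delta|v|$, on a set \<open>U\<close> of positive measure, while $\mathcal H^s(X)=0$ for some
  $s<n$. If almost every curve fragment in a set $P\subseteq U$ has its $\phi$-derivative near a
  hyperplane $v^\perp$, then $v\cdot\phi$ has an upper gradient which is small on \<open>P\<close>, so \<open>P\<close> is null.
  It therefore suffices to split \<open>U\<close>, for \<open>n\<close> quantitatively independent directions, into pieces
  the \<open>i\<close>-th of which is negligible on every curve fragment in the \<open>i\<close>-th direction.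

  After a linear change of $\phi$ these are the coordinate directions. The splitting replaces the
  multilinear Kakeya inequality by its combinatorial dual: a set of at most $m^n$ points of
  $\mathbb Z^n$ splits into \<open>n\<close> parts, the \<open>i\<close>-th of which has at most \<open>m\<close> points on every line in
  direction \<open>i\<close>. Applied to the children of every cell of a $2^d$-adic grid in $\mathbb R^n$,
  weighted by the image measure, it gives each cell \<open>n\<close> weights. Since $s<n$, almost every
  point lies at infinitely many levels in a cell of mass at least $2^{-dNs}$, one of whose weights is then
  large; a curve in direction \<open>i\<close> meets few cells whose \<open>i\<close>-th weight is large.

  Hence independent families have at most $\dim_{\mathrm H}X$ members, and the independent families of maximal
  size are charts: adding \<open>f\<close> to one makes it dependent, which expresses \<open>f\<close> to first order
  through the chart.\<close>

subsection \<open>Lipschitz functions on the line and upper gradients\<close>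

text \<open>Each level of the grid costs a factor \<open>2 ^ n * (d + 2)\<close>:
  \<open>d + 1\<close> from sorting the children of a cell by mass into dyadic classes, one more for
  the children assigned to other directions, and \<open>2 ^ n\<close> because a nearly straight
  fragment meets several parallel lines of children. The gap \<open>s < n\<close> gains a factor
  \<beta> per level that is exponential in \<open>d\<close>, about
  \<open>2 powr (d * (n - s) / (n * n))\<close>. Hence the grid is \<open>2 ^ d\<close>-adic with
  \<open>d\<close> large instead of dyadic. The order of the constants is the second constraint. The
  aperture of the cones is fixed by \<open>n\<close> and \<open>s\<close> before the measure and the
  map are known. So the coordinates may later be rescaled by factors that depend on the aperture,
  which makes a triangular system of directions nearly diagonal. Directions are rounded to a finite
  grid, so that only finitely many splittings have to be superimposed; along curves this needs
  slopes only up to a fixed error.\<close>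

lemma Vitali_intervals:
  fixes E G :: "real set"
  assumes "open G" "E \<subseteq> G"
    and K: "\<And>t d. \<lbrakk>t \<in> E; 0 < d\<rbrakk> \<Longrightarrow> \<exists>a b. a < b \<and> a \<le> t \<and> t \<le> b \<and> b - a < d \<and> P a b"
  obtains C where "countable C" "\<And>i. i \<in> C \<Longrightarrow> fst i < snd i \<and> P (fst i) (snd i) \<and> {fst i..snd i} \<subseteq> G"
     "disjoint_family_on (\<lambda>i. {fst i..snd i}) C"
     "negligible (E - (\<Union>i\<in>C. {fst i..snd i}))"
proof -
  define K where "K = {i. fst i < snd i \<and> P (fst i) (snd i) \<and> {fst i..snd i} \<subseteq> G}"
  have cb: "cball ((fst i + snd i)/2) ((snd i - fst i)/2) = {fst i..snd i}" for i :: "real \<times> real"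
    by (simp add: cball_eq_atLeastAtMost field_simps)
  have 1: "\<exists>i. i \<in> K \<and> x \<in> cball ((fst i + snd i)/2) ((snd i - fst i)/2) \<and> (snd i - fst i)/2 < d"
    if xd: "x \<in> E" "0 < d" for x d
  proof -
    obtain r where r: "r > 0" "ball x r \<subseteq> G" using assms xd by (meson openE subsetD)
    obtain a b where ab: "a < b" "a \<le> x" "x \<le> b" "b - a < min d r" "P a b"
      using assms(3)[OF xd(1), of "min d r"] xd r by auto
    have "{a..b} \<subseteq> ball x r" using ab by (auto simp: dist_real_def)
    then have "(a,b) \<in> K" using ab r by (auto simp: K_def)
    moreover have "x \<in> cball ((fst (a,b) + snd (a,b))/2) ((snd (a,b) - fst (a,b))/2)"
      unfolding cb using ab by simp
    ultimately show ?thesis using ab xd by (intro exI[of _ "(a,b)"]) auto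
  qed
  have 2: "0 < (snd i - fst i)/2" if "i \<in> K" for i using that by (auto simp: K_def)
  obtain C where C: "countable C" "C \<subseteq> K"
     "pairwise (\<lambda>i j. disjnt (cball ((fst i + snd i)/2) ((snd i - fst i)/2)) (cball ((fst j + snd j)/2) ((snd j - fst j)/2))) C"
     "negligible(E - (\<Union>i \<in> C. cball ((fst i + snd i)/2) ((snd i - fst i)/2)))"
    by (rule Vitali_covering_theorem_cballs[of K "\<lambda>i. (snd i - fst i)/2" E "\<lambda>i. (fst i + snd i)/2", OF 2 1])
  show ?thesis
  proof (rule that[OF C(1)])
    show "disjoint_family_on (\<lambda>i. {fst i..snd i}) C"
      using C(3) unfolding cb disjoint_family_on_def pairwise_def disjnt_def by auto
    show "negligible (E - (\<Union>i\<in>C. {fst i..snd i}))" using C(4) unfolding cb .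
  qed (use C(2) in \<open>auto simp: K_def\<close>)
qed

text \<open>Both Vitali selections are nested: first intervals of slope at most \<open>p\<close> inside \<open>G\<close>, then
  intervals of slope at least \<open>q\<close> inside their interiors.\<close>
lemma two_slopes_shrink:
  fixes F :: "real \<Rightarrow> real"
  assumes mono: "\<And>x y. x \<le> y \<Longrightarrow> F x \<le> F y" and cont: "continuous_on UNIV F"
    and pq: "0 < p" "p < q" and G: "open G" "E \<subseteq> G"
    and lo: "\<And>t d. \<lbrakk>t \<in> E; 0 < d\<rbrakk> \<Longrightarrow> \<exists>a b. a < b \<and> a \<le> t \<and> t \<le> b \<and> b - a < d \<and> F b - F a \<le> p * (b - a)"
    and hi: "\<And>t d. \<lbrakk>t \<in> E; 0 < d\<rbrakk> \<Longrightarrow> \<exists>a b. a < b \<and> a \<le> t \<and> t \<le> b \<and> b - a < d \<and> q * (b - a) \<le> F b - F a"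
  obtains B where "B \<in> sets borel" "B \<subseteq> G" "negligible (E - B)"
    "ennreal q * emeasure lborel B \<le> ennreal p * emeasure lborel G"
proof -
  let ?I = "\<lambda>i::real\<times>real. {fst i..snd i}"
  obtain C where C: "countable C"
    "\<And>i. i \<in> C \<Longrightarrow> fst i < snd i \<and> F (snd i) - F (fst i) \<le> p * (snd i - fst i) \<and> ?I i \<subseteq> G"
    "disjoint_family_on ?I C" "negligible (E - (\<Union>i\<in>C. ?I i))"
    by (rule Vitali_intervals[OF G, where P = "\<lambda>a b. F b - F a \<le> p * (b - a)"]) (use lo in auto)
  let ?U = "\<Union>i\<in>C. {fst i<..<snd i}"
  have U: "open ?U" by auto
  obtain C' where C': "countable C'"
    "\<And>i. i \<in> C' \<Longrightarrow> fst i < snd i \<and> q * (snd i - fst i) \<le> F (snd i) - F (fst i) \<and> ?I i \<subseteq> ?U"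
    "disjoint_family_on ?I C'" "negligible (E \<inter> ?U - (\<Union>i\<in>C'. ?I i))"
    by (rule Vitali_intervals[OF U, where P = "\<lambda>a b. q * (b - a) \<le> F b - F a" and E = "E \<inter> ?U"]) (use hi in auto)
  define B where "B = (\<Union>i\<in>C'. ?I i)"
  define A where "A = (\<Union>i\<in>C. ?I i)"
  have Bs: "B \<in> sets borel" and As: "A \<in> sets borel"
    unfolding A_def B_def using C(1) C'(1) by (auto intro!: sets.countable_UN')
  have BU: "B \<subseteq> ?U" using C'(2) unfolding B_def by blast
  have UA: "?U \<subseteq> A" unfolding A_def by (force intro: less_imp_le)
  have AG: "A \<subseteq> G" using C(2) unfolding A_def by blast
  \<comment> \<open>The second selection sees only points inside the open intervals; the endpoints
    lost in this way are countably many.\<close>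
  have "negligible (fst ` C \<union> snd ` C)" using C(1) by (simp add: negligible_iff_null_sets null_sets_completionI countable_imp_null_set_lborel)
  then have "negligible (((E - A) \<union> (fst ` C \<union> snd ` C)) \<union> (E \<inter> ?U - B))"
    using C(4) C'(4) unfolding A_def B_def by (intro negligible_Un) auto
  then have neg: "negligible (E - B)"
  proof (rule negligible_subset)
    show "E - B \<subseteq> ((E - A) \<union> (fst ` C \<union> snd ` C)) \<union> (E \<inter> ?U - B)"
    proof
      fix x assume x: "x \<in> E - B"
      show "x \<in> ((E - A) \<union> (fst ` C \<union> snd ` C)) \<union> (E \<inter> ?U - B)"
      proof (rule ccontr)
        assume n: "\<not> ?thesis"
        then have "x \<in> A" "x \<notin> ?U" "x \<notin> fst ` C" "x \<notin> snd ` C" using x by auto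
        then obtain i where i: "i \<in> C" "fst i \<le> x" "x \<le> snd i" unfolding A_def by auto
        then have "x \<noteq> fst i" "x \<noteq> snd i" using \<open>x \<notin> fst ` C\<close> \<open>x \<notin> snd ` C\<close> by auto
        then have "x \<in> {fst i<..<snd i}" using i by auto
        then show False using i(1) \<open>x \<notin> ?U\<close> by blast
      qed
    qed
  qed
  \<comment> \<open>The Stieltjes measure of \<open>F\<close> compares the two selections:
    \<open>q * |B| <= F(B) <= F(A) <= p * |A|\<close>.\<close>
  let ?m = "interval_measure F"
  have eF: "emeasure ?m {a..b} = ennreal (F b - F a)" if "a \<le> b" for a b
    using emeasure_interval_measure_Icc[OF that mono cont] .
  have sumF: "emeasure ?m (\<Union>i\<in>D. ?I i) = (\<integral>\<^sup>+i. emeasure ?m (?I i) \<partial>count_space D)"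
    if "countable D" "disjoint_family_on ?I D" for D
    using that by (intro emeasure_UN_countable) auto
  have sumL: "emeasure lborel (\<Union>i\<in>D. ?I i) = (\<integral>\<^sup>+i. emeasure lborel (?I i) \<partial>count_space D)"
    if "countable D" "disjoint_family_on ?I D" for D
    using that by (intro emeasure_UN_countable) auto
  have "ennreal q * emeasure lborel B = (\<integral>\<^sup>+i. ennreal q * emeasure lborel (?I i) \<partial>count_space C')"
    unfolding B_def sumL[OF C'(1,3)] by (rule nn_integral_cmult[symmetric]) simp
  also have "\<dots> \<le> (\<integral>\<^sup>+i. emeasure ?m (?I i) \<partial>count_space C')"
  proof (rule nn_integral_mono)
    fix i assume "i \<in> space (count_space C')"
    then have i: "fst i < snd i" "q * (snd i - fst i) \<le> F (snd i) - F (fst i)" using C'(2) by auto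
    then have "emeasure ?m (?I i) = ennreal (F (snd i) - F (fst i))"
      "emeasure lborel (?I i) = ennreal (snd i - fst i)" using eF by auto
    then show "ennreal q * emeasure lborel (?I i) \<le> emeasure ?m (?I i)"
      using i pq by (simp add: ennreal_mult[symmetric] ennreal_leI)
  qed
  also have "\<dots> = emeasure ?m B" unfolding B_def sumF[OF C'(1,3)] ..
  also have "\<dots> \<le> emeasure ?m A" using BU UA As by (intro emeasure_mono) auto
  also have "\<dots> = (\<integral>\<^sup>+i. emeasure ?m (?I i) \<partial>count_space C)" unfolding A_def sumF[OF C(1,3)] ..
  also have "\<dots> \<le> (\<integral>\<^sup>+i. ennreal p * emeasure lborel (?I i) \<partial>count_space C)"
  proof (rule nn_integral_mono)
    fix i assume "i \<in> space (count_space C)"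
    then have i: "fst i < snd i" "F (snd i) - F (fst i) \<le> p * (snd i - fst i)" using C(2) by auto
    then have "emeasure ?m (?I i) = ennreal (F (snd i) - F (fst i))"
      "emeasure lborel (?I i) = ennreal (snd i - fst i)" using eF by auto
    then show "emeasure ?m (?I i) \<le> ennreal p * emeasure lborel (?I i)"
      using i pq by (simp add: ennreal_mult[symmetric] ennreal_leI)
  qed
  also have "\<dots> = ennreal p * emeasure lborel A"
    unfolding A_def sumL[OF C(1,3)] by (rule nn_integral_cmult) simp
  also have "\<dots> \<le> ennreal p * emeasure lborel G" using AG G(1) by (intro mult_left_mono emeasure_mono) auto
  finally show ?thesis using that Bs BU UA AG neg by blast
qed

lemma lmeasurable_open_superset:
  assumes S: "S \<in> lmeasurable" and N: "negligible N" and e: "0 < e"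
  obtains G where "open G" "S \<union> N \<subseteq> G" "G \<in> lmeasurable" "measure lebesgue G < measure lebesgue S + e"
proof -
  have nul: "N \<in> null_sets lebesgue" using N by (simp add: negligible_iff_null_sets)
  have SN: "S \<union> N \<in> lmeasurable" "measure lebesgue (S \<union> N) = measure lebesgue S"
    by (rule fmeasurable.Un[OF S negligible_imp_measurable[OF N]])
      (rule measure_Un_null_set[OF fmeasurableD[OF S] nul])
  obtain G where G: "open G" "S \<union> N \<subseteq> G" "G - (S \<union> N) \<in> lmeasurable"
      "emeasure lebesgue (G - (S \<union> N)) < ennreal e"
    using sets_lebesgue_outer_open[OF fmeasurableD[OF SN(1)] e] by metis
  have G': "G = (S \<union> N) \<union> (G - (S \<union> N))" using G(2) by blast
  have "G \<in> lmeasurable" by (subst G') (intro fmeasurable.Un SN(1) G(3))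
  moreover have "measure lebesgue G \<le> measure lebesgue (S \<union> N) + measure lebesgue (G - (S \<union> N))"
    by (subst G') (intro measure_Un_le fmeasurableD SN(1) G(3))
  moreover have "measure lebesgue (G - (S \<union> N)) < e"
    using G(4) e unfolding emeasure_eq_measure2[OF G(3)] by (simp add: ennreal_less_iff)
  ultimately show ?thesis using SN(2) by (intro that[OF G(1,2)]) auto
qed

text \<open>The outer measure \<open>m\<close> of \<open>E\<close> satisfies
  \<open>m <= p / q * m\<close>: a nearly optimal open \<open>G\<close> can be exchanged for the
  smaller \<open>B\<close>, which still contains almost all of \<open>E\<close>.\<close>

lemma negligible_two_slopes:
  fixes F :: "real \<Rightarrow> real"
  assumes mono: "\<And>x y. x \<le> y \<Longrightarrow> F x \<le> F y" and cont: "continuous_on UNIV F"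
    and pq: "0 < p" "p < q" and E: "bounded E"
    and lo: "\<And>t d. \<lbrakk>t \<in> E; 0 < d\<rbrakk> \<Longrightarrow> \<exists>a b. a < b \<and> a \<le> t \<and> t \<le> b \<and> b - a < d \<and> F b - F a \<le> p * (b - a)"
    and hi: "\<And>t d. \<lbrakk>t \<in> E; 0 < d\<rbrakk> \<Longrightarrow> \<exists>a b. a < b \<and> a \<le> t \<and> t \<le> b \<and> b - a < d \<and> q * (b - a) \<le> F b - F a"
  shows "negligible E"
proof -
  define \<G> where "\<G> = {G. open G \<and> E \<subseteq> G \<and> G \<in> lmeasurable}"
  define m where "m = Inf (measure lebesgue ` \<G>)"
  obtain R where R: "R > 0" "E \<subseteq> ball 0 R" using E bounded_subset_ballD by blast
  have ne: "\<G> \<noteq> {}" using R by (auto simp: \<G>_def intro: lmeasurable_ball)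
  have bdd: "bdd_below (measure lebesgue ` \<G>)" by (rule bdd_belowI[of _ 0]) auto
  have m0: "0 \<le> m" unfolding m_def using ne by (intro cInf_greatest) auto
  have step: "m \<le> p / q * measure lebesgue G + e" if GG: "G \<in> \<G>" and e0: "e > 0" for G e
  proof -
    have G: "open G" "E \<subseteq> G" "G \<in> lmeasurable" using GG by (auto simp: \<G>_def)
    obtain B where B: "B \<in> sets borel" "B \<subseteq> G" "negligible (E - B)"
      "ennreal q * emeasure lborel B \<le> ennreal p * emeasure lborel G"
      by (rule two_slopes_shrink[OF mono cont pq G(1,2) lo hi])
    have Bl: "B \<in> lmeasurable"
      using B G by (intro fmeasurableI2[OF G(3)]) auto
    have eG: "emeasure lborel G = ennreal (measure lebesgue G)"
      using G emeasure_eq_measure2[OF G(3)] by (simp add: emeasure_completion)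
    have eB: "emeasure lborel B = ennreal (measure lebesgue B)"
      using B emeasure_eq_measure2[OF Bl] by (simp add: emeasure_completion)
    have qB: "q * measure lebesgue B \<le> p * measure lebesgue G"
      using B(4) pq unfolding eG eB by (simp add: ennreal_mult[symmetric])
    obtain T where T: "open T" "B \<union> (E - B) \<subseteq> T" "T \<in> lmeasurable" "measure lebesgue T < measure lebesgue B + e"
      by (rule lmeasurable_open_superset[OF Bl B(3) e0])
    have "E \<subseteq> T" using T(2) by blast
    then have "T \<in> \<G>" using T(1,3) by (auto simp: \<G>_def)
    then have "m \<le> measure lebesgue T" unfolding m_def using bdd by (intro cInf_lower) auto
    then have "m \<le> measure lebesgue B + e" using T(4) by linarith
    moreover have "measure lebesgue B \<le> p / q * measure lebesgue G" using qB pq by (simp add: field_simps)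
    ultimately show ?thesis by linarith
  qed
  have "m \<le> p / q * m"
  proof (rule ccontr)
    assume n: "\<not> ?thesis"
    define e where "e = (m - p / q * m) / 4"
    have e: "e > 0" using n by (simp add: e_def)
    have "\<exists>G\<in>\<G>. measure lebesgue G < m + e"
      using cInf_lessD[of "measure lebesgue ` \<G>" "m + e"] ne e by (auto simp: m_def[symmetric])
    then obtain G where G: "G \<in> \<G>" "measure lebesgue G < m + e" by auto
    have "m \<le> p / q * measure lebesgue G + e" by (rule step[OF G(1) e])
    also have "\<dots> \<le> p / q * (m + e) + e" using G pq by (intro add_right_mono mult_left_mono) auto
    also have "\<dots> \<le> p / q * m + e + e" using pq e by (simp add: field_simps)
    finally have "m \<le> p / q * m + e + e" .
    moreover have "4 * e = m - p / q * m" by (simp add: e_def)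
    ultimately show False using e by linarith
  qed
  then have "m * (1 - p / q) \<le> 0" by (simp add: algebra_simps)
  then have mz: "m = 0" using m0 pq by (simp add: mult_le_0_iff)
  show ?thesis unfolding negligible_outer
  proof safe
    fix e :: real assume "e > 0"
    then obtain G where "G \<in> \<G>" "measure lebesgue G < e"
      using cInf_lessD[of "measure lebesgue ` \<G>" "e"] ne mz by (auto simp: m_def[symmetric])
    then show "\<exists>T. E \<subseteq> T \<and> T \<in> lmeasurable \<and> measure lebesgue T < e" by (auto simp: \<G>_def)
  qed
qed


section \<open>Slopes at almost every time, up to a fixed error\<close>

lemma int_predicate_switch:
  fixes a b :: int
  assumes "P a" "\<not> P b" "a \<le> b"
  shows "\<exists>z. a \<le> z \<and> z < b \<and> P z \<and> \<not> P (z + 1)"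
  using assms(3,2)
proof (induction b rule: int_ge_induct)
  case base then show ?case using assms(1) by simp
next
  case (step i) then show ?case
    by (cases "P i") force+
qed

text \<open>A quantitative, discretised form of Rademacher's theorem on the line.\<close>
lemma lipschitz_approx_slope:
  fixes h :: "real \<Rightarrow> real"
  assumes h: "L-lipschitz_on UNIV h" and e: "0 < e"
  shows "\<exists>N. negligible N \<and> (\<forall>t\<in>{0..1} - N. \<exists>z::int. \<bar>z * e\<bar> \<le> L + 2 * e \<and>
    (\<exists>d>0. \<forall>s. \<bar>s - t\<bar> < d \<longrightarrow> \<bar>h s - h t - z * e * (s - t)\<bar> \<le> e * \<bar>s - t\<bar>))"
proof -
  have L: "L \<ge> 0" using h by (rule lipschitz_on_nonneg)
  have hL: "\<bar>h s - h t\<bar> \<le> L * \<bar>s - t\<bar>" for s t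
    using lipschitz_onD[OF h, of s t] by (simp add: dist_real_def)
  define sl where "sl s t = (h s - h t) / (s - t)" for s t
  have slL: "\<bar>sl s t\<bar> \<le> L" if "s \<noteq> t" for s t
    using hL[of s t] that by (simp add: sl_def divide_simps)
  \<comment> \<open>Near such a point arbitrarily short quotients lie on both sides of the gap
    between \<open>z * e\<close> and \<open>(z + 1) * e\<close>. Off all these sets the quotients
    finally vary by at most two steps.\<close>
  define E where "E z = {t\<in>{0..1}. (\<forall>d>0. \<exists>s. 0 < \<bar>s - t\<bar> \<and> \<bar>s - t\<bar> < d \<and> sl s t < z * e) \<and>
     (\<forall>d>0. \<exists>s. 0 < \<bar>s - t\<bar> \<and> \<bar>s - t\<bar> < d \<and> sl s t > (z + 1) * e)}" for z :: int
  \<comment> \<open>The linear term makes \<open>F\<close> increasing, as a Stieltjes measure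
    requires, and moves all slopes up to at least 1. A level whose shifted value is not positive
    therefore has empty \<open>E z\<close>.\<close>
  define F where "F t = h t + (L + 1) * t" for t
  have Fs: "F b - F a = (sl s t + L + 1) * (b - a)" if "a < b" "(a = s \<and> b = t) \<or> (a = t \<and> b = s)" for a b s t
    using that by (auto simp: F_def sl_def field_simps)
  have Fmono: "F x \<le> F y" if "x \<le> y" for x y
  proof -
    have "h x - h y \<le> L * (y - x)" using hL[of x y] that by auto
    also have "\<dots> \<le> (L + 1) * (y - x)" using that by (intro mult_right_mono) auto
    finally show ?thesis by (simp add: F_def algebra_simps)
  qed
  have Fc: "continuous_on UNIV F" unfolding F_def
    using lipschitz_on_continuous_on[OF h] by (intro continuous_intros)
  have negE: "negligible (E z)" for z
  proof (cases "0 < z * e + L + 1")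
    case False
    have "E z = {}"
    proof (rule ccontr)
      assume "E z \<noteq> {}"
      then obtain t where "t \<in> E z" by auto
      then have "\<forall>d>0. \<exists>s. 0 < \<bar>s - t\<bar> \<and> \<bar>s - t\<bar> < d \<and> sl s t < z * e" unfolding E_def by blast
      then obtain s where "0 < \<bar>s - t\<bar>" "sl s t < z * e" by (meson zero_less_one)
      then show False using slL[of s t] False by auto
    qed
    then show ?thesis by simp
  next
    case True
    show ?thesis
    proof (rule negligible_two_slopes[OF Fmono Fc True, of "(z + 1) * e + L + 1"])
      show "z * e + L + 1 < (z + 1) * e + L + 1" using e by (simp add: algebra_simps)
      show "bounded (E z)" by (rule bounded_subset[of "{0..1}"]) (auto simp: E_def)
    next
      fix t d :: real assume t: "t \<in> E z" "0 < d"
      then obtain s where s: "0 < \<bar>s - t\<bar>" "\<bar>s - t\<bar> < d" "sl s t < z * e" unfolding E_def by blast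
      define a b where "a = min s t" and "b = max s t"
      have ab: "a < b" "a \<le> t" "t \<le> b" "b - a < d" "(a = s \<and> b = t) \<or> (a = t \<and> b = s)"
        using s by (auto simp: a_def b_def)
      have "F b - F a \<le> (z * e + L + 1) * (b - a)"
        unfolding Fs[OF ab(1,5)] using s ab by (intro mult_right_mono) auto
      then show "\<exists>a b. a < b \<and> a \<le> t \<and> t \<le> b \<and> b - a < d \<and> F b - F a \<le> (z * e + L + 1) * (b - a)"
        using ab by blast
    next
      fix t d :: real assume t: "t \<in> E z" "0 < d"
      then obtain s where s: "0 < \<bar>s - t\<bar>" "\<bar>s - t\<bar> < d" "sl s t > (z + 1) * e" unfolding E_def by blast
      define a b where "a = min s t" and "b = max s t"
      have ab: "a < b" "a \<le> t" "t \<le> b" "b - a < d" "(a = s \<and> b = t) \<or> (a = t \<and> b = s)"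
        using s by (auto simp: a_def b_def)
      have "((z + 1) * e + L + 1) * (b - a) \<le> F b - F a"
        unfolding Fs[OF ab(1,5)] using s ab by (intro mult_right_mono) auto
      then show "\<exists>a b. a < b \<and> a \<le> t \<and> t \<le> b \<and> b - a < d \<and> ((z + 1) * e + L + 1) * (b - a) \<le> F b - F a"
        using ab by blast
    qed
  qed
  have "negligible (\<Union>z. E z)" using negE by (intro negligible_countable_Union) auto
  moreover have "\<exists>z::int. \<bar>z * e\<bar> \<le> L + 2 * e \<and>
    (\<exists>d>0. \<forall>s. \<bar>s - t\<bar> < d \<longrightarrow> \<bar>h s - h t - z * e * (s - t)\<bar> \<le> e * \<bar>s - t\<bar>)"
    if t: "t \<in> {0..1} - (\<Union>z. E z)" for t
  proof -
    define A where "A z \<longleftrightarrow> (\<exists>d>0. \<forall>s. 0 < \<bar>s - t\<bar> \<and> \<bar>s - t\<bar> < d \<longrightarrow> z * e \<le> sl s t)" for z :: int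
    have "L / e \<ge> 0" using L e by simp
    define Z0 where "Z0 = - \<lceil>L / e\<rceil>"
    define Z1 where "Z1 = \<lfloor>L / e\<rfloor> + 1"
    have "real_of_int \<lceil>L / e\<rceil> * e \<ge> L" using e by (simp add: pos_divide_le_eq[symmetric])
    then have "Z0 * e \<le> - L" by (simp add: Z0_def)
    then have A0: "A Z0" unfolding A_def using slL by (intro exI[of _ 1]) force
    have Z1: "L < Z1 * e" using e unfolding Z1_def by (metis floor_less_iff pos_divide_less_eq add.commute less_add_one of_int_1 of_int_add real_of_int_floor_add_one_gt)
    have A1: "\<not> A Z1"
    proof
      assume "A Z1"
      then obtain d where d: "d > 0" "\<And>s. 0 < \<bar>s - t\<bar> \<and> \<bar>s - t\<bar> < d \<longrightarrow> Z1 * e \<le> sl s t" unfolding A_def by blast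
      from d(2)[of "t + d/2"] d(1) have "Z1 * e \<le> sl (t + d/2) t" by auto
      then show False using slL[of "t + d/2" t] d(1) Z1 by auto
    qed
    have "Z0 \<le> Z1" using \<open>L / e \<ge> 0\<close> by (simp add: Z0_def Z1_def) linarith
    \<comment> \<open>Nearby quotients stay above level \<open>z\<close>, but not above level
      \<open>z + 1\<close>. Since \<open>t\<close> avoids \<open>E (z + 1)\<close>, they lie between
      \<open>z * e\<close> and \<open>(z + 2) * e\<close>, and the midpoint
      \<open>(z + 1) * e\<close> serves as slope with error \<open>e\<close>.\<close>
    then obtain z where z: "Z0 \<le> z" "z < Z1" "A z" "\<not> A (z + 1)" using int_predicate_switch[of A Z0 Z1] A0 A1 by blast
    from z(3) obtain d1 where d1: "d1 > 0" "\<And>s. 0 < \<bar>s - t\<bar> \<Longrightarrow> \<bar>s - t\<bar> < d1 \<Longrightarrow> z * e \<le> sl s t" unfolding A_def by blast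
    have "t \<notin> E (z + 1)" using t by auto
    moreover have "\<forall>d>0. \<exists>s. 0 < \<bar>s - t\<bar> \<and> \<bar>s - t\<bar> < d \<and> sl s t < (z + 1) * e"
      using z(4) unfolding A_def by (auto simp: not_le)
    ultimately have "\<not> (\<forall>d>0. \<exists>s. 0 < \<bar>s - t\<bar> \<and> \<bar>s - t\<bar> < d \<and> sl s t > (real_of_int (z + 1) + 1) * e)"
      using t unfolding E_def by (auto simp: algebra_simps)
    then obtain d2 where d2: "d2 > 0" "\<And>s. 0 < \<bar>s - t\<bar> \<Longrightarrow> \<bar>s - t\<bar> < d2 \<Longrightarrow> sl s t \<le> (real_of_int (z + 1) + 1) * e"
      by (meson not_less)
    show ?thesis
    proof (intro exI[of _ "z + 1"] conjI exI[of _ "min d1 d2"] allI impI)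
      have "(z + 1) * e \<le> L + e"
      proof -
        have "z + 1 \<le> L / e + 1" using z(2) unfolding Z1_def by linarith
        then have "(z + 1) * e \<le> (L / e + 1) * e" using e by (intro mult_right_mono) auto
        then show ?thesis using e by (simp add: algebra_simps)
      qed
      moreover have "- L \<le> (z + 1) * e"
      proof -
        have "- (L / e) \<le> z + 1" using z(1) unfolding Z0_def by linarith
        then have "- (L / e) * e \<le> (z + 1) * e" using e by (intro mult_right_mono) auto
        then show ?thesis using e by simp
      qed
      ultimately show "\<bar>(z + 1) * e\<bar> \<le> L + 2 * e" using e by (simp add: abs_le_iff)
    next
      fix s assume s: "\<bar>s - t\<bar> < min d1 d2"
      show "\<bar>h s - h t - (z + 1) * e * (s - t)\<bar> \<le> e * \<bar>s - t\<bar>"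
      proof (cases "s = t")
        case False
        then have "\<bar>sl s t - (z + 1) * e\<bar> \<le> e"
          using d1(2)[of s] d2(2)[of s] s by (auto simp: abs_le_iff algebra_simps)
        moreover have "h s - h t - (z + 1) * e * (s - t) = (sl s t - (z + 1) * e) * (s - t)"
          using False by (simp add: sl_def field_simps)
        ultimately show ?thesis by (simp add: abs_mult mult_right_mono)
      qed simp
    qed (use d1 d2 in auto)
  qed
  ultimately show ?thesis by blast
qed

section \<open>Upper gradients that are small on a given set\<close>

lemma lipschitz_clamp:
  fixes \<gamma> :: "real \<Rightarrow> 'a::metric_space"
  assumes "1-lipschitz_on {0..1} \<gamma>"
  shows "1-lipschitz_on UNIV (\<lambda>t. \<gamma> (max 0 (min 1 t)))"
proof (rule lipschitz_onI)
  fix x y :: real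
  have "dist (\<gamma> (max 0 (min 1 x))) (\<gamma> (max 0 (min 1 y))) \<le> 1 * dist (max 0 (min 1 x)) (max 0 (min 1 y))"
    by (rule lipschitz_onD[OF assms]) auto
  also have "\<dots> \<le> 1 * dist x y" by (auto simp: dist_real_def)
  finally show "dist (\<gamma> (max 0 (min 1 x))) (\<gamma> (max 0 (min 1 y))) \<le> 1 * dist x y" .
qed simp

text \<open>Off \<open>P\<close> the Lipschitz constant always bounds the rate of change along a
  curve. At almost every time spent in \<open>P\<close>, \<open>loc\<close> gives the rate \<eta>.
  The local rates are added up by subdivision, without integrating a derivative.\<close>

lemma upper_gradient_two_values:
  fixes f :: "'a::metric_space \<Rightarrow> real"
  assumes f: "L-lipschitz_on UNIV f" and P: "P \<in> sets borel" and \<eta>: "0 \<le> \<eta>" "\<eta> \<le> L"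
    and loc: "\<And>\<gamma> :: real \<Rightarrow> 'a. 1-lipschitz_on UNIV \<gamma> \<Longrightarrow> \<exists>N. negligible N \<and>
      (\<forall>t\<in>{0..1} - N. \<gamma> t \<in> P \<longrightarrow>
        (\<exists>d>0. \<forall>s. \<bar>s - t\<bar> < d \<longrightarrow> \<bar>f (\<gamma> s) - f (\<gamma> t)\<bar> \<le> \<eta> * \<bar>s - t\<bar>))"
  shows "upper_gradient f (\<lambda>x. if x \<in> P then \<eta> else L)"
  unfolding upper_gradient_def
proof (intro conjI allI impI)
  show "(\<lambda>x. if x \<in> P then \<eta> else L) \<in> borel_measurable borel" using P by measurable
  show "0 \<le> (if x \<in> P then \<eta> else L)" for x using \<eta> by auto
next
  fix \<gamma>0 :: "real \<Rightarrow> 'a"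
  assume lip0: "1-lipschitz_on {0..1} \<gamma>0"
  define \<gamma> where "\<gamma> t = \<gamma>0 (max 0 (min 1 t))" for t
  have lip: "1-lipschitz_on UNIV \<gamma>" unfolding \<gamma>_def by (rule lipschitz_clamp[OF lip0])
  have eq: "\<gamma> t = \<gamma>0 t" if "t \<in> {0..1}" for t using that by (auto simp: \<gamma>_def)
  obtain N where N: "negligible N" "\<And>t. t \<in> {0..1} \<Longrightarrow> t \<notin> N \<Longrightarrow> \<gamma> t \<in> P \<Longrightarrow>
        (\<exists>d>0. \<forall>s. \<bar>s - t\<bar> < d \<longrightarrow> \<bar>f (\<gamma> s) - f (\<gamma> t)\<bar> \<le> \<eta> * \<bar>s - t\<bar>)"
    using loc[OF lip] by blast
  have \<gamma>c: "continuous_on UNIV \<gamma>" by (rule lipschitz_on_continuous_on[OF lip])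
  then have \<gamma>m: "\<gamma> \<in> borel_measurable borel" by (rule borel_measurable_continuous_onI)
  define Q where "Q = {t\<in>{0..1}. \<gamma> t \<notin> P}"
  have Qb: "Q \<in> sets borel"
  proof -
    have "Q = {0..1} \<inter> (\<gamma> -` (- P) \<inter> space borel)" by (auto simp: Q_def)
    moreover have "\<gamma> -` (- P) \<inter> space borel \<in> sets borel" using P \<gamma>m by (intro measurable_sets) auto
    ultimately show ?thesis by auto
  qed
  have Qm: "Q \<in> lmeasurable" 
    by (rule fmeasurableI2[of "{0..1}"]) (use Qb in \<open>auto simp: Q_def\<close>)
  have Q1: "measure lebesgue Q \<le> 1"
  proof -
    have "Q \<subseteq> {0..1}" by (auto simp: Q_def)
    then have "measure lebesgue Q \<le> measure lebesgue {0..1::real}"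
      by (intro measure_mono_fmeasurable fmeasurableD[OF Qm]) auto
    then show ?thesis by simp
  qed
  have fL: "\<bar>f (\<gamma> s) - f (\<gamma> t)\<bar> \<le> L * \<bar>s - t\<bar>" for s t
  proof -
    have L: "0 \<le> L" using \<eta> by linarith
    have "\<bar>f (\<gamma> s) - f (\<gamma> t)\<bar> \<le> L * dist (\<gamma> s) (\<gamma> t)"
      using lipschitz_onD[OF f, of "\<gamma> s" "\<gamma> t"] by (simp add: dist_real_def)
    also have "\<dots> \<le> L * \<bar>s - t\<bar>"
      using lipschitz_onD[OF lip, of s t] L by (intro mult_left_mono) (auto simp: dist_real_def)
    finally show ?thesis .
  qed
  have main: "\<bar>f (\<gamma> 1) - f (\<gamma> 0)\<bar> \<le> \<eta> + (L - \<eta>) * (measure lebesgue Q + e)" if e: "e > 0" for e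
  proof -
    \<comment> \<open>\<open>G\<close> contains all bad times: those spent off \<open>P\<close> and
      the exceptional ones.\<close>
    obtain G where G: "open G" "Q \<union> N \<subseteq> G" and Gm: "G \<in> lmeasurable"
      and Ge: "measure lebesgue G < measure lebesgue Q + e"
      by (rule lmeasurable_open_superset[OF Qm N(1) e])
    define m where "m a b = measure lebesgue (G \<inter> {a<..b})" for a b
    have Gab: "G \<inter> {a<..b} \<in> lmeasurable" for a b
      by (rule fmeasurableI2[OF Gm]) (use G(1) in auto)
    \<comment> \<open>The majorant is additive over adjacent intervals because \<open>m\<close> uses
      half-open ones. By bisection it then suffices to prove the bound on all short intervals around
      each single time.\<close>
    have "\<bar>f (\<gamma> 1) - f (\<gamma> 0)\<bar> \<le> \<eta> * (1 - 0) + (L - \<eta>) * m 0 1"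
    proof (rule Bolzano[of 0 1 "\<lambda>a b. a \<le> b \<longrightarrow> \<bar>f (\<gamma> b) - f (\<gamma> a)\<bar> \<le> \<eta> * (b - a) + (L - \<eta>) * m a b", THEN mp])
      show "(0::real) \<le> 1" "(0::real) \<le> 1" by auto
    next
      fix a b c :: real
      assume *: "a \<le> b \<longrightarrow> \<bar>f (\<gamma> b) - f (\<gamma> a)\<bar> \<le> \<eta> * (b - a) + (L - \<eta>) * m a b"
        "b \<le> c \<longrightarrow> \<bar>f (\<gamma> c) - f (\<gamma> b)\<bar> \<le> \<eta> * (c - b) + (L - \<eta>) * m b c" "a \<le> b" "b \<le> c"
      have "G \<inter> {a<..c} = (G \<inter> {a<..b}) \<union> (G \<inter> {b<..c})" using * by auto
      then have "m a c = m a b + m b c" unfolding m_def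
        using Gab by (simp only:) (rule measure_Un_AE, auto)
      then show "a \<le> c \<longrightarrow> \<bar>f (\<gamma> c) - f (\<gamma> a)\<bar> \<le> \<eta> * (c - a) + (L - \<eta>) * m a c"
        using * by (simp add: algebra_simps)
    next
      fix t :: real assume t: "0 \<le> t" "t \<le> 1"
      show "\<exists>d>0. \<forall>a b. a \<le> t \<and> t \<le> b \<and> b - a < d \<longrightarrow> (a \<le> b \<longrightarrow> \<bar>f (\<gamma> b) - f (\<gamma> a)\<bar> \<le> \<eta> * (b - a) + (L - \<eta>) * m a b)"
      proof (cases "t \<in> G")
        case True
        then obtain d where d: "d > 0" "ball t d \<subseteq> G" using G(1) by (meson openE)
        show ?thesis
        proof (intro exI[of _ d] conjI allI impI)
          fix a b assume ab: "a \<le> t \<and> t \<le> b \<and> b - a < d" "a \<le> b"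
          then have "{a<..b} \<subseteq> ball t d" by (auto simp: dist_real_def)
          then have "G \<inter> {a<..b} = {a<..b}" using d by auto
          then have mab: "m a b = b - a" using ab by (simp add: m_def)
          show "\<bar>f (\<gamma> b) - f (\<gamma> a)\<bar> \<le> \<eta> * (b - a) + (L - \<eta>) * m a b"
            using fL[of b a] ab unfolding mab by (simp add: algebra_simps)
        qed (rule d)
      next
        case False
        then have "t \<notin> N" "\<gamma> t \<in> P" using G(2) t by (auto simp: Q_def)
        then obtain d where d: "d > 0" "\<And>s. \<bar>s - t\<bar> < d \<Longrightarrow> \<bar>f (\<gamma> s) - f (\<gamma> t)\<bar> \<le> \<eta> * \<bar>s - t\<bar>"
          using N(2)[of t] t by auto
        show ?thesis
        proof (intro exI[of _ d] conjI allI impI)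
          fix a b assume ab: "a \<le> t \<and> t \<le> b \<and> b - a < d" "a \<le> b"
          then have "\<bar>f (\<gamma> b) - f (\<gamma> t)\<bar> \<le> \<eta> * (b - t)" "\<bar>f (\<gamma> a) - f (\<gamma> t)\<bar> \<le> \<eta> * (t - a)"
            using d(2)[of a] d(2)[of b] by auto
          then have "\<bar>f (\<gamma> b) - f (\<gamma> a)\<bar> \<le> \<eta> * (b - a)" by (simp add: algebra_simps)
          moreover have "0 \<le> (L - \<eta>) * m a b" using \<eta> by (auto simp: m_def)
          ultimately show "\<bar>f (\<gamma> b) - f (\<gamma> a)\<bar> \<le> \<eta> * (b - a) + (L - \<eta>) * m a b" by linarith
        qed (rule d)
      qed
    qed
    moreover have "m 0 1 \<le> measure lebesgue G" unfolding m_def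
      using Gab[of 0 1] Gm by (intro measure_mono_fmeasurable) auto
    ultimately have "(L - \<eta>) * m 0 1 \<le> (L - \<eta>) * (measure lebesgue Q + e)"
      and "\<bar>f (\<gamma> 1) - f (\<gamma> 0)\<bar> \<le> \<eta> + (L - \<eta>) * m 0 1"
      using Ge \<eta> by (auto intro!: mult_left_mono)
    then show ?thesis by linarith
  qed
  have "\<bar>f (\<gamma> 1) - f (\<gamma> 0)\<bar> \<le> \<eta> + (L - \<eta>) * measure lebesgue Q"
  proof (rule field_le_epsilon)
    fix e :: real assume e: "e > 0"
    have "\<bar>f (\<gamma> 1) - f (\<gamma> 0)\<bar> \<le> \<eta> + (L - \<eta>) * (measure lebesgue Q + e / (L - \<eta> + 1))"
      by (rule main) (use e \<eta> in auto)
    also have "\<dots> = \<eta> + (L - \<eta>) * measure lebesgue Q + e * ((L - \<eta>) / (L - \<eta> + 1))" by (simp add: algebra_simps)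
    also have "\<dots> \<le> \<eta> + (L - \<eta>) * measure lebesgue Q + e * 1"
      using e \<eta> by (intro add_left_mono mult_left_mono) auto
    finally show "\<bar>f (\<gamma> 1) - f (\<gamma> 0)\<bar> \<le> \<eta> + (L - \<eta>) * measure lebesgue Q + e" by simp
  qed
  also have "\<dots> = \<eta> * (1 - measure lebesgue Q) + L * measure lebesgue Q" by (simp add: algebra_simps)
  finally have fin: "ennreal \<bar>f (\<gamma> 1) - f (\<gamma> 0)\<bar> \<le> ennreal (\<eta> * (1 - measure lebesgue Q)) + ennreal (L * measure lebesgue Q)"
    using \<eta> Q1 by (subst ennreal_plus[symmetric]) (simp_all del: ennreal_plus add: ennreal_leI)
  have eQ: "emeasure lborel Q = ennreal (measure lebesgue Q)"
    using Qb emeasure_eq_measure2[OF Qm] by (simp add: emeasure_completion)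
  have "emeasure lborel ({0..1} - Q) = emeasure lborel {0..1::real} - emeasure lborel Q"
    using Qb eQ by (intro emeasure_Diff) (auto simp: Q_def)
  then have eQ': "emeasure lborel ({0..1} - Q) = ennreal (1 - measure lebesgue Q)"
    using Q1 by (simp add: eQ ennreal_minus[symmetric] flip: ennreal_1)
  have "(\<integral>\<^sup>+t\<in>{0..1}. ennreal (if \<gamma>0 t \<in> P then \<eta> else L) \<partial>lborel) =
    (\<integral>\<^sup>+t. ennreal \<eta> * indicator ({0..1} - Q) t + ennreal L * indicator Q t \<partial>lborel)"
    by (rule nn_integral_cong) (auto simp: indicator_def Q_def eq)
  also have "\<dots> = ennreal \<eta> * emeasure lborel ({0..1} - Q) + ennreal L * emeasure lborel Q"
    using Qb by (subst nn_integral_add) (auto simp: nn_integral_cmult_indicator)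
  also have "\<dots> = ennreal (\<eta> * (1 - measure lebesgue Q)) + ennreal (L * measure lebesgue Q)"
    using \<eta> Q1 by (simp add: eQ eQ' ennreal_mult)
  finally show "ennreal \<bar>f (\<gamma>0 1) - f (\<gamma>0 0)\<bar> \<le> (\<integral>\<^sup>+t\<in>{0..1}. ennreal (if \<gamma>0 t \<in> P then \<eta> else L) \<partial>lborel)"
    using fin eq[of 0] eq[of 1] by simp
qed

subsection \<open>Splitting along lines\<close>

lemma real_le_two_power: "m \<le> 2 ^ k \<Longrightarrow> real m \<le> 2 ^ k"
  by (metis of_nat_le_iff of_nat_numeral of_nat_power)

text \<open>Induction on the dimension: a line in the new direction carries more than
  \<open>m\<close> points, and the lower-dimensional slices through them are disjoint and rich by
  induction.\<close>

lemma card_line_rich: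
  fixes A :: "(nat \<Rightarrow> int) set"
  assumes A: "finite A" and "a \<in> A"
    and rich: "\<And>i a. i < n \<Longrightarrow> a \<in> A \<Longrightarrow> m < card {b\<in>A. \<forall>j. j \<noteq> i \<longrightarrow> b j = a j}"
  shows "(m + 1) ^ n \<le> card {b\<in>A. \<forall>j\<ge>n. b j = a j}"
  using assms(2,3)
proof (induction n arbitrary: a)
  case 0
  have "{b\<in>A. \<forall>j\<ge>0. b j = a j} = {a}" using 0 by auto
  then show ?case by simp
next
  case (Suc n)
  define l where "l = {b\<in>A. \<forall>j. j \<noteq> n \<longrightarrow> b j = a j}"
  define S where "S b = {c\<in>A. \<forall>j\<ge>n. c j = b j}" for b
  have l: "m + 1 \<le> card l" using Suc.prems(2)[of n a] Suc.prems(1) by (simp add: l_def)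
  have S: "(m + 1) ^ n \<le> card (S b)" if "b \<in> l" for b
    unfolding S_def by (rule Suc.IH) (use that Suc.prems in \<open>auto simp: l_def\<close>)
  have "(m + 1) ^ Suc n \<le> card l * (m + 1) ^ n"
    unfolding power_Suc by (rule mult_right_mono[OF l]) simp
  also have "\<dots> \<le> (\<Sum>b\<in>l. card (S b))" using sum_bounded_below[of l "(m+1)^n" "\<lambda>b. card (S b)"] S by simp
  also have "\<dots> = card (\<Union>b\<in>l. S b)"
  proof (rule card_UN_disjoint[symmetric])
    show "\<forall>i\<in>l. \<forall>j\<in>l. i \<noteq> j \<longrightarrow> S i \<inter> S j = {}"
    proof (intro ballI impI)
      fix b c assume bc: "b \<in> l" "c \<in> l" "b \<noteq> c"
      then have "b n \<noteq> c n" by (auto simp: l_def fun_eq_iff) metis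
      then show "S b \<inter> S c = {}" by (auto simp: S_def)
    qed
  qed (use A in \<open>auto simp: l_def S_def\<close>)
  also have "\<dots> \<le> card {b\<in>A. \<forall>j\<ge>Suc n. b j = a j}"
    by (rule card_mono) (use A in \<open>auto simp: l_def S_def\<close>)
  finally show ?case .
qed

text \<open>The combinatorial dual of the Loomis--Whitney inequality. Greedily remove a line with few
  points; one exists because otherwise \<open>A\<close> would have more than \<open>m ^ n\<close> points.\<close>
lemma split_along_lines:
  fixes A :: "(nat \<Rightarrow> int) set"
  assumes "finite A" "card A \<le> m ^ n" "1 \<le> n"
  shows "\<exists>f. (\<forall>a\<in>A. f a < n) \<and>
    (\<forall>i<n. \<forall>b. card {a\<in>A. f a = i \<and> (\<forall>j. j \<noteq> i \<longrightarrow> a j = b j)} \<le> m)"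
  using assms(1,2)
proof (induction A rule: finite_psubset_induct)
  case (psubset A)
  show ?case
  proof (cases "A = {}")
    case True
    then show ?thesis by (intro exI[of _ "\<lambda>_. 0"]) auto
  next
    case False
    then obtain a0 where a0: "a0 \<in> A" by auto
    have "\<exists>i<n. \<exists>a\<in>A. card {b\<in>A. \<forall>j. j \<noteq> i \<longrightarrow> b j = a j} \<le> m"
    proof (rule ccontr)
      assume "\<not> ?thesis"
      then have "(m + 1) ^ n \<le> card {b\<in>A. \<forall>j\<ge>n. b j = a0 j}"
        by (intro card_line_rich psubset.hyps a0) (auto simp: not_le)
      also have "\<dots> \<le> card A" using psubset.hyps by (intro card_mono) auto
      also have "\<dots> \<le> m ^ n" by (rule psubset.prems)
      also have "\<dots> < (m + 1) ^ n" using assms(3) by (intro power_strict_mono) auto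
      finally show False by simp
    qed
    then obtain i a where i: "i < n" "a \<in> A" "card {b\<in>A. \<forall>j. j \<noteq> i \<longrightarrow> b j = a j} \<le> m" by blast
    define l where "l = {b\<in>A. \<forall>j. j \<noteq> i \<longrightarrow> b j = a j}"
    have l: "l \<subseteq> A" "a \<in> l" using i by (auto simp: l_def)
    then have sub: "A - l \<subset> A" by auto
    have "card (A - l) \<le> m ^ n"
      using card_mono[OF psubset.hyps(1), of "A - l"] psubset.prems by simp
    then obtain f where f: "\<And>a. a \<in> A - l \<Longrightarrow> f a < n"
      "\<And>i b. i < n \<Longrightarrow> card {a\<in>A - l. f a = i \<and> (\<forall>j. j \<noteq> i \<longrightarrow> a j = b j)} \<le> m"
      using psubset.IH[OF sub] by blast
    define g where "g a = (if a \<in> l then i else f a)" for a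
    show ?thesis
    proof (intro exI[of _ g] conjI ballI allI impI)
      show "g a < n" if "a \<in> A" for a using that f i by (auto simp: g_def)
      fix k b assume k: "k < n"
      let ?X = "{a\<in>A. g a = k \<and> (\<forall>j. j \<noteq> k \<longrightarrow> a j = b j)}"
      show "card ?X \<le> m"
      \<comment> \<open>A point of the removed line with label \<open>k\<close> forces
        \<open>k = i\<close> and puts all of \<open>?X\<close> inside \<open>l\<close>. So old and
        new labels never add up on one line.\<close>
      proof (cases "?X \<inter> l = {}")
        case True
        then have "?X \<subseteq> {a\<in>A - l. f a = k \<and> (\<forall>j. j \<noteq> k \<longrightarrow> a j = b j)}" by (auto simp: g_def)
        then have "card ?X \<le> card {a\<in>A - l. f a = k \<and> (\<forall>j. j \<noteq> k \<longrightarrow> a j = b j)}"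
          using psubset.hyps by (intro card_mono) auto
        then show ?thesis using f(2)[OF k, of b] by simp
      next
        case False
        then obtain c where c: "c \<in> l" "g c = k" "\<forall>j. j \<noteq> k \<longrightarrow> c j = b j" by auto
        then have "k = i" by (auto simp: g_def)
        then have "?X \<subseteq> l" using c by (auto simp: l_def)
        then have "card ?X \<le> card l" using psubset.hyps l by (intro card_mono) (auto intro: finite_subset)
        then show ?thesis using i(3) by (simp add: l_def)
      qed
    qed
  qed
qed

text \<open>Dyadic pigeonholing of the masses. A class \<open>j < d\<close> consists of points of
  mass about \<open>B / 2 ^ (n * j)\<close>, up to a factor \<open>2 ^ n\<close>, so it has at most
  \<open>2 ^ (n * (j + 1))\<close> points and splits with multiplicity \<open>2 ^ (j + 1)\<close>.
  In the last class, whose points may be arbitrarily light, the trivial multiplicity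
  \<open>2 ^ d\<close> is used. Each of the \<open>d + 1\<close> classes adds at most 1 to the sum
  along a line.\<close>

lemma weighted_split_along_lines:
  fixes A :: "(nat \<Rightarrow> int) set" and p :: "(nat \<Rightarrow> int) \<Rightarrow> real"
  assumes A: "finite A" and n: "1 \<le> n" and p: "\<And>a. a \<in> A \<Longrightarrow> 0 \<le> p a" "sum p A \<le> B"
    and lines: "\<And>i b. i < n \<Longrightarrow> card {a\<in>A. \<forall>j. j \<noteq> i \<longrightarrow> a j = b j} \<le> 2 ^ d"
  shows "\<exists>f M. (\<forall>a\<in>A. f a < n \<and> 0 < M a \<and> p a * M a ^ n \<le> 2 ^ n * B) \<and>
    (\<forall>i<n. \<forall>b. (\<Sum>a\<in>{a\<in>A. f a = i \<and> (\<forall>j. j \<noteq> i \<longrightarrow> a j = b j)}. 1 / M a) \<le> real d + 1)"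
proof -
  have B: "0 \<le> B" using p sum_nonneg[of A p] by force
  have pB: "p a \<le> B" if "a \<in> A" for a using that p A member_le_sum[of a A p] by force
  define J where "J a = (LEAST j. j = d \<or> B / 2 ^ (n * (j + 1)) < p a)" for a
  have J: "J a = d \<or> B / 2 ^ (n * (J a + 1)) < p a" for a
    unfolding J_def by (rule LeastI[of _ d]) simp
  have Jd: "J a \<le> d" for a unfolding J_def by (rule Least_le) simp
  have Jp: "p a \<le> B / 2 ^ (n * J a)" if "a \<in> A" for a
  proof (cases "J a")
    case 0 then show ?thesis using pB[OF that] by simp
  next
    case (Suc j)
    then have "\<not> (j = d \<or> B / 2 ^ (n * (j + 1)) < p a)"
      using not_less_Least[of j "\<lambda>j. j = d \<or> B / 2 ^ (n * (j + 1)) < p a"] by (simp add: J_def)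
    then show ?thesis using Suc by auto
  qed
  define L where "L j = {a\<in>A. J a = j}" for j
  have cL: "card (L j) \<le> (2 ^ (j + 1)) ^ n" if j: "j < d" for j
  proof (cases "L j = {}")
    case False
    have fin: "finite (L j)" using A by (simp add: L_def)
    have pL: "B / 2 ^ (n * (j + 1)) < p a" if "a \<in> L j" for a using J[of a] that j by (auto simp: L_def)
    have "real (card (L j)) * (B / 2 ^ (n * (j + 1))) < sum p (L j)"
      using sum_strict_mono[OF fin False, of "\<lambda>_. B / 2 ^ (n * (j + 1))" p] pL by simp
    also have "\<dots> \<le> sum p A" using A p by (intro sum_mono2) (auto simp: L_def)
    also have "\<dots> \<le> B" by (rule p)
    finally have *: "real (card (L j)) * (B / 2 ^ (n * (j + 1))) < B" .
    then have "B > 0" using B by (cases "B = 0") auto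
    with * have "real (card (L j)) < 2 ^ (n * (j + 1))" by (simp add: field_simps)
    then have "card (L j) < 2 ^ (n * (j + 1))" by (metis of_nat_less_iff of_nat_numeral of_nat_power)
    then show ?thesis by (simp add: power_mult[symmetric] power_add[symmetric] algebra_simps)
  qed simp
  have "\<forall>j. \<exists>f. j < d \<longrightarrow> (\<forall>a\<in>L j. f a < n) \<and>
    (\<forall>i<n. \<forall>b. card {a\<in>L j. f a = i \<and> (\<forall>k. k \<noteq> i \<longrightarrow> a k = b k)} \<le> 2 ^ (j + 1))"
    using split_along_lines[of "L _", OF _ cL n] A by (simp add: L_def)
  from choice[OF this] obtain F where F': "\<And>j. j < d \<Longrightarrow> (\<forall>a\<in>L j. F j a < n) \<and>
    (\<forall>i<n. \<forall>b. card {a\<in>L j. F j a = i \<and> (\<forall>k. k \<noteq> i \<longrightarrow> a k = b k)} \<le> 2 ^ (j + 1))" by blast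
  have F: "\<And>j a. j < d \<Longrightarrow> a \<in> L j \<Longrightarrow> F j a < n"
    "\<And>j i b. j < d \<Longrightarrow> i < n \<Longrightarrow> card {a\<in>L j. F j a = i \<and> (\<forall>k. k \<noteq> i \<longrightarrow> a k = b k)} \<le> 2 ^ (j + 1)"
    using F' by blast+
  define f where "f a = (if J a < d then F (J a) a else 0)" for a
  define M :: "(nat \<Rightarrow> int) \<Rightarrow> real" where "M a = (if J a < d then 2 ^ (J a + 1) else 2 ^ d)" for a
  show ?thesis
  proof (intro exI[of _ f] exI[of _ M] conjI ballI allI impI)
    fix a assume a: "a \<in> A"
    show "f a < n" using F(1)[of "J a" a] a n by (auto simp: f_def L_def)
    show M0: "0 < M a" by (simp add: M_def)
    have "M a \<le> 2 ^ (J a + 1)" using Jd[of a] by (auto simp: M_def)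
    then have "M a ^ n \<le> (2 ^ (J a + 1)) ^ n" using M0 by (intro power_mono) auto
    then have "p a * M a ^ n \<le> (B / 2 ^ (n * J a)) * (2 ^ (J a + 1)) ^ n"
      using Jp[OF a] p(1)[OF a] M0 B by (intro mult_mono) auto
    also have "(2 ^ (J a + 1)) ^ n = (2::real) ^ n * 2 ^ (n * J a)"
      by (simp add: power_mult[symmetric] power_add[symmetric] algebra_simps)
    finally show "p a * M a ^ n \<le> 2 ^ n * B" by (simp add: mult.commute)
  next
    fix i b assume i: "i < n"
    let ?X = "{a\<in>A. f a = i \<and> (\<forall>k. k \<noteq> i \<longrightarrow> a k = b k)}"
    have fin: "finite ?X" using A by simp
    have "(\<Sum>a\<in>?X. 1 / M a) = (\<Sum>j\<in>{..d}. \<Sum>a\<in>{a\<in>?X. J a = j}. 1 / M a)"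
      using Jd fin by (intro sum.group[symmetric]) auto
    also have "\<dots> \<le> (\<Sum>j\<in>{..d}. 1)"
    proof (rule sum_mono)
      fix j assume j: "j \<in> {..d}"
      show "(\<Sum>a\<in>{a\<in>?X. J a = j}. 1 / M a) \<le> 1"
      proof (cases "j < d")
        case True
        have eq: "{a\<in>?X. J a = j} = {a\<in>L j. F j a = i \<and> (\<forall>k. k \<noteq> i \<longrightarrow> a k = b k)}"
          using True by (auto simp: L_def f_def)
        have "(\<Sum>a\<in>{a\<in>?X. J a = j}. 1 / M a) = (\<Sum>a\<in>{a\<in>?X. J a = j}. 1 / 2 ^ (j + 1))"
          using True by (intro sum.cong) (auto simp: M_def)
        also have "\<dots> = real (card {a\<in>?X. J a = j}) / 2 ^ (j + 1)" by simp
        also have "\<dots> \<le> 1"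
        proof -
          have "card {a\<in>?X. J a = j} \<le> 2 ^ (j + 1)" unfolding eq by (rule F(2)[OF True i])
          then have "real (card {a\<in>?X. J a = j}) \<le> 2 ^ (j + 1)"
            by (rule real_le_two_power)
          then show ?thesis by (simp add: divide_le_eq)
        qed
        finally show ?thesis .
      next
        case False
        then have jd: "j = d" using j by auto
        have "(\<Sum>a\<in>{a\<in>?X. J a = j}. 1 / M a) = (\<Sum>a\<in>{a\<in>?X. J a = j}. 1 / 2 ^ d)"
          using jd by (intro sum.cong) (auto simp: M_def)
        also have "\<dots> = real (card {a\<in>?X. J a = j}) / 2 ^ d" by simp
        also have "\<dots> \<le> 1"
        proof -
          have "card {a\<in>?X. J a = j} \<le> card {a\<in>A. \<forall>k. k \<noteq> i \<longrightarrow> a k = b k}" using A by (intro card_mono) auto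
          then have "card {a\<in>?X. J a = j} \<le> 2 ^ d" using lines[OF i, of b] by simp
          then have "real (card {a\<in>?X. J a = j}) \<le> 2 ^ d"
            by (rule real_le_two_power)
          then show ?thesis by (simp add: divide_le_eq)
        qed
        finally show ?thesis .
      qed
    qed
    also have "\<dots> = real d + 1" by simp
    finally show "(\<Sum>a\<in>?X. 1 / M a) \<le> real d + 1" .
  qed
qed

subsection \<open>Trees of grid cells\<close>

text \<open>The integer lattice in dimension \<open>n\<close>, encoded by sequences vanishing from
  index \<open>n\<close> on. Equality of cells is then equality of functions, and a line in
  direction \<open>i\<close> is given by agreement at all other indices.\<close>

definition int_points :: "nat \<Rightarrow> (nat \<Rightarrow> int) set" where
  "int_points n = {c. \<forall>j\<ge>n. c j = 0}"

lemma card_box_points: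
  fixes F :: "nat \<Rightarrow> int set"
  assumes "\<And>j. j < n \<Longrightarrow> finite (F j)"
  shows "finite {c\<in>int_points n. \<forall>j<n. c j \<in> F j} \<and>
    card {c\<in>int_points n. \<forall>j<n. c j \<in> F j} \<le> (\<Prod>j<n. card (F j))"
  using assms
proof (induction n)
  case 0
  have "{c\<in>int_points 0. \<forall>j<0. c j \<in> F j} = {\<lambda>_. 0}" by (auto simp: int_points_def)
  then show ?case by simp
next
  case (Suc n)
  let ?S = "\<lambda>n. {c\<in>int_points n. \<forall>j<n. c j \<in> F j}"
  let ?g = "\<lambda>(c, v). c(n := v) :: nat \<Rightarrow> int"
  have IH: "finite (?S n)" "card (?S n) \<le> (\<Prod>j<n. card (F j))" using Suc by auto
  have sub: "?S (Suc n) \<subseteq> ?g ` (?S n \<times> F n)"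
  proof
    fix c assume c: "c \<in> ?S (Suc n)"
    have "c = ?g (c(n := 0), c n)" by simp
    moreover have "(c(n := 0), c n) \<in> ?S n \<times> F n" using c by (auto simp: int_points_def)
    ultimately show "c \<in> ?g ` (?S n \<times> F n)" by blast
  qed
  have fin: "finite (?S n \<times> F n)" using IH(1) Suc.prems by auto
  have "card (?S (Suc n)) \<le> card (?g ` (?S n \<times> F n))" using sub fin by (intro card_mono) auto
  also have "\<dots> \<le> card (?S n \<times> F n)" using fin by (rule card_image_le)
  also have "\<dots> = card (?S n) * card (F n)" by (rule card_cartesian_product)
  also have "\<dots> \<le> (\<Prod>j<n. card (F j)) * card (F n)" using IH(2) by (rule mult_right_mono) simp
  finally have "card (?S (Suc n)) \<le> (\<Prod>j<Suc n. card (F j))" by simp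
  moreover have "finite (?S (Suc n))" using sub fin by (meson finite_surj)
  ultimately show ?case by blast
qed

lemma sum_UN_le:
  fixes u :: "'a \<Rightarrow> real"
  assumes "finite B" "\<And>b. b \<in> B \<Longrightarrow> finite (Y b)" "\<And>b a. b \<in> B \<Longrightarrow> a \<in> Y b \<Longrightarrow> 0 \<le> u a"
  shows "sum u (\<Union>b\<in>B. Y b) \<le> (\<Sum>b\<in>B. sum u (Y b))"
  using assms
proof (induction B rule: finite_induct)
  case (insert b B)
  let ?R = "\<Union>b\<in>B. Y b"
  have "sum u (Y b \<union> ?R) + sum u (Y b \<inter> ?R) = sum u (Y b) + sum u ?R"
    using insert by (intro sum.union_inter) auto
  moreover have "0 \<le> sum u (Y b \<inter> ?R)" using insert.prems by (intro sum_nonneg) auto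
  moreover have "sum u ?R \<le> (\<Sum>b\<in>B. sum u (Y b))" using insert by auto
  ultimately show ?case using insert.hyps by simp
qed simp

lemma countable_int_points: "countable (int_points n)"
proof -
  have "int_points n \<subseteq> (\<lambda>f j. if j < n then f j else 0) ` (PiE {..<n} (\<lambda>_. UNIV))"
  proof
    fix c assume "c \<in> int_points n"
    then have "c = (\<lambda>j. if j < n then restrict c {..<n} j else 0)" by (auto simp: int_points_def fun_eq_iff)
    moreover have "restrict c {..<n} \<in> PiE {..<n} (\<lambda>_. UNIV)" by auto
    ultimately show "c \<in> (\<lambda>f j. if j < n then f j else 0) ` (PiE {..<n} (\<lambda>_. UNIV))"
      by (rule image_eqI)
  qed
  moreover have "countable (PiE {..<n} (\<lambda>_. UNIV :: int set))" by (intro countable_PiE) auto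
  ultimately show ?thesis by (meson countable_image countable_subset)
qed

definition addr :: "nat \<Rightarrow> nat \<Rightarrow> nat \<Rightarrow> (nat \<Rightarrow> real) \<Rightarrow> nat \<Rightarrow> int" where
  "addr d n N y = (\<lambda>j. if j < n then \<lfloor>(2 ^ d) ^ N * y j\<rfloor> else 0)"

text \<open>Integer division rounds down for negative arguments too, so it matches the floors in
  \<open>addr\<close> on the whole lattice.\<close>

definition parent :: "nat \<Rightarrow> (nat \<Rightarrow> int) \<Rightarrow> nat \<Rightarrow> int" where
  "parent d c = (\<lambda>j. c j div 2 ^ d)"

lemma addr_in_int_points [simp]: "addr d n N y \<in> int_points n"
  by (simp add: addr_def int_points_def)

lemma parent_in_int_points: "c \<in> int_points n \<Longrightarrow> parent d c \<in> int_points n"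
  by (simp add: parent_def int_points_def)

lemma parent_addr: "parent d (addr d n (Suc N) y) = addr d n N y"
proof
  fix j
  have "\<lfloor>(2 ^ d) ^ Suc N * y j\<rfloor> div 2 ^ d = \<lfloor>((2 ^ d) ^ Suc N * y j) / real_of_int (2 ^ d)\<rfloor>"
    by (rule floor_divide_real_eq_div[symmetric]) simp
  also have "((2 ^ d) ^ Suc N * y j) / real_of_int (2 ^ d) = (2 ^ d) ^ N * y j" by simp
  finally show "parent d (addr d n (Suc N) y) j = addr d n N y j" by (simp add: parent_def addr_def)
qed

lemma child_coordinate: "parent d c = Q \<Longrightarrow> c j \<in> {2 ^ d * Q j..<2 ^ d * Q j + 2 ^ d}"
proof -
  assume "parent d c = Q"
  then have c: "Q j = c j div 2 ^ d" by (auto simp: parent_def)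
  have "c j = 2 ^ d * (c j div 2 ^ d) + c j mod 2 ^ d" by simp
  moreover have "0 \<le> c j mod 2 ^ d" "c j mod 2 ^ d < 2 ^ d" by auto
  ultimately show ?thesis unfolding c atLeastLessThan_iff by linarith
qed

text \<open>The cells at level \<open>N + 1\<close> carry a direction \<open>f N c\<close> and a multiplicity \<open>M N c\<close>; these
  choices are made once for the whole infinite tree of cells.\<close>
lemma tree_split:
  fixes p :: "nat \<Rightarrow> (nat \<Rightarrow> int) \<Rightarrow> real"
  assumes n: "1 \<le> n" and p: "\<And>N c. 0 \<le> p N c"
    and sub: "\<And>N Q A. finite A \<Longrightarrow> A \<subseteq> {a\<in>int_points n. parent d a = Q} \<Longrightarrow> sum (p (Suc N)) A \<le> p N Q"
  obtains f :: "nat \<Rightarrow> (nat \<Rightarrow> int) \<Rightarrow> nat" and M :: "nat \<Rightarrow> (nat \<Rightarrow> int) \<Rightarrow> real"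
  where "\<And>N c. c \<in> int_points n \<Longrightarrow> f N c < n"
    "\<And>N c. c \<in> int_points n \<Longrightarrow> 0 < M N c"
    "\<And>N c. c \<in> int_points n \<Longrightarrow> p (Suc N) c * M N c ^ n \<le> 2 ^ n * p N (parent d c)"
    "\<And>N i b Q X. i < n \<Longrightarrow> X \<subseteq> {a\<in>int_points n. parent d a = Q \<and> (\<forall>j. j \<noteq> i \<longrightarrow> a j = b j)} \<Longrightarrow>
      finite X \<and> (\<Sum>a\<in>X. if f N a = i then 1 / M N a else 1 / 2 ^ d) \<le> real d + 2"
proof -
  define ch where "ch Q = {a\<in>int_points n. parent d a = Q}" for Q
  have fin: "finite (ch Q)" for Q
  proof (rule finite_subset)
    show "ch Q \<subseteq> {c\<in>int_points n. \<forall>j<n. c j \<in> {2 ^ d * Q j..<2 ^ d * Q j + 2 ^ d}}"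
      using child_coordinate by (auto simp: ch_def)
    show "finite {c\<in>int_points n. \<forall>j<n. c j \<in> {2 ^ d * Q j..<2 ^ d * Q j + 2 ^ d}}"
      using card_box_points[of n "\<lambda>j. {2 ^ d * Q j..<2 ^ d * Q j + 2 ^ d}"] by blast
  qed
  have lines: "card {a\<in>ch Q. \<forall>j. j \<noteq> i \<longrightarrow> a j = b j} \<le> 2 ^ d" for Q i b
  proof -
    let ?X = "{a\<in>ch Q. \<forall>j. j \<noteq> i \<longrightarrow> a j = b j}"
    have "inj_on (\<lambda>a. a i) ?X"
    proof (rule inj_onI)
      fix x y assume *: "x \<in> ?X" "y \<in> ?X" "x i = y i"
      show "x = y"
      proof
        fix j show "x j = y j" using * by (cases "j = i") auto
      qed
    qed
    moreover have "(\<lambda>a. a i) ` ?X \<subseteq> {2 ^ d * Q i..<2 ^ d * Q i + 2 ^ d}"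
      using child_coordinate by (auto simp: ch_def)
    ultimately have "card ?X \<le> card {2 ^ d * Q i..<2 ^ d * Q i + 2 ^ d}"
      by (intro card_inj_on_le) auto
    then show ?thesis by (simp add: nat_power_eq)
  qed
  define G where "G N Q f M \<longleftrightarrow> (\<forall>a\<in>ch Q. f a < n \<and> 0 < M a \<and> p (Suc N) a * M a ^ n \<le> 2 ^ n * p N Q) \<and>
    (\<forall>i<n. \<forall>b. (\<Sum>a\<in>{a\<in>ch Q. f a = i \<and> (\<forall>j. j \<noteq> i \<longrightarrow> a j = b j)}. 1 / M a) \<le> real d + 1)" for N Q f M
  have "\<exists>f M. G N Q f M" for N Q
    unfolding G_def
    by (rule weighted_split_along_lines[OF fin n p sub[OF fin] lines]) (simp add: ch_def)
  then obtain f' M' where "\<And>N Q. G N Q (f' N Q) (M' N Q)" by metis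
  then have fM:
    "\<And>N Q a. a \<in> ch Q \<Longrightarrow> f' N Q a < n \<and> 0 < M' N Q a \<and> p (Suc N) a * M' N Q a ^ n \<le> 2 ^ n * p N Q"
    "\<And>N Q i b. i < n \<Longrightarrow> (\<Sum>a\<in>{a\<in>ch Q. f' N Q a = i \<and> (\<forall>j. j \<noteq> i \<longrightarrow> a j = b j)}. 1 / M' N Q a) \<le> real d + 1"
    unfolding G_def by blast+
  have inch: "c \<in> ch (parent d c)" if "c \<in> int_points n" for c using that by (simp add: ch_def)
  show ?thesis
  proof (rule that[of "\<lambda>N c. f' N (parent d c) c" "\<lambda>N c. M' N (parent d c) c"])
    fix N i b Q X
    assume i: "i < n" and X: "X \<subseteq> {a\<in>int_points n. parent d a = Q \<and> (\<forall>j. j \<noteq> i \<longrightarrow> a j = b j)}"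
    have Xch: "X \<subseteq> {a\<in>ch Q. \<forall>j. j \<noteq> i \<longrightarrow> a j = b j}" using X by (auto simp: ch_def)
    then have finX: "finite X" using fin[of Q] by (auto intro: finite_subset)
    have "card X \<le> card {a\<in>ch Q. \<forall>j. j \<noteq> i \<longrightarrow> a j = b j}" by (rule card_mono[OF _ Xch]) (use fin in auto)
    also have "\<dots> \<le> 2 ^ d" by (rule lines)
    finally have cX: "real (card X) \<le> 2 ^ d" by (rule real_le_two_power)
    let ?Y = "{a\<in>ch Q. f' N Q a = i \<and> (\<forall>j. j \<noteq> i \<longrightarrow> a j = b j)}"
    have "(\<Sum>a\<in>X. if f' N (parent d a) a = i then 1 / M' N (parent d a) a else 1 / 2 ^ d)
      = (\<Sum>a\<in>X. if f' N Q a = i then 1 / M' N Q a else 1 / 2 ^ d)"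
      using X by (intro sum.cong) auto
    \<comment> \<open>At most \<open>2 ^ d\<close> children lie on the line, so those assigned to
      other directions contribute at most 1 beyond the \<open>d + 1\<close> of the assigned
      ones.\<close>
    also have "\<dots> \<le> (\<Sum>a\<in>X. (if f' N Q a = i then 1 / M' N Q a else 0) + 1 / 2 ^ d)"
      using fM(1)[of _ Q] Xch by (intro sum_mono) (auto simp: less_imp_le)
    also have "\<dots> = (\<Sum>a\<in>{a\<in>X. f' N Q a = i}. 1 / M' N Q a) + real (card X) / 2 ^ d"
      using finX by (simp add: sum.distrib sum.If_cases Int_def)
    also have "\<dots> \<le> (\<Sum>a\<in>?Y. 1 / M' N Q a) + 1"
    proof (rule add_mono)
      show "(\<Sum>a\<in>{a\<in>X. f' N Q a = i}. 1 / M' N Q a) \<le> (\<Sum>a\<in>?Y. 1 / M' N Q a)"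
        using fM(1)[of _ Q] Xch fin[of Q] by (intro sum_mono2) (auto simp: less_imp_le)
      show "real (card X) / 2 ^ d \<le> 1" using cX by simp
    qed
    also have "\<dots> \<le> real d + 2" using fM(2)[OF i, where Q=Q and N=N and b=b] by simp
    finally show "finite X \<and> (\<Sum>a\<in>X. if f' N (parent d a) a = i then 1 / M' N (parent d a) a else 1 / 2 ^ d) \<le> real d + 2"
      using finX by simp
  qed (use fM inch in auto)
qed

text \<open>\<open>weight i\<close> is a budget for curves running nearly in direction \<open>i\<close>: its sum over the cells of
  level \<open>N\<close> met by such a curve is at most exponential in \<open>N\<close> with a base logarithmic in \<open>2 ^ d\<close>.\<close>
primrec weight :: "nat \<Rightarrow> (nat \<Rightarrow> (nat \<Rightarrow> int) \<Rightarrow> nat) \<Rightarrow> (nat \<Rightarrow> (nat \<Rightarrow> int) \<Rightarrow> real) \<Rightarrow> nat \<Rightarrow> nat \<Rightarrow> (nat \<Rightarrow> int) \<Rightarrow> real" where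
  "weight d f M i 0 c = 1"
| "weight d f M i (Suc N) c = weight d f M i N (parent d c) * (if f N c = i then 1 / M N c else 1 / 2 ^ d)"

text \<open>The link between weights and mass: the product of the normalised weights is inversely
  proportional to this quantity, and a cell of large mass cannot make it large.\<close>

primrec mult_prod :: "nat \<Rightarrow> (nat \<Rightarrow> (nat \<Rightarrow> int) \<Rightarrow> real) \<Rightarrow> nat \<Rightarrow> (nat \<Rightarrow> int) \<Rightarrow> real" where
  "mult_prod d M 0 c = 1"
| "mult_prod d M (Suc N) c = mult_prod d M N (parent d c) * M N c"

lemma weight_nonneg:
  assumes "\<And>N c. c \<in> int_points n \<Longrightarrow> 0 < M N c" "c \<in> int_points n"
  shows "0 \<le> weight d f M i N c" "0 < mult_prod d M N c"
  using assms(2) by (induction N arbitrary: c) (auto simp: assms(1) parent_in_int_points less_imp_le)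

text \<open>At every level exactly one direction receives the factor \<open>1 / M\<close> and all
  others \<open>1 / 2 ^ d\<close>. After normalisation by \<open>2 ^ d\<close> only one factor per
  level differs from 1.\<close>

lemma prod_weight:
  assumes f: "\<And>N c. c \<in> int_points n \<Longrightarrow> f N c < n"
    and M: "\<And>N c. c \<in> int_points n \<Longrightarrow> 0 < M N c" and c: "c \<in> int_points n"
  shows "(\<Prod>i<n. (2 ^ d) ^ N * weight d f M i N c) = (2 ^ d) ^ N / mult_prod d M N c"
  using c
proof (induction N arbitrary: c)
  case (Suc N)
  have "(\<Prod>i<n. (2 ^ d) ^ Suc N * weight d f M i (Suc N) c) =
    (\<Prod>i<n. ((2 ^ d) ^ N * weight d f M i N (parent d c)) * (if f N c = i then 2 ^ d / M N c else 1))"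
    by (intro prod.cong) auto
  also have "\<dots> = (\<Prod>i<n. (2 ^ d) ^ N * weight d f M i N (parent d c)) * (\<Prod>i<n. if f N c = i then 2 ^ d / M N c else 1)"
    by (rule prod.distrib)
  also have "(\<Prod>i<n. (2 ^ d) ^ N * weight d f M i N (parent d c)) = (2 ^ d) ^ N / mult_prod d M N (parent d c)"
    by (rule Suc.IH[OF parent_in_int_points[OF Suc.prems]])
  also have "(\<Prod>i<n. if f N c = i then 2 ^ d / M N c else 1) = 2 ^ d / M N c"
    using f[OF Suc.prems, of N] by (simp add: prod.delta')
  finally show ?case by simp
qed simp

text \<open>The one-step bounds telescope along the chain of ancestors.\<close>

lemma mass_mult_prod:
  assumes M: "\<And>N c. c \<in> int_points n \<Longrightarrow> 0 < M N c"
    and pM: "\<And>N c. c \<in> int_points n \<Longrightarrow> p (Suc N) c * M N c ^ n \<le> 2 ^ n * p N (parent d c)"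
    and V: "\<And>c. p 0 c \<le> V" and c: "c \<in> int_points n"
  shows "p N c * mult_prod d M N c ^ n \<le> (2 ^ n) ^ N * V"
  using c
proof (induction N arbitrary: c)
  case (Suc N)
  let ?m = "mult_prod d M N (parent d c)"
  have m: "0 < ?m" by (rule weight_nonneg[OF M parent_in_int_points[OF Suc.prems]])
  have "p (Suc N) c * mult_prod d M (Suc N) c ^ n = p (Suc N) c * M N c ^ n * ?m ^ n"
    by (simp add: power_mult_distrib)
  also have "\<dots> \<le> 2 ^ n * p N (parent d c) * ?m ^ n" using pM[OF Suc.prems] m by (intro mult_right_mono) auto
  also have "\<dots> \<le> 2 ^ n * ((2 ^ n) ^ N * V)"
    using Suc.IH[OF parent_in_int_points[OF Suc.prems]] by (simp add: mult.assoc)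
  finally show ?case by simp
qed (simp add: V)

text \<open>A cell passes its weight on to those children that \<open>X\<close> contains. By
  \<open>cov\<close> these lie on at most \<open>2 ^ n\<close> lines in direction \<open>i\<close>,
  and by \<open>lines\<close> the factors along one line sum to at most \<open>d + 2\<close>.
  \<open>cov\<close> is the only trace of the geometry of the curve.\<close>

lemma sum_weight_le:
  assumes M: "\<And>N c. c \<in> int_points n \<Longrightarrow> 0 < M N c"
    and lines: "\<And>N b Q X. X \<subseteq> {a\<in>int_points n. parent d a = Q \<and> (\<forall>j. j \<noteq> i \<longrightarrow> a j = b j)} \<Longrightarrow>
      finite X \<and> (\<Sum>a\<in>X. if f N a = i then 1 / M N a else 1 / 2 ^ d) \<le> real d + 2"
    and X: "\<And>N. X N \<subseteq> int_points n" "finite (X 0)" "\<And>N c. c \<in> X (Suc N) \<Longrightarrow> parent d c \<in> X N"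
    and cov: "\<And>N Q. Q \<in> X N \<Longrightarrow> \<exists>B. finite B \<and> card B \<le> 2 ^ n \<and>
      (\<forall>a\<in>X (Suc N). parent d a = Q \<longrightarrow> (\<exists>b\<in>B. \<forall>j. j \<noteq> i \<longrightarrow> a j = b j))"
  shows "finite (X N) \<and> (\<Sum>c\<in>X N. weight d f M i N c) \<le> real (card (X 0)) * (2 ^ n * (real d + 2)) ^ N"
proof (induction N)
  case (Suc N)
  define u where "u a = (if f N a = i then 1 / M N a else 1 / 2 ^ d)" for a
  define C where "C Q = {a\<in>X (Suc N). parent d a = Q}" for Q
  have u0: "0 \<le> u a" if "a \<in> X (Suc N)" for a using that X(1)[of "Suc N"] M[of a N] by (auto simp: u_def less_imp_le)
  have C: "finite (C Q) \<and> sum u (C Q) \<le> 2 ^ n * (real d + 2)" if Q: "Q \<in> X N" for Q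
  proof -
    obtain B where B: "finite B" "card B \<le> 2 ^ n"
      "\<And>a. a \<in> X (Suc N) \<Longrightarrow> parent d a = Q \<Longrightarrow> \<exists>b\<in>B. \<forall>j. j \<noteq> i \<longrightarrow> a j = b j"
      using cov[OF Q] by blast
    define Y where "Y b = {a\<in>C Q. \<forall>j. j \<noteq> i \<longrightarrow> a j = b j}" for b
    have Y: "finite (Y b)" "sum u (Y b) \<le> real d + 2" for b
      using lines[of "Y b" Q b N] X(1)[of "Suc N"] by (auto simp: Y_def C_def u_def[abs_def])
    have CY: "C Q \<subseteq> (\<Union>b\<in>B. Y b)" using B(3) by (force simp: C_def Y_def)
    then have "finite (C Q)" using Y B(1) by (meson finite_UN_I finite_subset)
    moreover have "sum u (C Q) \<le> 2 ^ n * (real d + 2)"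
    proof -
      have "sum u (C Q) \<le> sum u (\<Union>b\<in>B. Y b)"
        by (rule sum_mono2) (use CY Y B u0 in \<open>auto simp: Y_def C_def\<close>)
      also have "\<dots> \<le> (\<Sum>b\<in>B. sum u (Y b))"
        using B(1) Y(1) u0 by (intro sum_UN_le) (auto simp: Y_def C_def)
      also have "\<dots> \<le> (\<Sum>b\<in>B. real d + 2)" using Y(2) by (intro sum_mono)
      also have "\<dots> = real (card B) * (real d + 2)" by simp
      also have "\<dots> \<le> 2 ^ n * (real d + 2)"
        using real_le_two_power[OF B(2)] by (intro mult_right_mono) auto
      finally show ?thesis .
    qed
    ultimately show ?thesis by blast
  qed
  have XC: "X (Suc N) = (\<Union>Q\<in>X N. C Q)" using X(3) by (auto simp: C_def)
  have fin: "finite (X (Suc N))" unfolding XC using Suc.IH C by auto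
  have "(\<Sum>c\<in>X (Suc N). weight d f M i (Suc N) c) = (\<Sum>c\<in>X (Suc N). weight d f M i N (parent d c) * u c)"
    by (simp add: u_def)
  also have "\<dots> = (\<Sum>Q\<in>X N. \<Sum>c\<in>{c\<in>X (Suc N). parent d c = Q}. weight d f M i N (parent d c) * u c)"
    using fin Suc.IH X(3) by (intro sum.group[symmetric]) auto
  also have "\<dots> = (\<Sum>Q\<in>X N. weight d f M i N Q * sum u (C Q))"
    by (intro sum.cong refl) (auto simp: C_def sum_distrib_left)
  also have "\<dots> \<le> (\<Sum>Q\<in>X N. weight d f M i N Q * (2 ^ n * (real d + 2)))"
    using C X(1)[of N] by (intro sum_mono mult_left_mono weight_nonneg[OF M]) auto
  also have "\<dots> = (\<Sum>Q\<in>X N. weight d f M i N Q) * (2 ^ n * (real d + 2))" by (simp add: sum_distrib_right)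
  also have "\<dots> \<le> real (card (X 0)) * (2 ^ n * (real d + 2)) ^ N * (2 ^ n * (real d + 2))"
    using Suc.IH by (intro mult_right_mono) auto
  finally show ?case using fin by (simp add: mult_ac)
qed (use X(2) in simp)

text \<open>The product of the weights over all directions is controlled by the mass of the cell.\<close>
lemma heavy_direction:
  fixes p :: "nat \<Rightarrow> (nat \<Rightarrow> int) \<Rightarrow> real"
  assumes n: "1 \<le> n"
    and f: "\<And>N c. c \<in> int_points n \<Longrightarrow> f N c < n"
    and M: "\<And>N c. c \<in> int_points n \<Longrightarrow> 0 < M N c"
    and pM: "\<And>N c. c \<in> int_points n \<Longrightarrow> p (Suc N) c * M N c ^ n \<le> 2 ^ n * p N (parent d c)"
    and V: "\<And>c. p 0 c \<le> V" "0 \<le> V" and c: "c \<in> int_points n"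
    and \<beta>: "0 < \<beta>" "\<beta> ^ (n * n) * 2 ^ n \<le> \<sigma> * (2 ^ d) ^ n" and \<sigma>: "0 < \<sigma>" "\<sigma> ^ N \<le> p N c"
  shows "\<exists>i<n. 1 / (V + 1) * \<beta> ^ N \<le> (2 ^ d) ^ N * weight d f M i N c"
proof (rule ccontr)
  assume neg: "\<not> ?thesis"
  \<comment> \<open>This choice gives both \<open>b <= 1\<close> and \<open>b * V < 1\<close>; one
    power of \<open>b\<close> then outweighs the total mass without a root of \<open>V\<close>, and
    \<open>V = 0\<close> is allowed.\<close>
  define b where "b = 1 / (V + 1)"
  have b: "0 < b" "b \<le> 1" "b * V < 1" using V(2) by (auto simp: b_def field_simps)
  define y where "y = b * \<beta> ^ N"
  let ?m = "mult_prod d M N c"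
  have m: "0 < ?m" by (rule weight_nonneg[OF M c])
  have y: "0 < y" using b \<beta> by (simp add: y_def)
  \<comment> \<open>If all normalised weights were below \<open>y\<close>, their product would force
    \<open>?m\<close> to be at least \<open>(2 ^ d) ^ N / y ^ n\<close>, too large for a cell of
    mass at least \<open>\<sigma> ^ N\<close>.\<close>
  have "(2 ^ d) ^ N / ?m = (\<Prod>i<n. (2 ^ d) ^ N * weight d f M i N c)"
    by (rule prod_weight[OF f M c, symmetric])
  also have "\<dots> \<le> (\<Prod>i<n. y)"
    using neg weight_nonneg(1)[OF M c] by (intro prod_mono) (auto simp: y_def b_def not_le less_imp_le)
  finally have "(2 ^ d) ^ N \<le> y ^ n * ?m" using m by (simp add: field_simps)
  then have "((2 ^ d) ^ N) ^ n \<le> (y ^ n * ?m) ^ n" by (rule power_mono) simp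
  then have "\<sigma> ^ N * ((2 ^ d) ^ N) ^ n \<le> p N c * (y ^ n * ?m) ^ n"
    using \<sigma> m y by (intro mult_mono) (auto intro: order.trans[OF zero_le_power \<sigma>(2)])
  also have "\<dots> = (p N c * ?m ^ n) * y ^ (n * n)" by (simp add: power_mult_distrib power_mult)
  also have "\<dots> \<le> ((2 ^ n) ^ N * V) * y ^ (n * n)"
    using y mass_mult_prod[of n M p d V c N, OF M pM V(1) c] by (intro mult_right_mono) auto
  also have "\<dots> = b ^ (n * n) * V * (\<beta> ^ (n * n) * 2 ^ n) ^ N"
    by (simp add: y_def power_mult_distrib mult_ac flip: power_mult)
  also have "\<dots> \<le> b * V * (\<sigma> * (2 ^ d) ^ n) ^ N"
  proof (rule mult_mono)
    show "b ^ (n * n) * V \<le> b * V"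
      using power_decreasing[of 1 "n * n" b] b n V(2) by (intro mult_right_mono) auto
    show "(\<beta> ^ (n * n) * 2 ^ n) ^ N \<le> (\<sigma> * (2 ^ d) ^ n) ^ N"
      using \<beta> by (intro power_mono) auto
  qed (use b V \<beta> \<sigma> in auto)
  also have "\<dots> < 1 * (\<sigma> * (2 ^ d) ^ n) ^ N" using b \<sigma> by (intro mult_strict_right_mono) auto
  also have "\<dots> = \<sigma> ^ N * ((2 ^ d) ^ N) ^ n" by (simp add: power_mult_distrib mult_ac flip: power_mult)
  finally show False by simp
qed

section \<open>Fragments nearly in one direction meet few heavy cells\<close>

lemma floor_eq_abs_diff_less_1:
  fixes x y :: real
  shows "\<lfloor>x\<rfloor> = \<lfloor>y\<rfloor> \<Longrightarrow> \<bar>x - y\<bar> < 1"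
  by linarith

text \<open>Applied to the coordinates transverse to a fragment: inside one cell each of them meets
  at most two layers of children.\<close>

lemma floor_two_values:
  fixes h :: "'b \<Rightarrow> real"
  assumes "\<And>t t'. t \<in> T \<Longrightarrow> t' \<in> T \<Longrightarrow> \<bar>h t - h t'\<bar> < 1"
  shows "\<exists>z. \<forall>t\<in>T. \<lfloor>h t\<rfloor> \<in> {z, z + 1}"
proof (cases "T = {}")
  case False
  then obtain t0 where t0: "t0 \<in> T" by auto
  have near: "\<bar>\<lfloor>h t\<rfloor> - \<lfloor>h t'\<rfloor>\<bar> \<le> 1" if "t \<in> T" "t' \<in> T" for t t' using assms[OF that] by linarith
  show ?thesis
  proof (cases "\<exists>t\<in>T. \<lfloor>h t\<rfloor> < \<lfloor>h t0\<rfloor>")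
    case True
    then obtain t1 where "t1 \<in> T" "\<lfloor>h t1\<rfloor> < \<lfloor>h t0\<rfloor>" by auto
    then have "\<forall>t\<in>T. \<lfloor>h t\<rfloor> \<in> {\<lfloor>h t0\<rfloor> - 1, \<lfloor>h t0\<rfloor> - 1 + 1}"
      using near[of t1] near[of _ t0] t0 by fastforce
    then show ?thesis by blast
  next
    case False
    then have "\<forall>t\<in>T. \<lfloor>h t\<rfloor> \<in> {\<lfloor>h t0\<rfloor>, \<lfloor>h t0\<rfloor> + 1}" using near[of _ t0] t0 by fastforce
    then show ?thesis by blast
  qed
qed auto

text \<open>The total weight of the cells met by the fragment grows at most by the factor
  \<open>2 ^ n * (d + 2) < \<beta>\<close> per level, so few of these cells have weight at least \<open>b * \<beta> ^ N / (2 ^ d) ^ N\<close>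
  and the Borel--Cantelli lemma applies.\<close>
lemma fragment_negligible:
  fixes g :: "real \<Rightarrow> nat \<Rightarrow> real"
  assumes i: "i < n"
    and M: "\<And>N c. c \<in> int_points n \<Longrightarrow> 0 < M N c"
    and lines: "\<And>N b Q X. X \<subseteq> {a\<in>int_points n. parent d a = Q \<and> (\<forall>j. j \<noteq> i \<longrightarrow> a j = b j)} \<Longrightarrow>
      finite X \<and> (\<Sum>a\<in>X. if f N a = i then 1 / M N a else 1 / 2 ^ d) \<le> real d + 2"
    and bdd: "\<And>t j. t \<in> T \<Longrightarrow> j < n \<Longrightarrow> \<bar>g t j\<bar> \<le> R"
    and c: "0 < c" "\<And>t t'. t \<in> T \<Longrightarrow> t' \<in> T \<Longrightarrow> c * \<bar>t - t'\<bar> \<le> \<bar>g t i - g t' i\<bar>"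
    and cone: "\<And>t t' j. t \<in> T \<Longrightarrow> t' \<in> T \<Longrightarrow> j < n \<Longrightarrow> j \<noteq> i \<Longrightarrow> \<bar>g t j - g t' j\<bar> \<le> 1 / 2 ^ d * \<bar>g t i - g t' i\<bar>"
    and b: "0 < b" and \<beta>: "2 ^ n * (real d + 2) < \<beta>"
    and inf: "\<And>t. t \<in> T \<Longrightarrow> \<exists>\<^sub>\<infinity>N. b * \<beta> ^ N \<le> (2 ^ d) ^ N * weight d f M i N (addr d n N (g t))"
  shows "negligible T"
proof -
  define A where "A N t = addr d n N (g t)" for N t
  define X where "X N = A N ` T" for N
  define \<Lambda> where "\<Lambda> = 2 ^ n * (real d + 2)"
  have \<Lambda>: "0 < \<Lambda>" "\<Lambda> < \<beta>" using \<beta> by (auto simp: \<Lambda>_def)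
  have XI: "X N \<subseteq> int_points n" for N by (auto simp: X_def A_def)
  have X0: "finite (X 0)"
  proof (rule finite_subset)
    show "X 0 \<subseteq> {c\<in>int_points n. \<forall>j<n. c j \<in> {- \<lceil>R\<rceil> - 1..\<lceil>R\<rceil>}}"
    proof safe
      fix a j assume "a \<in> X 0" "j < n"
      then obtain t where t: "t \<in> T" "a j = \<lfloor>g t j\<rfloor>" by (auto simp: X_def A_def addr_def)
      have "\<bar>g t j\<bar> \<le> R" by (rule bdd[OF t(1) \<open>j < n\<close>])
      then show "a j \<in> {- \<lceil>R\<rceil> - 1..\<lceil>R\<rceil>}" unfolding t(2) atLeastAtMost_iff by linarith
    qed (use XI in auto)
    show "finite {c\<in>int_points n. \<forall>j<n. c j \<in> {- \<lceil>R\<rceil> - 1..\<lceil>R\<rceil>}}"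
      using card_box_points[of n "\<lambda>_. {- \<lceil>R\<rceil> - 1..\<lceil>R\<rceil>}"] by blast
  qed
  have same: "\<bar>(2 ^ d) ^ N * g t i - (2 ^ d) ^ N * g t' i\<bar> < 1" if "A N t = A N t'" for N t t'
    using fun_cong[OF that, of i] i by (intro floor_eq_abs_diff_less_1) (simp add: A_def addr_def)
  have same': "\<bar>g t i - g t' i\<bar> < 1 / (2 ^ d) ^ N" if "A N t = A N t'" for N t t'
  proof -
    have "(2 ^ d) ^ N * \<bar>g t i - g t' i\<bar> < 1"
      using same[OF that] by (simp add: abs_mult flip: right_diff_distrib)
    then show ?thesis by (simp add: field_simps)
  qed
  have cov: "\<exists>B. finite B \<and> card B \<le> 2 ^ n \<and>
      (\<forall>a\<in>X (Suc N). parent d a = Q \<longrightarrow> (\<exists>b\<in>B. \<forall>j. j \<noteq> i \<longrightarrow> a j = b j))" if "Q \<in> X N" for N Q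
  proof -
    define TQ where "TQ = {t\<in>T. A N t = Q}"
    \<comment> \<open>The aperture \<open>1 / 2 ^ d\<close> equals the ratio of two consecutive
      levels. Inside a cell of level \<open>N\<close> the \<open>i\<close>-th coordinate varies by
      less than its side, so every other coordinate varies by less than the side of a child.\<close>
    have "\<exists>z. \<forall>t\<in>TQ. \<lfloor>(2 ^ d) ^ Suc N * g t j\<rfloor> \<in> {z, z + 1}" if j: "j < n" "j \<noteq> i" for j
    proof (rule floor_two_values)
      fix t t' assume t: "t \<in> TQ" "t' \<in> TQ"
      then have AA: "A N t = A N t'" "t \<in> T" "t' \<in> T" by (auto simp: TQ_def)
      have "\<bar>(2 ^ d) ^ Suc N * g t j - (2 ^ d) ^ Suc N * g t' j\<bar> = (2 ^ d) ^ Suc N * \<bar>g t j - g t' j\<bar>"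
        by (simp add: abs_mult flip: right_diff_distrib)
      also have "\<dots> \<le> (2 ^ d) ^ Suc N * (1 / 2 ^ d * \<bar>g t i - g t' i\<bar>)"
        by (intro mult_left_mono cone AA j) auto
      also have "\<dots> = (2 ^ d) ^ N * \<bar>g t i - g t' i\<bar>" by simp
      also have "\<dots> < (2 ^ d) ^ N * (1 / (2 ^ d) ^ N)" by (intro mult_strict_left_mono same'[OF AA(1)]) auto
      finally show "\<bar>(2 ^ d) ^ Suc N * g t j - (2 ^ d) ^ Suc N * g t' j\<bar> < 1" by simp
    qed
    then obtain z where z: "\<And>j t. j < n \<Longrightarrow> j \<noteq> i \<Longrightarrow> t \<in> TQ \<Longrightarrow> \<lfloor>(2 ^ d) ^ Suc N * g t j\<rfloor> \<in> {z j, z j + 1}"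
      by metis
    \<comment> \<open>A line in direction \<open>i\<close> is represented by its point with
      \<open>i\<close>-th coordinate 0, so \<open>B\<close> counts lines.\<close>
    define F where "F j = (if j = i then {0} else {z j, z j + 1})" for j
    define B where "B = {c\<in>int_points n. \<forall>j<n. c j \<in> F j}"
    have "finite B \<and> card B \<le> (\<Prod>j<n. card (F j))"
      unfolding B_def by (rule card_box_points) (simp add: F_def)
    moreover have "(\<Prod>j<n. card (F j)) \<le> (\<Prod>j<n. 2)"
      by (intro prod_mono) (auto simp: F_def)
    ultimately have B: "finite B" "card B \<le> 2 ^ n" by auto
    have "\<exists>b\<in>B. \<forall>j. j \<noteq> i \<longrightarrow> a j = b j" if a: "a \<in> X (Suc N)" "parent d a = Q" for a
    proof -
      obtain t where t: "t \<in> T" "a = A (Suc N) t" using a(1) by (auto simp: X_def)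
      then have tQ: "t \<in> TQ" using a(2) by (auto simp: TQ_def A_def parent_addr)
      have "a(i := 0) \<in> B"
        using z[OF _ _ tQ] t(2) i by (auto simp: B_def F_def A_def addr_def int_points_def)
      then show ?thesis by (intro bexI[of _ "a(i := 0)"]) auto
    qed
    then show ?thesis using B by blast
  qed
  have sumX: "finite (X N) \<and> (\<Sum>a\<in>X N. weight d f M i N a) \<le> real (card (X 0)) * \<Lambda> ^ N" for N
    unfolding \<Lambda>_def
  proof (rule sum_weight_le[OF M lines XI X0 _ cov])
    show "parent d a \<in> X N" if "a \<in> X (Suc N)" for N a using that by (auto simp: X_def A_def parent_addr)
  qed auto
  define G where "G N = {a\<in>X N. b * \<beta> ^ N \<le> (2 ^ d) ^ N * weight d f M i N a}" for N
  have finG: "finite (G N)" for N using sumX by (simp add: G_def)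
  have cardG: "real (card (G N)) \<le> real (card (X 0)) / b * (2 ^ d) ^ N * (\<Lambda> / \<beta>) ^ N" for N
  proof -
    have "real (card (G N)) * (b * \<beta> ^ N) \<le> (\<Sum>a\<in>G N. (2 ^ d) ^ N * weight d f M i N a)"
      using sum_bounded_below[of "G N" "b * \<beta> ^ N" "\<lambda>a. (2 ^ d) ^ N * weight d f M i N a"] by (simp add: G_def)
    also have "\<dots> \<le> (\<Sum>a\<in>X N. (2 ^ d) ^ N * weight d f M i N a)"
    proof (rule sum_mono2)
      fix a assume "a \<in> X N - G N"
      then have "a \<in> int_points n" using XI by blast
      then have "0 \<le> weight d f M i N a" by (intro weight_nonneg(1)[where n = n]) (auto intro: M)
      then show "0 \<le> (2 ^ d) ^ N * weight d f M i N a" by simp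
    qed (use sumX[of N] in \<open>auto simp: G_def\<close>)
    also have "\<dots> \<le> (2 ^ d) ^ N * (real (card (X 0)) * \<Lambda> ^ N)"
      unfolding sum_distrib_left[symmetric] using sumX[of N] by (intro mult_left_mono) auto
    finally show ?thesis using b \<Lambda> by (simp add: field_simps power_divide)
  qed
  define \<tau> where "\<tau> N a = (SOME t. t \<in> T \<and> A N t = a)" for N a
  have \<tau>: "\<tau> N a \<in> T \<and> A N (\<tau> N a) = a" if "a \<in> X N" for N a
    unfolding \<tau>_def by (rule someI_ex) (use that in \<open>auto simp: X_def\<close>)
  \<comment> \<open>By the lower bound \<open>c\<close>, times whose points share a cell of level
    \<open>N\<close> are less than \<open>r N\<close> apart. One interval around the representative
    \<open>\<tau> N a\<close> covers all times spent in the cell \<open>a\<close>.\<close>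
  define r where "r N = 1 / (c * (2 ^ d) ^ N)" for N
  define S where "S N = (\<Union>a\<in>G N. {\<tau> N a - r N..\<tau> N a + r N})" for N
  have r0: "0 < r N" for N using c by (simp add: r_def)
  have S1: "S N \<in> sets lborel" for N using finG by (auto simp: S_def)
  have S2: "emeasure lborel (S N) < \<infinity>" for N
    using finG unfolding S_def by (intro emeasure_bounded_finite bounded_UN) auto
  \<comment> \<open>The factor \<open>(2 ^ d) ^ N\<close> in the number of heavy cells cancels
    against the length of the intervals and leaves a geometric series of ratio
    \<open>\<Lambda> / \<beta> < 1\<close>.\<close>
  have S3: "measure lborel (S N) \<le> 2 * real (card (X 0)) / (b * c) * (\<Lambda> / \<beta>) ^ N" for N
  proof -
    have "measure lborel (S N) \<le> (\<Sum>a\<in>G N. measure lborel {\<tau> N a - r N..\<tau> N a + r N})"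
      unfolding S_def using finG by (intro measure_UNION_le) auto
    also have "\<dots> = real (card (G N)) * (2 * r N)" using r0[of N] by simp
    also have "\<dots> \<le> real (card (X 0)) / b * (2 ^ d) ^ N * (\<Lambda> / \<beta>) ^ N * (2 * r N)"
      using r0[of N] cardG by (intro mult_right_mono) auto
    also have "\<dots> = 2 * real (card (X 0)) / (b * c) * (\<Lambda> / \<beta>) ^ N" using c by (simp add: r_def)
    finally show ?thesis .
  qed
  have "summable (\<lambda>N. measure lborel (S N))"
  proof (rule summable_comparison_test')
    show "summable (\<lambda>N. 2 * real (card (X 0)) / (b * c) * (\<Lambda> / \<beta>) ^ N)"
      using \<Lambda> by (intro summable_mult summable_geometric) auto
    show "norm (measure lborel (S N)) \<le> 2 * real (card (X 0)) / (b * c) * (\<Lambda> / \<beta>) ^ N" for N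
      using S3 by simp
  qed
  then have "AE x in lborel. \<forall>\<^sub>F N in sequentially. x \<in> space lborel - S N"
    by (rule borel_cantelli_AE1[OF S1 S2])
  then obtain Z where Z: "Z \<in> null_sets lborel" "{x. \<not> (\<forall>\<^sub>F N in sequentially. x \<notin> S N)} \<subseteq> Z"
    by (auto simp: eventually_ae_filter)
  have "T \<subseteq> Z"
  proof
    fix t assume t: "t \<in> T"
    have "t \<in> S N" if N: "b * \<beta> ^ N \<le> (2 ^ d) ^ N * weight d f M i N (addr d n N (g t))" for N
    proof -
      have aX: "A N t \<in> X N" using t by (simp add: X_def)
      then have aG: "A N t \<in> G N" using N by (simp add: G_def A_def)
      have \<tau>': "\<tau> N (A N t) \<in> T" "A N (\<tau> N (A N t)) = A N t" using \<tau>[OF aX] by auto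
      have "c * \<bar>t - \<tau> N (A N t)\<bar> \<le> \<bar>g t i - g (\<tau> N (A N t)) i\<bar>" by (rule c(2)[OF t \<tau>'(1)])
      also have "\<dots> < 1 / (2 ^ d) ^ N" by (rule same'[OF \<tau>'(2)[symmetric]])
      finally have "\<bar>t - \<tau> N (A N t)\<bar> \<le> r N" using c by (simp add: r_def field_simps)
      then have "t \<in> {\<tau> N (A N t) - r N..\<tau> N (A N t) + r N}" by auto
      then show ?thesis using aG unfolding S_def by blast
    qed
    then have "\<exists>\<^sub>\<infinity>N. t \<in> S N" using inf[OF t] by (rule INFM_mono[rotated])
    then have "\<not> (\<forall>\<^sub>F N in sequentially. t \<notin> S N)"
      by (simp add: frequently_def cofinite_eq_sequentially)
    then show "t \<in> Z" using Z(2) by blast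
  qed
  then show ?thesis using Z(1) by (meson negligible_iff_null_sets negligible_subset null_sets_completionI)
qed

text \<open>Equality in the last condition gives \<open>\<beta> = 2 powr (d * e - 1 / n)\<close>
  with \<open>e = (n - s) / (n * n)\<close>. This grows exponentially in \<open>d\<close>, whereas
  \<open>2 ^ n * (d + 2)\<close> grows linearly.\<close>

lemma exists_scale:
  assumes s: "s < real n" and n: "1 \<le> n"
  shows "\<exists>d \<beta>. 1 \<le> d \<and> 0 < \<beta> \<and> 2 ^ n * (real d + 2) < \<beta> \<and>
    \<beta> ^ (n * n) * 2 ^ n \<le> (2 ^ d) powr (- s) * (2 ^ d) ^ n"
proof -
  define e where "e = (real n - s) / (n * n)"
  have e: "0 < e" using s n by (simp add: e_def)
  define x where "x = (2::real) powr (- e)"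
  have x: "0 < x" "x < 1" using e powr_less_mono[of "- e" 0 2] by (auto simp: x_def)
  define C where "C = (2::real) powr (- 1 / n) / 2 ^ n"
  have C: "0 < C" by (simp add: C_def)
  have "(\<lambda>d. real d * x ^ d + 2 * x ^ d) \<longlonglongrightarrow> 0 + 2 * 0"
    using x by (intro tendsto_intros powser_times_n_limit_0 LIMSEQ_power_zero) auto
  then have "\<forall>\<^sub>F d in sequentially. real d * x ^ d + 2 * x ^ d < C"
    using order_tendstoD(2)[of _ 0 sequentially C] C by auto
  then have "\<forall>\<^sub>F d in sequentially. real d * x ^ d + 2 * x ^ d < C \<and> 1 \<le> d"
    using eventually_ge_at_top[of 1] by (rule eventually_conj)
  then obtain d :: nat where d: "real d * x ^ d + 2 * x ^ d < C" "1 \<le> d"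
    using eventually_happens'[OF sequentially_bot] by blast
  define \<beta> where "\<beta> = (2::real) powr (d * e - 1 / n)"
  have xd: "x ^ d = 2 powr (- (d * e))" by (simp add: x_def powr_power mult.commute)
  have "(real d + 2) * x ^ d < C" using d by (simp add: algebra_simps)
  then have "(real d + 2) * x ^ d * 2 powr (d * e) < C * 2 powr (d * e)" by simp
  also have "(real d + 2) * x ^ d * 2 powr (d * e) = real d + 2"
    by (simp add: xd mult.assoc flip: powr_add)
  also have "C * 2 powr (d * e) = \<beta> / 2 ^ n" by (simp add: C_def \<beta>_def flip: powr_add)
  finally have 1: "2 ^ n * (real d + 2) < \<beta>" by (simp add: field_simps)
  have nn: "real (n * n) * (d * e - 1 / n) = d * (real n - s) - n"
    using n by (simp add: e_def field_simps)
  have "\<beta> ^ (n * n) = 2 powr (d * (real n - s) - n)"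
    unfolding \<beta>_def by (subst powr_power) (use nn in \<open>auto simp: mult.commute\<close>)
  then have "\<beta> ^ (n * n) * 2 ^ n = 2 powr (d * (real n - s) - n) * 2 powr n" by (simp add: powr_realpow)
  also have "\<dots> = 2 powr (d * (- s)) * 2 powr (d * n)" by (simp add: algebra_simps flip: powr_add)
  also have "2 powr (d * (- s)) = (2 ^ d) powr (- s)" by (simp add: powr_powr flip: powr_realpow)
  also have "2 powr (d * n) = ((2::real) ^ d) ^ n"
    by (simp add: powr_powr flip: powr_realpow)
  finally show ?thesis using 1 d(2) by (intro exI[of _ d] exI[of _ \<beta>]) (simp add: \<beta>_def)
qed

subsection \<open>Curve-null decompositions\<close>

lemma hausdorff_null_cover:
  fixes A :: "'a::metric_space set"
  assumes "hausdorff_measure s A = 0" "0 < e"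
  shows "\<exists>U :: nat \<Rightarrow> 'a set. A \<subseteq> (\<Union>i. U i) \<and> (\<forall>i. bounded (U i) \<and> diameter (U i) \<le> 1) \<and>
    (\<Sum>i. diam_pow s (U i)) < ennreal e"
proof -
  have "hausdorff_premeasure 1 s A \<le> hausdorff_measure s A"
    unfolding hausdorff_measure_def by (rule SUP_upper) simp
  then have "hausdorff_premeasure 1 s A < ennreal e" using assms by simp
  then show ?thesis unfolding hausdorff_premeasure_def INF_less_iff Bex_def mem_Collect_eq by (simp only: conj_assoc)
qed

text \<open>By the convention \<open>0 ^ 0 = 1\<close> every nonempty set of a cover counts 1. Hence
  an exponent of vanishing measure is positive, which makes the ratio \<sigma> in
  \<open>heavy_cells\<close> smaller than 1.\<close>

lemma hausdorff_measure_0_UNIV: "hausdorff_measure 0 (UNIV :: 'a::metric_space set) \<noteq> 0"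
proof
  assume "hausdorff_measure 0 (UNIV :: 'a set) = 0"
  from hausdorff_null_cover[OF this zero_less_one]
  obtain U :: "nat \<Rightarrow> 'a set" where U: "UNIV \<subseteq> (\<Union>i. U i)" "(\<Sum>i. diam_pow 0 (U i)) < ennreal 1"
    by (elim exE conjE) (rule that)
  obtain i where "U i \<noteq> {}" using U(1) by fastforce
  then have "1 = diam_pow 0 (U i)" by (simp add: diam_pow_def)
  also have "\<dots> = (\<Sum>k\<in>{i}. diam_pow 0 (U k))" by simp
  also have "\<dots> \<le> (\<Sum>i. diam_pow 0 (U i))" by (intro sum_le_suminf summableI) auto
  finally show False using U(2) by simp
qed

definition cell :: "nat \<Rightarrow> nat \<Rightarrow> (nat \<Rightarrow> 'a \<Rightarrow> real) \<Rightarrow> nat \<Rightarrow> (nat \<Rightarrow> int) \<Rightarrow> 'a set" where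
  "cell d n \<psi> N a = {y. addr d n N (\<lambda>j. \<psi> j y) = a}"

lemma cell_borel:
  fixes \<psi> :: "nat \<Rightarrow> 'a::metric_space \<Rightarrow> real"
  assumes "\<And>j. j < n \<Longrightarrow> L-lipschitz_on UNIV (\<psi> j)"
  shows "cell d n \<psi> N a \<in> sets borel"
proof (cases "a \<in> int_points n")
  case True
  have m: "\<psi> j \<in> borel_measurable borel" if "j < n" for j
    using lipschitz_on_continuous_on[OF assms[OF that]] by (rule borel_measurable_continuous_onI)
  have "cell d n \<psi> N a = UNIV \<inter> (\<Inter>j\<in>{..<n}. {y. \<lfloor>(2 ^ d) ^ N * \<psi> j y\<rfloor> = a j})"
    using True by (auto simp: cell_def addr_def int_points_def fun_eq_iff)
  also have "\<dots> \<in> sets borel"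
  proof (cases "n = 0")
    case False
    have "{y. \<lfloor>(2 ^ d) ^ N * \<psi> j y\<rfloor> = a j} \<in> sets borel" if "j < n" for j
    proof -
      have "(\<lambda>y. (2 ^ d) ^ N * \<psi> j y) -` {y. \<lfloor>y\<rfloor> = a j} \<inter> space borel \<in> sets borel"
      proof (rule measurable_sets[of _ borel borel])
        show "(\<lambda>y. (2 ^ d) ^ N * \<psi> j y) \<in> borel_measurable borel" using m[OF that] by measurable
        have "{y. \<lfloor>y\<rfloor> = a j} = {real_of_int (a j)..<real_of_int (a j) + 1}" by (auto simp: floor_eq_iff)
        then show "{y::real. \<lfloor>y\<rfloor> = a j} \<in> sets borel" by simp
      qed
      then show ?thesis by (simp add: vimage_def)
    qed
    then show ?thesis using False by (intro sets.Int sets.finite_INT) auto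
  qed simp
  finally show ?thesis .
next
  case False
  then have "cell d n \<psi> N a = {}" by (auto simp: cell_def)
  then show ?thesis by simp
qed

text \<open>Only countably many addresses occur, so an arbitrary predicate is allowed. This matters
  because the weights come from choices with no regularity.\<close>

lemma addr_predicate_borel:
  fixes \<psi> :: "nat \<Rightarrow> 'a::metric_space \<Rightarrow> real"
  assumes "\<And>j. j < n \<Longrightarrow> L-lipschitz_on UNIV (\<psi> j)"
  shows "{x. P (addr d n N (\<lambda>j. \<psi> j x))} \<in> sets borel"
proof -
  have "{x. P (addr d n N (\<lambda>j. \<psi> j x))} = (\<Union>a\<in>{a\<in>int_points n. P a}. cell d n \<psi> N a)"
    by (auto simp: cell_def)
  also have "\<dots> \<in> sets borel"
    using countable_int_points[of n] cell_borel[OF assms]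
    by (intro sets.countable_UN') (auto intro: countable_subset)
  finally show ?thesis .
qed

lemma exists_level:
  fixes D r :: real
  assumes "1 < D" "0 < r" "r \<le> 1"
  shows "\<exists>N. (1 / D) ^ Suc N < r \<and> r \<le> (1 / D) ^ N"
proof -
  obtain m where "(1 / D) ^ m < r" using real_arch_pow_inv[of r "1 / D"] assms by auto
  then have ex: "(1 / D) ^ Suc m < r" using power_decreasing[of m "Suc m" "1 / D"] assms by simp
  define N where "N = (LEAST N. (1 / D) ^ Suc N < r)"
  have 1: "(1 / D) ^ Suc N < r" unfolding N_def using ex by (rule LeastI)
  have "r \<le> (1 / D) ^ N"
  proof (cases N)
    case 0 then show ?thesis using assms by simp
  next
    case (Suc m)
    then have "\<not> (1 / D) ^ Suc m < r" using not_less_Least[of m "\<lambda>N. (1 / D) ^ Suc N < r"] by (simp add: N_def)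
    then show ?thesis using Suc by simp
  qed
  with 1 show ?thesis by blast
qed

lemma card_addr_image:
  fixes \<psi> :: "nat \<Rightarrow> 'a::metric_space \<Rightarrow> real"
  assumes L: "\<And>j. j < n \<Longrightarrow> L-lipschitz_on UNIV (\<psi> j)" "0 \<le> L"
    and U: "bounded U" "diameter U \<le> (1 / 2 ^ d) ^ N"
  shows "finite ((\<lambda>x. addr d n N (\<lambda>j. \<psi> j x)) ` U) \<and>
    card ((\<lambda>x. addr d n N (\<lambda>j. \<psi> j x)) ` U) \<le> nat (2 * \<lceil>L\<rceil> + 3) ^ n"
proof (cases "U = {}")
  case False
  then obtain x0 where x0: "x0 \<in> U" by auto
  define z where "z j = \<lfloor>(2 ^ d) ^ N * \<psi> j x0\<rfloor>" for j
  define F where "F j = {z j - (\<lceil>L\<rceil> + 1)..z j + (\<lceil>L\<rceil> + 1)}" for j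
  have sub: "(\<lambda>x. addr d n N (\<lambda>j. \<psi> j x)) ` U \<subseteq> {c\<in>int_points n. \<forall>j<n. c j \<in> F j}"
  proof safe
    fix x j assume x: "x \<in> U" "j < n"
    have "\<bar>(2 ^ d) ^ N * \<psi> j x - (2 ^ d) ^ N * \<psi> j x0\<bar> = (2 ^ d) ^ N * \<bar>\<psi> j x - \<psi> j x0\<bar>"
      by (simp add: abs_mult flip: right_diff_distrib)
    also have "\<dots> \<le> (2 ^ d) ^ N * (L * dist x x0)"
      using lipschitz_onD[OF L(1)[OF x(2)], of x x0] by (intro mult_left_mono) (auto simp: dist_real_def)
    also have "\<dots> \<le> (2 ^ d) ^ N * (L * (1 / 2 ^ d) ^ N)"
      using diameter_bounded_bound[OF U(1) x(1) x0] U(2) L(2) by (intro mult_left_mono) auto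
    also have "\<dots> = L" by (simp add: power_divide)
    finally have "\<bar>(2 ^ d) ^ N * \<psi> j x - (2 ^ d) ^ N * \<psi> j x0\<bar> \<le> L" .
    then have "\<lfloor>(2 ^ d) ^ N * \<psi> j x\<rfloor> \<in> F j" unfolding F_def z_def atLeastAtMost_iff by linarith
    then show "addr d n N (\<lambda>j. \<psi> j x) j \<in> F j" using x by (simp add: addr_def)
  qed simp
  have cF: "card (F j) = nat (2 * \<lceil>L\<rceil> + 3)" for j by (simp add: F_def algebra_simps)
  have "finite {c\<in>int_points n. \<forall>j<n. c j \<in> F j} \<and>
    card {c\<in>int_points n. \<forall>j<n. c j \<in> F j} \<le> (\<Prod>j<n. card (F j))"
    by (rule card_box_points) (simp add: F_def)
  then have *: "finite {c\<in>int_points n. \<forall>j<n. c j \<in> F j}"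
    "card {c\<in>int_points n. \<forall>j<n. c j \<in> F j} \<le> nat (2 * \<lceil>L\<rceil> + 3) ^ n"
    unfolding cF by auto
  show ?thesis using finite_subset[OF sub *(1)] order.trans[OF card_mono[OF *(1) sub] *(2)] by blast
qed simp

text \<open>The light cells met by an efficient cover have small total mass.\<close>
lemma heavy_cells:
  fixes \<nu> :: "'a::metric_space measure" and \<psi> :: "nat \<Rightarrow> 'a \<Rightarrow> real"
  assumes \<nu>: "finite_measure \<nu>" "sets \<nu> = sets borel"
    and H: "hausdorff_measure s (UNIV :: 'a set) = 0" and s: "0 < s" and d: "1 \<le> d"
    and L: "\<And>j. j < n \<Longrightarrow> L-lipschitz_on UNIV (\<psi> j)" "0 \<le> L"
  shows "AE x in \<nu>. \<exists>\<^sub>\<infinity>N. ((2 ^ d) powr (- s)) ^ N \<le> measure \<nu> (cell d n \<psi> N (addr d n N (\<lambda>j. \<psi> j x)))"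
proof -
  interpret finite_measure \<nu> by fact
  define D where "D = (2::real) ^ d"
  define \<sigma> where "\<sigma> = D powr (- s)"
  have D: "1 < D" using d by (simp add: D_def one_less_power)
  have \<sigma>: "0 < \<sigma>" "\<sigma> < 1" using D s powr_less_mono[of "- s" 0 D] by (auto simp: \<sigma>_def)
  have \<sigma>N: "((1 / D) ^ N) powr s = \<sigma> ^ N" for N
    using D by (simp add: \<sigma>_def powr_minus power_divide powr_power powr_powr divide_inverse power_inverse inverse_powr flip: powr_realpow)
      (simp add: mult.commute)
  define K where "K = real (nat (2 * \<lceil>L\<rceil> + 3) ^ n)"
  have K: "0 \<le> K" by (simp add: K_def)
  define cover where "cover k U \<longleftrightarrow> UNIV \<subseteq> (\<Union>i. U i) \<and> (\<forall>i. bounded (U i) \<and> diameter (U i) \<le> 1) \<and>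
    (\<Sum>i. diam_pow s (U i)) < ennreal ((1/2) ^ k)" for k :: nat and U :: "nat \<Rightarrow> 'a set"
  have "\<exists>U. cover k U" for k
    unfolding cover_def by (rule hausdorff_null_cover[OF H]) simp
  then obtain U where "\<And>k. cover k (U k)" by metis
  then have U: "\<And>k. UNIV \<subseteq> (\<Union>i. U k i)" "\<And>k i. bounded (U k i)" "\<And>k i. diameter (U k i) \<le> 1"
    "\<And>k. (\<Sum>i. diam_pow s (U k i)) < ennreal ((1/2) ^ k)"
    unfolding cover_def by blast+
  define a where "a k i = diameter (U k i) powr s" for k i
  have a: "diam_pow s (U k i) = ennreal (a k i)" for k i using s by (simp add: diam_pow_def a_def)
  \<comment> \<open>A diameter may be 0. Raising it to at least \<open>(1 / D) ^ (k + i)\<close>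
    allows a level to be assigned to \<open>U k i\<close>, at the price of a geometric
    series.\<close>
  define r where "r k i = max (diameter (U k i)) ((1 / D) ^ (k + i))" for k i
  have r: "0 < r k i" "r k i \<le> 1" for k i
    using D U(3)[of k i] by (auto simp: r_def less_max_iff_disj power_le_one)
  have rs: "r k i powr s \<le> a k i + \<sigma> ^ (k + i)" for k i
  proof -
    have "0 \<le> a k i" "0 \<le> \<sigma> ^ (k + i)" using \<sigma> by (auto simp: a_def)
    moreover have "r k i powr s = a k i \<or> r k i powr s = \<sigma> ^ (k + i)"
      unfolding r_def max_def \<sigma>N[symmetric] a_def by (simp split: if_splits)
    ultimately show ?thesis by linarith
  qed
  have "\<exists>N. (1 / D) ^ Suc N < r k i \<and> r k i \<le> (1 / D) ^ N" for k i by (rule exists_level[OF D r])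
  then obtain N where N: "\<And>k i. (1 / D) ^ Suc (N k i) < r k i" "\<And>k i. r k i \<le> (1 / D) ^ N k i" by metis
  have \<sigma>r: "\<sigma> ^ Suc (N k i) \<le> r k i powr s" for k i
    unfolding \<sigma>N[symmetric] using N(1)[of k i] s D by (intro powr_mono2) auto
  let ?ad = "\<lambda>N x. addr d n N (\<lambda>j. \<psi> j x)"
  let ?p = "\<lambda>N c. measure \<nu> (cell d n \<psi> N c)"
  \<comment> \<open>\<open>U k i\<close> is no wider than a cell of level \<open>N k i\<close>, so
    it meets a bounded number of them. The light ones among these have total mass at most
    \<open>q\<close> times the enlarged summand of the cover.\<close>
  define I where "I k i = {c \<in> ?ad (N k i) ` U k i. ?p (N k i) c < \<sigma> ^ N k i}" for k i
  define B where "B k i = (\<Union>c\<in>I k i. cell d n \<psi> (N k i) c)" for k i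
  have I: "finite (I k i)" "card (I k i) \<le> nat (2 * \<lceil>L\<rceil> + 3) ^ n" for k i
  proof -
    have diam: "diameter (U k i) \<le> (1 / 2 ^ d) ^ N k i" using N(2)[of k i] by (simp add: r_def D_def)
    have *: "finite (?ad (N k i) ` U k i) \<and> card (?ad (N k i) ` U k i) \<le> nat (2 * \<lceil>L\<rceil> + 3) ^ n"
      by (rule card_addr_image[OF L U(2) diam])
    have sub: "I k i \<subseteq> ?ad (N k i) ` U k i" by (auto simp: I_def)
    show "finite (I k i)" using * sub by (auto intro: finite_subset)
    show "card (I k i) \<le> nat (2 * \<lceil>L\<rceil> + 3) ^ n" using * card_mono[OF _ sub] by linarith
  qed
  have cb: "cell d n \<psi> N c \<in> sets \<nu>" for N c unfolding \<nu>(2) by (rule cell_borel[OF L(1)])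
  have Bs: "B k i \<in> sets \<nu>" for k i unfolding B_def using I(1) cb by (intro sets.finite_UN) auto
  define q where "q = K / \<sigma>"
  have q: "0 \<le> q" using K \<sigma> by (simp add: q_def)
  have mB: "measure \<nu> (B k i) \<le> q * (a k i + \<sigma> ^ (k + i))" for k i
  proof -
    have "measure \<nu> (B k i) \<le> (\<Sum>c\<in>I k i. ?p (N k i) c)"
      unfolding B_def using I(1) cb by (intro measure_UNION_le) auto
    also have "\<dots> \<le> (\<Sum>c\<in>I k i. \<sigma> ^ N k i)" by (intro sum_mono) (auto simp: I_def)
    also have "\<dots> = real (card (I k i)) * \<sigma> ^ N k i" by simp
    also have "\<dots> \<le> K * \<sigma> ^ N k i" unfolding K_def using I(2) \<sigma> by (intro mult_right_mono of_nat_mono) auto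
    also have "\<dots> = q * \<sigma> ^ Suc (N k i)" using \<sigma> by (simp add: q_def)
    also have "\<dots> \<le> q * (a k i + \<sigma> ^ (k + i))"
      using order.trans[OF \<sigma>r rs] q by (intro mult_left_mono) auto
    finally show ?thesis .
  qed
  define C where "C k = (\<Union>i. B k i)" for k
  have Cs: "C k \<in> sets \<nu>" for k unfolding C_def using Bs by auto
  have mC: "measure \<nu> (C k) \<le> q * ((1/2) ^ k + \<sigma> ^ k / (1 - \<sigma>))" for k
  proof -
    have geo: "(\<lambda>i. \<sigma> ^ (k + i)) sums (\<sigma> ^ k * (1 / (1 - \<sigma>)))"
      using sums_mult[OF geometric_sums[of \<sigma>], of "\<sigma> ^ k"] \<sigma> by (simp add: power_add)
    have "emeasure \<nu> (C k) \<le> (\<Sum>i. emeasure \<nu> (B k i))"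
      unfolding C_def using Bs by (intro emeasure_subadditive_countably) auto
    also have "\<dots> \<le> (\<Sum>i. ennreal (q) * (ennreal (a k i) + ennreal (\<sigma> ^ (k + i))))"
    proof (intro suminf_le summableI)
      fix i
      have "emeasure \<nu> (B k i) \<le> ennreal (q * (a k i + \<sigma> ^ (k + i)))"
        unfolding emeasure_eq_measure by (rule ennreal_leI[OF mB])
      also have "\<dots> = ennreal (q) * (ennreal (a k i) + ennreal (\<sigma> ^ (k + i)))"
        using q \<sigma> by (simp add: ennreal_mult a_def)
      finally show "emeasure \<nu> (B k i) \<le> ennreal (q) * (ennreal (a k i) + ennreal (\<sigma> ^ (k + i)))" .
    qed
    also have "\<dots> = ennreal (q) * ((\<Sum>i. ennreal (a k i)) + (\<Sum>i. ennreal (\<sigma> ^ (k + i))))"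
      by (subst ennreal_suminf_cmult) (simp add: suminf_add[symmetric] summableI)
    also have "(\<Sum>i. ennreal (\<sigma> ^ (k + i))) = ennreal (\<sigma> ^ k * (1 / (1 - \<sigma>)))"
      using geo \<sigma> by (intro suminf_ennreal_eq) auto
    also have "ennreal (q) * ((\<Sum>i. ennreal (a k i)) + ennreal (\<sigma> ^ k * (1 / (1 - \<sigma>)))) \<le>
      ennreal (q) * (ennreal ((1/2) ^ k) + ennreal (\<sigma> ^ k * (1 / (1 - \<sigma>))))"
      using U(4)[of k] unfolding a by (intro mult_left_mono add_right_mono) auto
    also have "\<dots> = ennreal (q * ((1/2) ^ k + \<sigma> ^ k / (1 - \<sigma>)))"
      using q \<sigma> by (simp add: ennreal_mult)
    finally show ?thesis unfolding emeasure_eq_measure using q \<sigma> by (subst (asm) ennreal_le_iff) auto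
  qed
  have "summable (\<lambda>k. measure \<nu> (C k))"
  proof (rule summable_comparison_test')
    show "summable (\<lambda>k. q * ((1/2) ^ k + \<sigma> ^ k / (1 - \<sigma>)))"
      using \<sigma> by (intro summable_mult summable_add summable_divide summable_geometric) auto
    show "norm (measure \<nu> (C k)) \<le> q * ((1/2) ^ k + \<sigma> ^ k / (1 - \<sigma>))" for k
      using mC by simp
  qed
  then have "AE x in \<nu>. \<forall>\<^sub>F k in sequentially. x \<in> space \<nu> - C k"
    by (intro borel_cantelli_AE1 Cs) (auto simp: emeasure_eq_measure)
  then show ?thesis
  proof (rule AE_mp, intro AE_I2 impI)
    fix x assume "\<forall>\<^sub>F k in sequentially. x \<in> space \<nu> - C k"
    then have ev: "\<forall>\<^sub>F k in sequentially. x \<notin> C k" by (rule eventually_mono) auto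
    have "\<forall>k. \<exists>i. x \<in> U k i" using U(1) by blast
    then obtain i where i: "\<And>k. x \<in> U k (i k)" by metis
    show "\<exists>\<^sub>\<infinity>N. ((2 ^ d) powr (- s)) ^ N \<le> ?p N (?ad N x)"
      unfolding INFM_nat
    proof
      fix m
      \<comment> \<open>Infinitely many distinct levels are needed. For large \<open>k\<close> the
        member of the \<open>k\<close>-th cover containing \<open>x\<close> is so small that its
        level exceeds \<open>m\<close>, and outside \<open>C k\<close> the cell of \<open>x\<close>
        at that level is heavy.\<close>
      have "(\<lambda>k. (1/2) ^ k + \<sigma> ^ k) \<longlonglongrightarrow> 0 + (0::real)"
        using \<sigma> by (intro tendsto_add LIMSEQ_power_zero) auto
      then have "\<forall>\<^sub>F k in sequentially. (1/2) ^ k + \<sigma> ^ k < \<sigma> ^ Suc m"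
        using order_tendstoD(2)[of _ 0 sequentially "\<sigma> ^ Suc m"] \<sigma> by auto
      with ev have "\<forall>\<^sub>F k in sequentially. x \<notin> C k \<and> (1/2) ^ k + \<sigma> ^ k < \<sigma> ^ Suc m" by (rule eventually_conj)
      then obtain k where k: "x \<notin> C k" "(1/2) ^ k + \<sigma> ^ k < \<sigma> ^ Suc m"
        using eventually_happens'[OF sequentially_bot] by blast
      let ?N = "N k (i k)"
      have "ennreal (a k (i k)) \<le> (\<Sum>i. ennreal (a k i))"
        using sum_le_suminf[of "\<lambda>i. ennreal (a k i)" "{i k}"] by (simp add: summableI)
      also have "\<dots> < ennreal ((1/2) ^ k)" using U(4)[of k] unfolding a .
      finally have ak: "a k (i k) < (1/2) ^ k" by (subst (asm) ennreal_less_iff) (auto simp: a_def)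
      have "\<sigma> ^ Suc ?N \<le> a k (i k) + \<sigma> ^ (k + i k)" by (rule order.trans[OF \<sigma>r rs])
      also have "\<sigma> ^ (k + i k) \<le> \<sigma> ^ k" using \<sigma> by (intro power_decreasing) auto
      finally have "\<sigma> ^ Suc ?N < \<sigma> ^ Suc m" using ak k(2) by linarith
      then have "m < ?N" unfolding power_strict_decreasing_iff[OF \<sigma>] by simp
      moreover have "\<sigma> ^ ?N \<le> ?p ?N (?ad ?N x)"
      proof (rule ccontr)
        assume "\<not> ?thesis"
        then have "?ad ?N x \<in> I k (i k)" using i[of k] by (auto simp: I_def)
        moreover have "x \<in> cell d n \<psi> ?N (?ad ?N x)" by (simp add: cell_def)
        ultimately have "x \<in> B k (i k)" unfolding B_def by blast
        then show False using k(1) by (auto simp: C_def)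
      qed
      ultimately show "\<exists>N>m. ((2 ^ d) powr (- s)) ^ N \<le> ?p N (?ad N x)"
        unfolding \<sigma>_def D_def by (intro exI[of _ ?N] conjI)
    qed
  qed
qed

text \<open>A curve fragment is encoded as a curve on the whole line together with a set
  \<open>T\<close> of times. The tested fragments run inside a cone of aperture \<delta> around the
  \<open>i\<close>-th axis; the lower speed bound \<open>c\<close> is arbitrary, only \<delta> is
  quantitative.\<close>

definition coordinate_null :: "nat \<Rightarrow> (nat \<Rightarrow> 'a::metric_space \<Rightarrow> real) \<Rightarrow> real \<Rightarrow> nat \<Rightarrow> 'a set \<Rightarrow> bool" where
  "coordinate_null n \<psi> \<delta> i S \<longleftrightarrow> (\<forall>(\<gamma> :: real \<Rightarrow> 'a) T c. 1-lipschitz_on UNIV \<gamma> \<longrightarrow> T \<subseteq> {0..1} \<longrightarrow> 0 < c \<longrightarrow> \<gamma> ` T \<subseteq> S \<longrightarrow>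
     (\<forall>t\<in>T. \<forall>t'\<in>T. c * \<bar>t - t'\<bar> \<le> \<bar>\<psi> i (\<gamma> t) - \<psi> i (\<gamma> t')\<bar>) \<longrightarrow>
     (\<forall>t\<in>T. \<forall>t'\<in>T. \<forall>j<n. j \<noteq> i \<longrightarrow> \<bar>\<psi> j (\<gamma> t) - \<psi> j (\<gamma> t')\<bar> \<le> \<delta> * \<bar>\<psi> i (\<gamma> t) - \<psi> i (\<gamma> t')\<bar>) \<longrightarrow>
     negligible T)"

text \<open>This takes the place of the multilinear Kakeya inequality.\<close>
lemma curve_null_decomposition:
  assumes s: "0 \<le> s" "s < real n" and H: "hausdorff_measure s (UNIV :: 'a::metric_space set) = 0"
  shows "\<exists>\<delta>>0. \<forall>(\<nu> :: 'a measure) \<psi> L. finite_measure \<nu> \<longrightarrow> sets \<nu> = sets borel \<longrightarrow>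
    (\<forall>j<n. L-lipschitz_on UNIV (\<psi> j)) \<longrightarrow>
    (\<exists>S. (\<forall>i. S i \<in> sets borel) \<and> (AE x in \<nu>. \<exists>i<n. x \<in> S i) \<and>
      (\<forall>i<n. coordinate_null n \<psi> \<delta> i (S i)))"
proof -
  have n: "1 \<le> n" using s by (cases n) auto
  have s0: "0 < s" using s H hausdorff_measure_0_UNIV[where 'a='a] by (cases "s = 0") auto
  obtain d \<beta> where d: "1 \<le> d" and \<beta>: "0 < \<beta>" "2 ^ n * (real d + 2) < \<beta>"
    "\<beta> ^ (n * n) * 2 ^ n \<le> (2 ^ d) powr (- s) * (2 ^ d) ^ n"
    using exists_scale[OF s(2) n] by blast
  show ?thesis
  \<comment> \<open>The witness is chosen before \<nu>, \<psi> and \<open>L\<close>, so these may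
    later depend on the aperture.\<close>
  proof (intro exI[of _ "1 / 2 ^ d"] conjI allI impI)
    fix \<nu> :: "'a measure" and \<psi> :: "nat \<Rightarrow> 'a \<Rightarrow> real" and L
    assume \<nu>: "finite_measure \<nu>" "sets \<nu> = sets borel" and "\<forall>j<n. L-lipschitz_on UNIV (\<psi> j)"
    then have L: "\<And>j. j < n \<Longrightarrow> L-lipschitz_on UNIV (\<psi> j)" by blast
    then have L0: "0 \<le> L" using n lipschitz_on_nonneg by (metis less_eq_Suc_le One_nat_def)
    interpret finite_measure \<nu> by fact
    have sp: "space \<nu> = UNIV" using sets_eq_imp_space_eq[OF \<nu>(2)] by simp
    let ?ad = "\<lambda>N x. addr d n N (\<lambda>j. \<psi> j x)"
    define p where "p N c = measure \<nu> (cell d n \<psi> N c)" for N c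
    define V where "V = measure \<nu> UNIV"
    have cb: "cell d n \<psi> N c \<in> sets \<nu>" for N c unfolding \<nu>(2) by (rule cell_borel[OF L])
    have V: "\<And>c. p 0 c \<le> V" "0 \<le> V" unfolding V_def p_def
      by (auto intro!: finite_measure_mono simp: \<nu>(2))
    have sub: "sum (p (Suc N)) A \<le> p N Q" if A: "finite A" "A \<subseteq> {a\<in>int_points n. parent d a = Q}" for N Q A
    proof -
      have "sum (p (Suc N)) A = measure \<nu> (\<Union>a\<in>A. cell d n \<psi> (Suc N) a)"
        unfolding p_def using A(1) cb
        by (intro finite_measure_finite_Union[symmetric]) (auto simp: disjoint_family_on_def cell_def)
      also have "\<dots> \<le> measure \<nu> (cell d n \<psi> N Q)"
      proof (rule finite_measure_mono[OF _ cb], safe)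
        fix a x assume "a \<in> A" "x \<in> cell d n \<psi> (Suc N) a"
        then have "?ad (Suc N) x = a" "parent d a = Q" using A(2) by (auto simp: cell_def)
        then show "x \<in> cell d n \<psi> N Q" by (auto simp: cell_def parent_addr)
      qed
      finally show ?thesis by (simp add: p_def)
    qed
    have p0: "0 \<le> p N c" for N c by (simp add: p_def)
    obtain f :: "nat \<Rightarrow> (nat \<Rightarrow> int) \<Rightarrow> nat" and M :: "nat \<Rightarrow> (nat \<Rightarrow> int) \<Rightarrow> real"
      where f: "\<And>N c. c \<in> int_points n \<Longrightarrow> f N c < n"
      and M: "\<And>N c. c \<in> int_points n \<Longrightarrow> 0 < M N c"
      and pM: "\<And>N c. c \<in> int_points n \<Longrightarrow> p (Suc N) c * M N c ^ n \<le> 2 ^ n * p N (parent d c)"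
      and lines: "\<And>N i b Q X. i < n \<Longrightarrow> X \<subseteq> {a\<in>int_points n. parent d a = Q \<and> (\<forall>j. j \<noteq> i \<longrightarrow> a j = b j)} \<Longrightarrow>
        finite X \<and> (\<Sum>a\<in>X. if f N a = i then 1 / M N a else 1 / 2 ^ d) \<le> real d + 2"
    proof (rule tree_split[of n p d, OF n p0])
      show "sum (p (Suc N)) A \<le> p N Q" if "finite A" "A \<subseteq> {a\<in>int_points n. parent d a = Q}" for N Q A
        by (rule sub[OF that])
    next
      fix f :: "nat \<Rightarrow> (nat \<Rightarrow> int) \<Rightarrow> nat" and M :: "nat \<Rightarrow> (nat \<Rightarrow> int) \<Rightarrow> real"
      assume 1: "\<And>N c. c \<in> int_points n \<Longrightarrow> f N c < n" "\<And>N c. c \<in> int_points n \<Longrightarrow> 0 < M N c"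
        "\<And>N c. c \<in> int_points n \<Longrightarrow> p (Suc N) c * M N c ^ n \<le> 2 ^ n * p N (parent d c)"
      assume 2: "\<And>N i b Q X. i < n \<Longrightarrow> X \<subseteq> {a\<in>int_points n. parent d a = Q \<and> (\<forall>j. j \<noteq> i \<longrightarrow> a j = b j)} \<Longrightarrow>
        finite X \<and> (\<Sum>a\<in>X. if f N a = i then 1 / M N a else 1 / 2 ^ d) \<le> real d + 2"
      show thesis by (rule that[OF 1 2])
    qed
    define b where "b = 1 / (V + 1)"
    have b: "0 < b" using V by (simp add: b_def)
    define R where "R i N c \<longleftrightarrow> b * \<beta> ^ N \<le> (2 ^ d) ^ N * weight d f M i N c" for i N c
    define S where "S i = {x. \<exists>\<^sub>\<infinity>N. R i N (?ad N x)}" for i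
    show "\<exists>S. (\<forall>i. S i \<in> sets borel) \<and> (AE x in \<nu>. \<exists>i<n. x \<in> S i) \<and>
      (\<forall>i<n. coordinate_null n \<psi> (1 / 2 ^ d) i (S i))"
    proof (intro exI[of _ S] conjI allI impI)
      fix i
      have "S i = (\<Inter>m. \<Union>N\<in>{m<..}. {x. R i N (?ad N x)})" by (auto simp: S_def INFM_nat)
      also have "\<dots> \<in> sets borel"
        using addr_predicate_borel[OF L] by (intro sets.countable_INT' sets.countable_UN') auto
      finally show "S i \<in> sets borel" .
    next
      have "AE x in \<nu>. \<exists>\<^sub>\<infinity>N. ((2 ^ d) powr (- s)) ^ N \<le> measure \<nu> (cell d n \<psi> N (?ad N x))"
        by (rule heavy_cells[OF \<nu> H s0 d L L0])
      then show "AE x in \<nu>. \<exists>i<n. x \<in> S i"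
      proof (rule AE_mp, intro AE_I2 impI)
        fix x assume "\<exists>\<^sub>\<infinity>N. ((2 ^ d) powr (- s)) ^ N \<le> measure \<nu> (cell d n \<psi> N (?ad N x))"
        \<comment> \<open>At each of infinitely many levels some direction is heavy; since there are
          only \<open>n\<close> directions, one of them is heavy infinitely often.\<close>
        then have "\<exists>\<^sub>\<infinity>N. \<exists>i\<in>{..<n}. R i N (?ad N x)"
        proof (rule INFM_mono)
          fix N assume "((2 ^ d) powr (- s)) ^ N \<le> measure \<nu> (cell d n \<psi> N (?ad N x))"
          then have "\<exists>i<n. 1 / (V + 1) * \<beta> ^ N \<le> (2 ^ d) ^ N * weight d f M i N (?ad N x)"
            by (intro heavy_direction[of n f M p d V "?ad N x" \<beta> "(2 ^ d) powr (- s)" N, OF n f M pM V _ \<beta>(1,3)])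
              (auto simp: p_def)
          then show "\<exists>i\<in>{..<n}. R i N (?ad N x)" by (auto simp: R_def b_def)
        qed
        then show "\<exists>i<n. x \<in> S i" by (auto simp: S_def INFM_finite_Bex_distrib)
      qed
    next
      fix i assume i: "i < n"
      show "coordinate_null n \<psi> (1 / 2 ^ d) i (S i)"
        unfolding coordinate_null_def
      proof (intro allI impI)
        fix \<gamma> :: "real \<Rightarrow> 'a" and T c
        assume \<gamma>: "1-lipschitz_on UNIV (\<gamma> :: real \<Rightarrow> 'a)" and T: "T \<subseteq> {0..1}" and c: "0 < c"
          and TS: "\<gamma> ` T \<subseteq> S i"
          and c': "\<forall>t\<in>T. \<forall>t'\<in>T. c * \<bar>t - t'\<bar> \<le> \<bar>\<psi> i (\<gamma> t) - \<psi> i (\<gamma> t')\<bar>"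
          and cone: "\<forall>t\<in>T. \<forall>t'\<in>T. \<forall>j<n. j \<noteq> i \<longrightarrow> \<bar>\<psi> j (\<gamma> t) - \<psi> j (\<gamma> t')\<bar> \<le> 1 / 2 ^ d * \<bar>\<psi> i (\<gamma> t) - \<psi> i (\<gamma> t')\<bar>"
        have bdd: "\<bar>\<psi> j (\<gamma> t)\<bar> \<le> (\<Sum>j<n. \<bar>\<psi> j (\<gamma> 0)\<bar>) + L" if "t \<in> T" "j < n" for t j
        proof -
          have "dist (\<gamma> t) (\<gamma> 0) \<le> 1"
            using lipschitz_onD[OF \<gamma>, of t 0] T that by (auto simp: dist_real_def)
          then have "\<bar>\<psi> j (\<gamma> t) - \<psi> j (\<gamma> 0)\<bar> \<le> L"
            using lipschitz_onD[OF L[OF that(2)], of "\<gamma> t" "\<gamma> 0"] L0 mult_left_mono[of "dist (\<gamma> t) (\<gamma> 0)" 1 L]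
            by (auto simp: dist_real_def)
          moreover have "\<bar>\<psi> j (\<gamma> 0)\<bar> \<le> (\<Sum>j<n. \<bar>\<psi> j (\<gamma> 0)\<bar>)"
            using that by (intro member_le_sum) auto
          ultimately show ?thesis by linarith
        qed
        show "negligible T"
        proof (rule fragment_negligible[of i n M d f T "\<lambda>t j. \<psi> j (\<gamma> t)" _ c b \<beta>, OF i M lines[OF i] bdd c _ _ b \<beta>(2)])
          show "\<exists>\<^sub>\<infinity>N. b * \<beta> ^ N \<le> (2 ^ d) ^ N * weight d f M i N (addr d n N (\<lambda>j. \<psi> j (\<gamma> t)))" if "t \<in> T" for t
            using TS that by (auto simp: S_def R_def)
        qed (use c' cone in auto)
      qed
    qed
  qed simp
qed

subsection \<open>Independent Lipschitz functions\<close>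

text \<open>Induction on the number of equations. A solution \<open>u\<close> of the first
  \<open>k\<close> equations with \<open>u i1\<close> nonzero, and a second solution
  \<open>u'\<close> supported off \<open>i1\<close>, are independent, so a combination of the two
  kills the last equation without vanishing.\<close>

lemma underdetermined_solution:
  fixes w :: "nat \<Rightarrow> 'b \<Rightarrow> real"
  assumes "finite A" "k < card A"
  shows "\<exists>v. (\<exists>i\<in>A. v i \<noteq> 0) \<and> (\<forall>i. i \<notin> A \<longrightarrow> v i = 0) \<and> (\<forall>j<k. (\<Sum>i\<in>A. v i * w j i) = 0)"
  using assms
proof (induction k arbitrary: A)
  case 0
  then have "A \<noteq> {}" by auto
  then obtain a where "a \<in> A" by blast
  then have "\<exists>i\<in>A. (if i = a then 1 else 0 :: real) \<noteq> 0" by (intro bexI[of _ a]) auto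
  then show ?case using \<open>a \<in> A\<close> by (intro exI[of _ "\<lambda>i. if i = a then 1 else 0"] conjI) auto
next
  case (Suc k)
  obtain u where U: "(\<exists>i\<in>A. u i \<noteq> 0) \<and> (\<forall>i. i \<notin> A \<longrightarrow> u i = 0) \<and> (\<forall>j<k. (\<Sum>i\<in>A. u i * w j i) = 0)"
    using Suc.IH[OF Suc.prems(1) Suc_lessD[OF Suc.prems(2)]] by (rule exE)
  then obtain i1 where i1: "i1 \<in> A" "u i1 \<noteq> 0" by (elim conjE bexE)
  have "k < card (A - {i1})" using Suc.prems i1(1) by simp
  from Suc.IH[OF finite_Diff[OF Suc.prems(1)] this]
  obtain u' where U': "(\<exists>i\<in>A - {i1}. u' i \<noteq> 0) \<and> (\<forall>i. i \<notin> A - {i1} \<longrightarrow> u' i = 0) \<and>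
    (\<forall>j<k. (\<Sum>i\<in>A - {i1}. u' i * w j i) = 0)"
    by (rule exE)
  have u'1: "u' i = 0" if "i \<notin> A \<or> i = i1" for i using U' that by blast
  have u'A: "(\<Sum>i\<in>A. u' i * w j i) = 0" if "j < k" for j
  proof -
    have "(\<Sum>i\<in>A. u' i * w j i) = (\<Sum>i\<in>A - {i1}. u' i * w j i)"
      by (rule sum.mono_neutral_right) (use Suc.prems(1) u'1 in auto)
    also have "\<dots> = 0" using U' that by blast
    finally show ?thesis .
  qed
  define \<alpha> where "\<alpha> = (\<Sum>i\<in>A. u' i * w k i)"
  define \<beta> where "\<beta> = (\<Sum>i\<in>A. u i * w k i)"
  show ?case
  proof (cases "\<alpha> = 0")
    case True
    show ?thesis
    proof (intro exI[of _ u'] conjI allI impI)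
      show "\<exists>i\<in>A. u' i \<noteq> 0" using U' by blast
      show "u' i = 0" if "i \<notin> A" for i using that u'1 by blast
      show "(\<Sum>i\<in>A. u' i * w j i) = 0" if "j < Suc k" for j
        using that u'A[of j] True by (cases "j = k") (auto simp: \<alpha>_def)
    qed
  next
    case False
    define v where "v i = \<alpha> * u i - \<beta> * u' i" for i
    have vs: "(\<Sum>i\<in>A. v i * w j i) = \<alpha> * (\<Sum>i\<in>A. u i * w j i) - \<beta> * (\<Sum>i\<in>A. u' i * w j i)" for j
      by (simp add: v_def left_diff_distrib sum_subtractf sum_distrib_left mult.assoc)
    have "v i1 \<noteq> 0" using False i1(2) u'1[of i1] by (simp add: v_def)
    moreover have "(\<Sum>i\<in>A. v i * w j i) = 0" if "j < Suc k" for j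
    proof (cases "j = k")
      case True
      show ?thesis unfolding vs True \<alpha>_def \<beta>_def by simp
    next
      case False
      then have "j < k" using that by simp
      then show ?thesis unfolding vs using u'A[of j] U by auto
    qed
    moreover have "v i = 0" if "i \<notin> A" for i
    proof -
      have "u i = 0" using U that by blast
      then show ?thesis using that u'1[of i] by (simp add: v_def)
    qed
    ultimately show ?thesis using i1(1) by blast
  qed
qed

text \<open>Greedy choice: take a normalised \<open>v\<close> annihilating all directions chosen so
  far, then a member of \<open>J\<close> far from the hyperplane of \<open>v\<close>. The process
  runs for \<open>n\<close> steps because fewer than \<open>n\<close> equations always have a
  nontrivial solution.\<close>

lemma near_hyperplane_or_triangular:
  fixes J :: "(nat \<Rightarrow> real) set"
  assumes "k \<le> n" and far: "\<And>v. (\<Sum>j<n. \<bar>v j\<bar>) = 1 \<Longrightarrow> \<exists>w\<in>J. a < \<bar>\<Sum>j<n. v j * w j\<bar>"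
  shows "\<exists>ws vs. (\<forall>i<k. ws i \<in> J \<and> (\<Sum>j<n. \<bar>vs i j\<bar>) = 1 \<and> a < \<bar>\<Sum>j<n. vs i j * ws i j\<bar>) \<and>
    (\<forall>i<k. \<forall>l<i. (\<Sum>j<n. vs i j * ws l j) = 0)"
  using assms(1)
proof (induction k)
  case (Suc k)
  then have "k \<le> n" by simp
  from Suc.IH[OF this] obtain ws vs where *: "(\<forall>i<k. ws i \<in> J \<and> (\<Sum>j<n. \<bar>vs i j\<bar>) = 1 \<and> a < \<bar>\<Sum>j<n. vs i j * ws i j\<bar>) \<and>
    (\<forall>i<k. \<forall>l<i. (\<Sum>j<n. vs i j * ws l j) = 0)" by (elim exE)
  then have IH: "\<And>i. i < k \<Longrightarrow> ws i \<in> J" "\<And>i. i < k \<Longrightarrow> (\<Sum>j<n. \<bar>vs i j\<bar>) = 1"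
    "\<And>i. i < k \<Longrightarrow> a < \<bar>\<Sum>j<n. vs i j * ws i j\<bar>"
    "\<And>i l. i < k \<Longrightarrow> l < i \<Longrightarrow> (\<Sum>j<n. vs i j * ws l j) = 0" by auto
  have "k < card {..<n}" using Suc.prems by simp
  from underdetermined_solution[OF finite_lessThan this, of ws]
  obtain u where U: "(\<exists>i\<in>{..<n}. u i \<noteq> 0) \<and> (\<forall>i. i \<notin> {..<n} \<longrightarrow> u i = 0) \<and> (\<forall>l<k. (\<Sum>j<n. u j * ws l j) = 0)"
    by (rule exE)
  then obtain i0 where u: "i0 < n" "u i0 \<noteq> 0" by auto
  define S where "S = (\<Sum>j<n. \<bar>u j\<bar>)"
  have "\<bar>u i0\<bar> \<le> S" unfolding S_def using u(1) by (intro member_le_sum) auto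
  then have S: "0 < S" using u(2) by linarith
  define v where "v j = u j / S" for j
  have v1: "(\<Sum>j<n. \<bar>v j\<bar>) = 1" using S by (simp add: v_def S_def sum_divide_distrib[symmetric])
  have v0: "(\<Sum>j<n. v j * ws l j) = 0" if "l < k" for l
    using U that by (simp add: v_def sum_divide_distrib[symmetric])
  obtain w where w: "w \<in> J" "a < \<bar>\<Sum>j<n. v j * w j\<bar>" using far[OF v1] by blast
  show ?case
  proof (rule exI[of _ "ws(k := w)"], rule exI[of _ "vs(k := v)"], intro conjI allI impI)
    fix i l assume il: "i < Suc k" "l < i"
    show "(\<Sum>j<n. (vs(k := v)) i j * (ws(k := w)) l j) = 0"
    proof (cases "i = k")
      case True then show ?thesis using v0[of l] il by simp
    next
      case False then show ?thesis using IH(4)[of i l] il by simp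
    qed
  next
    fix i assume i: "i < Suc k"
    show "(ws(k := w)) i \<in> J"
    proof (cases "i = k")
      case False then show ?thesis using i IH(1)[of i] by simp
    qed (use w(1) in simp)
    show "(\<Sum>j<n. \<bar>(vs(k := v)) i j\<bar>) = 1"
    proof (cases "i = k")
      case False then show ?thesis using i IH(2)[of i] by simp
    qed (use v1 in simp)
    show "a < \<bar>\<Sum>j<n. (vs(k := v)) i j * (ws(k := w)) i j\<bar>"
    proof (cases "i = k")
      case False then show ?thesis using i IH(3)[of i] by simp
    qed (use w(2) in simp)
  qed
qed auto

section \<open>Independence sets and negligible directions\<close>

definition lincomb :: "nat \<Rightarrow> (nat \<Rightarrow> real) \<Rightarrow> (nat \<Rightarrow> 'a \<Rightarrow> real) \<Rightarrow> 'a \<Rightarrow> real" where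
  "lincomb n v \<phi> x = (\<Sum>j<n. v j * \<phi> j x)"

text \<open>At such a point the seminorm \<open>Lip\<close> of the combination dominates the 1-norm
  of the coefficients with constant \<open>1 / (m + 1)\<close>. Letting \<open>m\<close> run through
  the naturals exhausts the points of quantitative independence by countably many sets.\<close>

definition indep_set :: "nat \<Rightarrow> (nat \<Rightarrow> 'a::metric_space \<Rightarrow> real) \<Rightarrow> nat \<Rightarrow> 'a set" where
  "indep_set n \<phi> m = {x. \<forall>v. ennreal ((\<Sum>j<n. \<bar>v j\<bar>) / real (Suc m)) \<le> Lip (lincomb n v \<phi>) x}"

text \<open>The approximation is demanded between any two times of the fragment, not just
  infinitesimally, so that it yields the cone condition of \<open>coordinate_null\<close>
  directly.\<close>

definition direction_null :: "nat \<Rightarrow> (nat \<Rightarrow> 'a::metric_space \<Rightarrow> real) \<Rightarrow> real \<Rightarrow> (nat \<Rightarrow> real) \<Rightarrow> 'a set \<Rightarrow> bool" where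
  "direction_null n \<phi> \<epsilon> w P \<longleftrightarrow> (\<forall>(\<gamma> :: real \<Rightarrow> 'a) T. 1-lipschitz_on UNIV \<gamma> \<longrightarrow> T \<subseteq> {0..1} \<longrightarrow> \<gamma> ` T \<subseteq> P \<longrightarrow>
     (\<forall>t\<in>T. \<forall>s\<in>T. \<forall>j<n. \<bar>\<phi> j (\<gamma> s) - \<phi> j (\<gamma> t) - w j * (s - t)\<bar> \<le> \<epsilon> * \<bar>s - t\<bar>) \<longrightarrow> negligible T)"

lemma direction_null_mono: "direction_null n \<phi> \<epsilon> w P \<Longrightarrow> Q \<subseteq> P \<Longrightarrow> direction_null n \<phi> \<epsilon> w Q"
  unfolding direction_null_def by (meson subset_trans)

text \<open>A finite net for the velocities of \<phi> along 1-Lipschitz curves; the margin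
  \<open>2 * \<epsilon>\<close> is the one produced by
  \<open>lipschitz_approx_slope\<close>.\<close>

definition grid_directions :: "nat \<Rightarrow> real \<Rightarrow> real \<Rightarrow> (nat \<Rightarrow> real) set" where
  "grid_directions n \<epsilon> L = {w. \<exists>c\<in>int_points n. w = (\<lambda>j. of_int (c j) * \<epsilon>) \<and> (\<forall>j<n. \<bar>of_int (c j) * \<epsilon>\<bar> \<le> L + 2 * \<epsilon>)}"

lemma finite_grid_directions:
  assumes "0 < \<epsilon>"
  shows "finite (grid_directions n \<epsilon> L)"
proof -
  define K where "K = \<lceil>(L + 2 * \<epsilon>) / \<epsilon>\<rceil>"
  have "finite {c\<in>int_points n. \<forall>j<n. c j \<in> {-K..K}}" using card_box_points[of n "\<lambda>_. {-K..K}"] by blast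
  moreover have "grid_directions n \<epsilon> L \<subseteq> (\<lambda>c j. of_int (c j) * \<epsilon>) ` {c\<in>int_points n. \<forall>j<n. c j \<in> {-K..K}}"
  proof
    fix w assume "w \<in> grid_directions n \<epsilon> L"
    then obtain c where c: "c \<in> int_points n" "w = (\<lambda>j. of_int (c j) * \<epsilon>)" "\<And>j. j < n \<Longrightarrow> \<bar>of_int (c j) * \<epsilon>\<bar> \<le> L + 2 * \<epsilon>"
      unfolding grid_directions_def by blast
    have "c j \<in> {-K..K}" if "j < n" for j
    proof -
      have "\<bar>of_int (c j)\<bar> \<le> (L + 2 * \<epsilon>) / \<epsilon>" using c(3)[OF that] assms by (simp add: abs_mult pos_le_divide_eq)
      then show ?thesis unfolding K_def atLeastAtMost_iff by linarith
    qed
    then show "w \<in> (\<lambda>c j. of_int (c j) * \<epsilon>) ` {c\<in>int_points n. \<forall>j<n. c j \<in> {-K..K}}"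
      using c by (intro image_eqI[of _ _ c]) auto
  qed
  ultimately show ?thesis by (meson finite_surj)
qed

lemma lincomb_diff_bound:
  assumes "(\<Sum>j<n. \<bar>v j\<bar>) = 1" "\<And>j. j < n \<Longrightarrow> \<bar>y j\<bar> \<le> b"
  shows "\<bar>\<Sum>j<n. v j * y j\<bar> \<le> (b::real)"
proof -
  have "\<bar>\<Sum>j<n. v j * y j\<bar> \<le> (\<Sum>j<n. \<bar>v j\<bar> * b)"
    using assms(2) by (intro order.trans[OF sum_abs] sum_mono) (auto simp: abs_mult mult_left_mono)
  also have "\<dots> = b" using assms(1) by (simp add: sum_distrib_right[symmetric])
  finally show ?thesis .
qed

lemma lipschitz_on_lincomb:
  assumes "\<And>j. j < n \<Longrightarrow> L-lipschitz_on UNIV (\<phi> j)" "0 \<le> L" "(\<Sum>j<n. \<bar>v j\<bar>) = 1"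
  shows "L-lipschitz_on UNIV (lincomb n v \<phi>)"
proof (rule lipschitz_onI)
  fix x y
  have "\<bar>\<Sum>j<n. v j * (\<phi> j x - \<phi> j y)\<bar> \<le> L * dist x y"
    by (rule lincomb_diff_bound[OF assms(3)]) (use lipschitz_onD[OF assms(1)] in \<open>auto simp: dist_real_def\<close>)
  then show "dist (lincomb n v \<phi> x) (lincomb n v \<phi> y) \<le> L * dist x y"
    by (simp add: lincomb_def dist_real_def sum_subtractf right_diff_distrib)
qed (rule assms)

lemma lipschitz_compose_curve:
  assumes "L-lipschitz_on UNIV f" "1-lipschitz_on UNIV (\<gamma> :: real \<Rightarrow> 'a::metric_space)"
  shows "L-lipschitz_on UNIV (\<lambda>t. f (\<gamma> t) :: real)"
  using lipschitz_on_compose2[OF assms(2) lipschitz_on_subset[OF assms(1)]] by simp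

text \<open>At almost every time the rates of all \<open>\<phi> j\<close> agree up to \<epsilon>
  with some grid direction \<open>w\<close>. Times spent in \<open>P\<close> with a null
  \<open>w\<close> form countably many negligible fragments. For every other \<open>w\<close> the
  product with \<open>v\<close> is at most \<open>a\<close>, and rounding adds only \<epsilon>
  because \<open>v\<close> has 1-norm 1.\<close>

lemma small_derivative_on_null_directions:
  fixes \<phi> :: "nat \<Rightarrow> 'a::metric_space \<Rightarrow> real" and \<gamma> :: "real \<Rightarrow> 'a"
  assumes \<phi>: "\<And>j. j < n \<Longrightarrow> L-lipschitz_on UNIV (\<phi> j)" and \<epsilon>: "0 < \<epsilon>"
    and v: "(\<Sum>j<n. \<bar>v j\<bar>) = 1"
    and W: "\<And>w. w \<in> grid_directions n \<epsilon> L \<Longrightarrow> direction_null n \<phi> \<epsilon> w P \<or> \<bar>\<Sum>j<n. v j * w j\<bar> \<le> a"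
    and \<gamma>: "1-lipschitz_on UNIV \<gamma>"
  shows "\<exists>N. negligible N \<and> (\<forall>t\<in>{0..1} - N. \<gamma> t \<in> P \<longrightarrow>
    (\<exists>d>0. \<forall>s. \<bar>s - t\<bar> < d \<longrightarrow> \<bar>lincomb n v \<phi> (\<gamma> s) - lincomb n v \<phi> (\<gamma> t)\<bar> \<le> (a + \<epsilon>) * \<bar>s - t\<bar>))"
proof -
  define loc where "loc w d t \<longleftrightarrow> (\<forall>s. \<bar>s - t\<bar> < d \<longrightarrow> (\<forall>j<n. \<bar>\<phi> j (\<gamma> s) - \<phi> j (\<gamma> t) - w j * (s - t)\<bar> \<le> \<epsilon> * \<bar>s - t\<bar>))"
    for w :: "nat \<Rightarrow> real" and d t
  define app where "app j t z d \<longleftrightarrow> \<bar>of_int z * \<epsilon>\<bar> \<le> L + 2 * \<epsilon> \<and> 0 < d \<and>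
    (\<forall>s. \<bar>s - t\<bar> < d \<longrightarrow> \<bar>\<phi> j (\<gamma> s) - \<phi> j (\<gamma> t) - of_int z * \<epsilon> * (s - t)\<bar> \<le> \<epsilon> * \<bar>s - t\<bar>)"
    for t d :: real and z :: int and j :: nat
  have "\<exists>N. j < n \<longrightarrow> negligible N \<and> (\<forall>t\<in>{0..1} - N. \<exists>z d. app j t z d)" for j
  proof (cases "j < n")
    case True
    from lipschitz_approx_slope[OF lipschitz_compose_curve[OF \<phi>[OF True] \<gamma>] \<epsilon>]
    obtain N where N: "negligible N \<and> (\<forall>t\<in>{0..1} - N. \<exists>z::int. \<bar>of_int z * \<epsilon>\<bar> \<le> L + 2 * \<epsilon> \<and>
      (\<exists>d>0. \<forall>s. \<bar>s - t\<bar> < d \<longrightarrow> \<bar>\<phi> j (\<gamma> s) - \<phi> j (\<gamma> t) - of_int z * \<epsilon> * (s - t)\<bar> \<le> \<epsilon> * \<bar>s - t\<bar>))"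
      by (rule exE)
    have "\<exists>z d. app j t z d" if t: "t \<in> {0..1} - N" for t
    proof -
      from bspec[OF conjunct2[OF N] t] obtain z :: int where z: "\<bar>of_int z * \<epsilon>\<bar> \<le> L + 2 * \<epsilon> \<and>
        (\<exists>d>0. \<forall>s. \<bar>s - t\<bar> < d \<longrightarrow> \<bar>\<phi> j (\<gamma> s) - \<phi> j (\<gamma> t) - of_int z * \<epsilon> * (s - t)\<bar> \<le> \<epsilon> * \<bar>s - t\<bar>)"
        by (rule exE)
      from conjunct2[OF z] obtain d where
        "0 < d \<and> (\<forall>s. \<bar>s - t\<bar> < d \<longrightarrow> \<bar>\<phi> j (\<gamma> s) - \<phi> j (\<gamma> t) - of_int z * \<epsilon> * (s - t)\<bar> \<le> \<epsilon> * \<bar>s - t\<bar>)"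
        by (rule exE)
      then have "app j t z d" using z unfolding app_def by simp
      then show ?thesis by (intro exI)
    qed
    then show ?thesis using N by (intro exI[of _ N]) simp
  qed simp
  then obtain N where N: "\<And>j. j < n \<longrightarrow> negligible (N j) \<and> (\<forall>t\<in>{0..1} - N j. \<exists>z d. app j t z d)" by metis
  define W0 where "W0 = {w\<in>grid_directions n \<epsilon> L. direction_null n \<phi> \<epsilon> w P}"
  \<comment> \<open>The local approximation has to hold between all pairs of times. The scale is
    frozen at \<open>1 / (m + 1)\<close> and the times are cut into intervals of the strictly
    smaller length \<open>1 / (m + 2)\<close>.\<close>
  define T where "T w m k = {t\<in>{0..1}. \<gamma> t \<in> P \<and> loc w (1 / real (Suc m)) t \<and>
    t \<in> {real k / real (Suc (Suc m))..real (Suc k) / real (Suc (Suc m))}}" for w m k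
  have Tneg: "negligible (T w m k)" if w: "w \<in> W0" for w m k
  proof -
    have "\<forall>t\<in>T w m k. \<forall>s\<in>T w m k. \<forall>j<n. \<bar>\<phi> j (\<gamma> s) - \<phi> j (\<gamma> t) - w j * (s - t)\<bar> \<le> \<epsilon> * \<bar>s - t\<bar>"
    proof (intro ballI)
      fix t s assume ts: "t \<in> T w m k" "s \<in> T w m k"
      have "real (Suc k) / real (Suc (Suc m)) - real k / real (Suc (Suc m)) = 1 / real (Suc (Suc m))"
        by (simp add: diff_divide_distrib[symmetric])
      moreover have "1 / real (Suc (Suc m)) < 1 / real (Suc m)" by (simp add: field_simps)
      ultimately have "\<bar>s - t\<bar> < 1 / real (Suc m)" using ts unfolding T_def mem_Collect_eq atLeastAtMost_iff by linarith
      then show "\<forall>j<n. \<bar>\<phi> j (\<gamma> s) - \<phi> j (\<gamma> t) - w j * (s - t)\<bar> \<le> \<epsilon> * \<bar>s - t\<bar>"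
        using ts by (auto simp: T_def loc_def)
    qed
    moreover have "T w m k \<subseteq> {0..1}" "\<gamma> ` T w m k \<subseteq> P" by (auto simp: T_def)
    ultimately show ?thesis using w \<gamma> unfolding W0_def direction_null_def by blast
  qed
  define Z where "Z = (\<Union>j<n. N j) \<union> (\<Union>w\<in>W0. \<Union>m. \<Union>k. T w m k)"
  have "finite W0" using finite_grid_directions[OF \<epsilon>] by (simp add: W0_def)
  then have "negligible (\<Union>w\<in>W0. \<Union>m. \<Union>k. T w m k)"
    using Tneg by (intro negligible_Union) (auto intro!: negligible_countable_Union)
  moreover have "negligible (\<Union>j<n. N j)" using N by (intro negligible_Union) auto
  ultimately have "negligible Z" unfolding Z_def by (rule negligible_Un[rotated])
  moreover have "\<exists>d>0. \<forall>s. \<bar>s - t\<bar> < d \<longrightarrow> \<bar>lincomb n v \<phi> (\<gamma> s) - lincomb n v \<phi> (\<gamma> t)\<bar> \<le> (a + \<epsilon>) * \<bar>s - t\<bar>"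
    if t: "t \<in> {0..1} - Z" "\<gamma> t \<in> P" for t
  proof -
    have "\<exists>z d. j < n \<longrightarrow> app j t z d" for j
      using N[of j] t by (auto simp: Z_def)
    then obtain z d where zd: "\<And>j. j < n \<longrightarrow> app j t (z j) (d j)" by metis
    then have z: "\<And>j. j < n \<Longrightarrow> \<bar>of_int (z j) * \<epsilon>\<bar> \<le> L + 2 * \<epsilon>"
      and d: "\<And>j. j < n \<Longrightarrow> 0 < d j"
        "\<And>j s. j < n \<Longrightarrow> \<bar>s - t\<bar> < d j \<Longrightarrow> \<bar>\<phi> j (\<gamma> s) - \<phi> j (\<gamma> t) - of_int (z j) * \<epsilon> * (s - t)\<bar> \<le> \<epsilon> * \<bar>s - t\<bar>"
      by (auto simp: app_def)
    define c where "c j = (if j < n then z j else 0)" for j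
    define w where "w = (\<lambda>j. of_int (c j) * \<epsilon>)"
    have w: "w \<in> grid_directions n \<epsilon> L"
      unfolding grid_directions_def
    proof (rule CollectI, rule bexI[of _ c], intro conjI allI impI)
      show "w = (\<lambda>j. of_int (c j) * \<epsilon>)" by (rule w_def)
      show "\<bar>of_int (c j) * \<epsilon>\<bar> \<le> L + 2 * \<epsilon>" if "j < n" for j using z[OF that] that by (simp add: c_def)
      show "c \<in> int_points n" by (simp add: c_def int_points_def)
    qed
    define d0 where "d0 = Min (insert 1 (d ` {..<n}))"
    have d0: "0 < d0" "\<And>j. j < n \<Longrightarrow> d0 \<le> d j" using d(1) by (auto simp: d0_def)
    obtain m where m: "1 / real (Suc m) < d0" using d0(1) nat_approx_posE by blast
    have loc0: "\<bar>\<phi> j (\<gamma> s) - \<phi> j (\<gamma> t) - w j * (s - t)\<bar> \<le> \<epsilon> * \<bar>s - t\<bar>" if "\<bar>s - t\<bar> < d0" "j < n" for s j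
      using d(2)[OF that(2), of s] d0(2)[OF that(2)] that by (simp add: w_def c_def)
    have "loc w (1 / real (Suc m)) t" unfolding loc_def using loc0 m by auto
    moreover have "t \<in> {real k / real (Suc (Suc m))..real (Suc k) / real (Suc (Suc m))}"
      if "k = nat \<lfloor>t * real (Suc (Suc m))\<rfloor>" for k
    proof -
      have "0 \<le> t * real (Suc (Suc m))" using t by simp
      then have "real k \<le> t * real (Suc (Suc m))" "t * real (Suc (Suc m)) \<le> real (Suc k)"
        unfolding that by linarith+
      then show ?thesis by (simp add: pos_divide_le_eq pos_le_divide_eq del: of_nat_Suc)
    qed
    ultimately have "t \<in> T w m (nat \<lfloor>t * real (Suc (Suc m))\<rfloor>)" using t by (auto simp: T_def)
    then have "w \<notin> W0" using t(1) unfolding Z_def by blast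
    then have vw: "\<bar>\<Sum>j<n. v j * w j\<bar> \<le> a" using W[OF w] w by (auto simp: W0_def)
    show ?thesis
    proof (intro exI[of _ d0] conjI allI impI)
      fix s assume s: "\<bar>s - t\<bar> < d0"
      have "lincomb n v \<phi> (\<gamma> s) - lincomb n v \<phi> (\<gamma> t) =
        (\<Sum>j<n. v j * w j) * (s - t) + (\<Sum>j<n. v j * (\<phi> j (\<gamma> s) - \<phi> j (\<gamma> t) - w j * (s - t)))"
      proof -
        have "lincomb n v \<phi> (\<gamma> s) - lincomb n v \<phi> (\<gamma> t) = (\<Sum>j<n. v j * \<phi> j (\<gamma> s) - v j * \<phi> j (\<gamma> t))"
          unfolding lincomb_def by (rule sum_subtractf[symmetric])
        also have "\<dots> = (\<Sum>j<n. v j * w j * (s - t) + v j * (\<phi> j (\<gamma> s) - \<phi> j (\<gamma> t) - w j * (s - t)))"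
          by (rule sum.cong) (auto simp: algebra_simps)
        finally show ?thesis by (simp only: sum.distrib sum_distrib_right)
      qed
      moreover have "\<bar>\<Sum>j<n. v j * (\<phi> j (\<gamma> s) - \<phi> j (\<gamma> t) - w j * (s - t))\<bar> \<le> \<epsilon> * \<bar>s - t\<bar>"
        by (rule lincomb_diff_bound[OF v]) (rule loc0[OF s])
      moreover have "\<bar>(\<Sum>j<n. v j * w j) * (s - t)\<bar> \<le> a * \<bar>s - t\<bar>"
        using vw by (simp add: abs_mult mult_right_mono)
      ultimately show "\<bar>lincomb n v \<phi> (\<gamma> s) - lincomb n v \<phi> (\<gamma> t)\<bar> \<le> (a + \<epsilon>) * \<bar>s - t\<bar>"
        unfolding distrib_right by linarith
    qed (rule d0)
  qed
  ultimately show ?thesis by blast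
qed

definition Lip_dominated :: "real \<Rightarrow> 'a::metric_space measure \<Rightarrow> bool" where
  "Lip_dominated C \<nu> \<longleftrightarrow> (\<forall>f \<rho>. lipschitz_fun f \<and> upper_gradient f \<rho> \<longrightarrow> (AE x in \<nu>. Lip f x \<le> ennreal (C * \<rho> x)))"

text \<open>The combination given by \<open>v\<close> has an upper gradient equal to
  \<open>a + \<epsilon>\<close> on \<open>P\<close>. By \<open>small\<close>, even \<open>C\<close>
  times this value stays below the lower bound \<open>1 / (m + 1)\<close> that independence
  imposes.\<close>

lemma null_of_near_hyperplane:
  fixes \<phi> :: "nat \<Rightarrow> 'a::metric_space \<Rightarrow> real" and \<nu> :: "'a measure"
  assumes dom: "Lip_dominated C \<nu>" and C: "0 < C"
    and \<phi>: "\<And>j. j < n \<Longrightarrow> L-lipschitz_on UNIV (\<phi> j)" and \<epsilon>: "0 < \<epsilon>" and L: "a + \<epsilon> \<le> L" "0 \<le> a"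
    and small: "C * (a + \<epsilon>) < 1 / real (Suc m)"
    and v: "(\<Sum>j<n. \<bar>v j\<bar>) = 1"
    and W: "\<And>w. w \<in> grid_directions n \<epsilon> L \<Longrightarrow> direction_null n \<phi> \<epsilon> w P \<or> \<bar>\<Sum>j<n. v j * w j\<bar> \<le> a"
    and P: "P \<in> sets borel" "P \<subseteq> indep_set n \<phi> m"
  shows "AE x in \<nu>. x \<notin> P"
proof -
  let ?f = "lincomb n v \<phi>"
  have lip: "L-lipschitz_on UNIV ?f" using \<phi> L \<epsilon> v by (intro lipschitz_on_lincomb) auto
  have "upper_gradient ?f (\<lambda>x. if x \<in> P then a + \<epsilon> else L)"
    by (rule upper_gradient_two_values[OF lip P(1)])
      (use L \<epsilon> small_derivative_on_null_directions[OF \<phi> \<epsilon> v W] in auto)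
  then have "AE x in \<nu>. Lip ?f x \<le> ennreal (C * (if x \<in> P then a + \<epsilon> else L))"
    using dom lip unfolding Lip_dominated_def lipschitz_fun_def by blast
  then show ?thesis
  proof (rule AE_mp, intro AE_I2 impI notI)
    fix x assume x: "Lip ?f x \<le> ennreal (C * (if x \<in> P then a + \<epsilon> else L))" "x \<in> P"
    then have "ennreal ((\<Sum>j<n. \<bar>v j\<bar>) / real (Suc m)) \<le> Lip ?f x"
      using P(2) by (auto simp: indep_set_def)
    then have "ennreal (1 / real (Suc m)) \<le> ennreal (C * (a + \<epsilon>))" using x v by (auto dest: order.trans)
    then show False using small C L \<epsilon> by (simp add: ennreal_le_iff)
  qed
qed

section \<open>Calculus of the pointwise Lipschitz constant\<close>

lemma Lip_le_iff:
  fixes f :: "'a::metric_space \<Rightarrow> real"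
  assumes c: "0 \<le> c"
  shows "Lip f x \<le> ennreal c \<longleftrightarrow> (\<forall>e>0. \<forall>\<^sub>F y in at x. \<bar>f y - f x\<bar> \<le> (c + e) * dist y x)"
proof
  assume *: "Lip f x \<le> ennreal c"
  show "\<forall>e>0. \<forall>\<^sub>F y in at x. \<bar>f y - f x\<bar> \<le> (c + e) * dist y x"
  proof (intro allI impI)
    fix e :: real assume e: "0 < e"
    then have "ennreal c < ennreal (c + e)" using c by (simp add: ennreal_less_iff)
    then have "\<forall>\<^sub>F y in at x. ennreal (\<bar>f y - f x\<bar> / dist x y) < ennreal (c + e)"
      using * unfolding Lip_def Limsup_le_iff by blast
    moreover have "\<forall>\<^sub>F y in at x. y \<noteq> x" by (rule eventually_neq_at_within)
    ultimately show "\<forall>\<^sub>F y in at x. \<bar>f y - f x\<bar> \<le> (c + e) * dist y x"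
    proof eventually_elim
      case (elim y)
      then have "\<bar>f y - f x\<bar> / dist x y < c + e" by (simp add: ennreal_less_iff)
      then show ?case using elim(2) by (simp add: pos_divide_less_eq dist_commute)
    qed
  qed
next
  assume *: "\<forall>e>0. \<forall>\<^sub>F y in at x. \<bar>f y - f x\<bar> \<le> (c + e) * dist y x"
  show "Lip f x \<le> ennreal c"
  proof (rule ennreal_le_epsilon)
    fix e :: real assume e: "0 < e"
    have "\<forall>\<^sub>F y in at x. \<bar>f y - f x\<bar> \<le> (c + e) * dist y x" using * e by blast
    moreover have "\<forall>\<^sub>F y in at x. y \<noteq> x" by (rule eventually_neq_at_within)
    ultimately have "\<forall>\<^sub>F y in at x. ennreal (\<bar>f y - f x\<bar> / dist x y) \<le> ennreal (c + e)"
    proof eventually_elim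
      case (elim y)
      then have "\<bar>f y - f x\<bar> / dist x y \<le> c + e" by (simp add: pos_divide_le_eq dist_commute)
      then show ?case by (rule ennreal_leI)
    qed
    then have "Lip f x \<le> ennreal (c + e)" unfolding Lip_def by (rule Limsup_bounded)
    then show "Lip f x \<le> ennreal c + ennreal e" using c e by simp
  qed
qed

lemma Lip_add_le:
  assumes "0 \<le> a" "0 \<le> b" "Lip f x \<le> ennreal a" "Lip g x \<le> ennreal b"
  shows "Lip (\<lambda>y. f y + g y) x \<le> ennreal (a + b)"
proof (subst Lip_le_iff, use assms in simp, intro allI impI)
  fix e :: real assume "0 < e"
  then have "0 < e / 2" by simp
  then have "\<forall>\<^sub>F y in at x. \<bar>f y - f x\<bar> \<le> (a + e/2) * dist y x" "\<forall>\<^sub>F y in at x. \<bar>g y - g x\<bar> \<le> (b + e/2) * dist y x"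
    using assms Lip_le_iff by blast+
  then show "\<forall>\<^sub>F y in at x. \<bar>f y + g y - (f x + g x)\<bar> \<le> (a + b + e) * dist y x"
  proof eventually_elim
    case (elim y)
    have "(a + b + e) * dist y x = (a + e/2) * dist y x + (b + e/2) * dist y x" by (simp add: algebra_simps)
    then show ?case using elim by linarith
  qed
qed

lemma Lip_cmult_le:
  assumes "0 \<le> a" "Lip f x \<le> ennreal a"
  shows "Lip (\<lambda>y. c * f y) x \<le> ennreal (\<bar>c\<bar> * a)"
proof (subst Lip_le_iff, use assms in simp, intro allI impI)
  fix e :: real assume e: "0 < e"
  then have "0 < e / (\<bar>c\<bar> + 1)" by simp
  then have "\<forall>\<^sub>F y in at x. \<bar>f y - f x\<bar> \<le> (a + e / (\<bar>c\<bar> + 1)) * dist y x"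
    using assms Lip_le_iff by blast
  then show "\<forall>\<^sub>F y in at x. \<bar>c * f y - c * f x\<bar> \<le> (\<bar>c\<bar> * a + e) * dist y x"
  proof eventually_elim
    case (elim y)
    have "\<bar>c * f y - c * f x\<bar> = \<bar>c\<bar> * \<bar>f y - f x\<bar>" by (simp add: abs_mult flip: right_diff_distrib)
    also have "\<dots> \<le> \<bar>c\<bar> * ((a + e / (\<bar>c\<bar> + 1)) * dist y x)" using elim by (intro mult_left_mono) auto
    also have "\<dots> = (\<bar>c\<bar> * a + e * (\<bar>c\<bar> / (\<bar>c\<bar> + 1))) * dist y x" by (simp add: algebra_simps)
    also have "\<dots> \<le> (\<bar>c\<bar> * a + e * 1) * dist y x"
      using e by (intro mult_right_mono add_left_mono mult_left_mono) auto
    finally show ?case by simp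
  qed
qed

lemma Lip_le_lipschitz:
  assumes "L-lipschitz_on UNIV f"
  shows "Lip f x \<le> ennreal L"
proof -
  have L: "0 \<le> L" using assms by (rule lipschitz_on_nonneg)
  have "\<bar>f y - f x\<bar> \<le> (L + e) * dist y x" if "0 < e" for e y
  proof -
    have "\<bar>f y - f x\<bar> \<le> L * dist y x" using lipschitz_onD[OF assms, of y x] by (simp add: dist_real_def)
    moreover have "0 \<le> e * dist y x" using that by simp
    ultimately show ?thesis unfolding distrib_right by linarith
  qed
  then show ?thesis using L by (subst Lip_le_iff) auto
qed

lemma Lip_lincomb_le:
  assumes "\<And>j. j < n \<Longrightarrow> L-lipschitz_on UNIV (\<phi> j)" "0 \<le> L"
  shows "Lip (lincomb n v \<phi>) x \<le> ennreal (L * (\<Sum>j<n. \<bar>v j\<bar>))"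
proof (rule Lip_le_lipschitz, rule lipschitz_onI)
  fix x y
  have "\<bar>\<Sum>j<n. v j * (\<phi> j x - \<phi> j y)\<bar> \<le> (\<Sum>j<n. \<bar>v j\<bar> * (L * dist x y))"
  proof (intro order.trans[OF sum_abs] sum_mono)
    fix j assume "j \<in> {..<n}"
    then have "\<bar>\<phi> j x - \<phi> j y\<bar> \<le> L * dist x y" using lipschitz_onD[OF assms(1)[of j], of x y] by (simp add: dist_real_def)
    then show "\<bar>v j * (\<phi> j x - \<phi> j y)\<bar> \<le> \<bar>v j\<bar> * (L * dist x y)" by (simp add: abs_mult mult_left_mono)
  qed
  also have "\<dots> = L * (\<Sum>j<n. \<bar>v j\<bar>) * dist x y" by (simp add: sum_distrib_left sum_distrib_right mult_ac)
  finally show "dist (lincomb n v \<phi> x) (lincomb n v \<phi> y) \<le> L * (\<Sum>j<n. \<bar>v j\<bar>) * dist x y"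
    by (simp add: lincomb_def dist_real_def sum_subtractf right_diff_distrib)
qed (use assms in \<open>auto intro!: mult_nonneg_nonneg sum_nonneg\<close>)

text \<open>The limsup is an infimum over countably many radii of suprema over uncountably many
  \<open>y\<close>. For fixed \<open>y\<close> the admissible \<open>x\<close> with quotient above a
  level form an open set, so each supremum is lower semicontinuous.\<close>

lemma Lip_borel_measurable:
  fixes f :: "'a::metric_space \<Rightarrow> real"
  assumes f: "continuous_on UNIV f"
  shows "Lip f \<in> borel_measurable borel"
proof -
  define q where "q y x = ennreal (\<bar>f y - f x\<bar> / dist x y)" for x y
  define g where "g m x = (SUP y\<in>ball x (1 / real (Suc m)) - {x}. q y x)" for m :: nat and x
  have "Lip f x = (INF m. g m x)" for x
    unfolding Lip_def Limsup_at q_def[symmetric]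
  proof (rule antisym)
    show "(INF e\<in>{0<..}. SUP y\<in>ball x e - {x}. q y x) \<le> (INF m. g m x)"
      unfolding g_def by (rule INF_mono) (auto intro!: bexI[of _ "1 / real (Suc _)"])
    show "(INF m. g m x) \<le> (INF e\<in>{0<..}. SUP y\<in>ball x e - {x}. q y x)"
    proof (rule INF_mono)
      fix e :: real assume "e \<in> {0<..}"
      then obtain m where m: "1 / real (Suc m) < e" using nat_approx_posE[of e] by auto
      have "g m x \<le> (SUP y\<in>ball x e - {x}. q y x)"
        unfolding g_def by (rule SUP_subset_mono) (use m in auto)
      then show "\<exists>m\<in>UNIV. g m x \<le> (SUP y\<in>ball x e - {x}. q y x)" by blast
    qed
  qed
  moreover have "g m \<in> borel_measurable borel" for m
  proof (rule borel_measurableI_greater)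
    fix a
    have "{x \<in> space borel. a < g m x} = (\<Union>y. (- {y} \<inter> ball y (1 / real (Suc m))) \<inter> q y -` {a<..})"
      by (auto simp: g_def less_SUP_iff dist_commute)
    also have "open \<dots>"
    proof (intro open_UN ballI continuous_open_preimage)
      fix y
      show "continuous_on (- {y} \<inter> ball y (1 / real (Suc m))) (q y)"
        unfolding q_def using continuous_on_subset[OF f, of "- {y} \<inter> ball y (1 / real (Suc m))"]
        by (intro continuous_on_ennreal continuous_on_divide continuous_on_rabs continuous_on_diff continuous_on_dist continuous_on_const continuous_on_id) auto
    qed auto
    finally show "{x \<in> space borel. a < g m x} \<in> sets borel" by simp
  qed
  ultimately have "Lip f = (\<lambda>x. INF m. g m x)" "\<And>m. g m \<in> borel_measurable borel" by auto
  then show ?thesis by simp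
qed

section \<open>Measurability of the independence sets\<close>

definition rational_vectors :: "nat \<Rightarrow> (nat \<Rightarrow> real) set" where
  "rational_vectors n = (\<lambda>(c, k) j. of_int (c j) / real (Suc k)) ` (int_points n \<times> (UNIV :: nat set))"

lemma countable_rational_vectors: "countable (rational_vectors n)"
  unfolding rational_vectors_def by (intro countable_image countable_SIGMA countable_int_points) auto

lemma rational_vectors_dense:
  assumes "0 < e"
  shows "\<exists>v'\<in>rational_vectors n. (\<Sum>j<n. \<bar>v' j - v j\<bar>) < e"
proof -
  have "0 < e / (n + 1)" using assms by simp
  then obtain k where k: "1 / real (Suc k) < e / (n + 1)" using nat_approx_posE by blast
  define c where "c j = (if j < n then \<lfloor>real (Suc k) * v j\<rfloor> else 0)" for j
  define v' where "v' j = of_int (c j) / real (Suc k)" for j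
  have "(c, k) \<in> int_points n \<times> UNIV" by (simp add: c_def int_points_def)
  then have v': "v' \<in> rational_vectors n" unfolding rational_vectors_def v'_def[abs_def] by (rule rev_image_eqI) simp
  have "\<bar>v' j - v j\<bar> \<le> 1 / real (Suc k)" if "j < n" for j
  proof -
    have "\<bar>of_int (c j) - real (Suc k) * v j\<bar> \<le> 1" using that unfolding c_def by simp linarith
    moreover have "v' j - v j = (of_int (c j) - real (Suc k) * v j) / real (Suc k)" by (simp add: v'_def field_simps)
    ultimately show ?thesis by (simp add: abs_divide divide_right_mono)
  qed
  then have "(\<Sum>j<n. \<bar>v' j - v j\<bar>) \<le> (\<Sum>j<n. 1 / real (Suc k))" by (intro sum_mono) auto
  also have "\<dots> = real n * (1 / real (Suc k))" by simp
  also have "\<dots> \<le> real n * (e / (n + 1))" using k by (intro mult_left_mono) auto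
  also have "\<dots> < e" using assms by (simp add: field_simps)
  finally show ?thesis using v' by blast
qed

lemma lincomb_add: "lincomb n (\<lambda>j. u j + v j) \<phi> = (\<lambda>y. lincomb n u \<phi> y + lincomb n v \<phi> y)"
  by (rule ext) (simp add: lincomb_def distrib_right sum.distrib)

lemma lincomb_cmult: "lincomb n (\<lambda>j. c * v j) \<phi> = (\<lambda>y. c * lincomb n v \<phi> y)"
  by (rule ext) (simp add: lincomb_def sum_distrib_left mult.assoc)

text \<open>Both sides are Lipschitz in \<open>v\<close> for the 1-norm; for \<open>Lip\<close> this
  follows from subadditivity and the bound by \<open>L\<close>. So countably many conditions
  determine the set.\<close>

lemma indep_setI_rational:
  assumes \<phi>: "\<And>j. j < n \<Longrightarrow> L-lipschitz_on UNIV (\<phi> j)" "0 \<le> L"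
    and rat: "\<And>v. v \<in> rational_vectors n \<Longrightarrow> ennreal ((\<Sum>j<n. \<bar>v j\<bar>) / real (Suc m)) \<le> Lip (lincomb n v \<phi>) x"
  shows "x \<in> indep_set n \<phi> m"
  unfolding indep_set_def
proof (rule CollectI, rule allI, rule ccontr)
  fix v :: "nat \<Rightarrow> real"
  define S where "S = (\<Sum>j<n. \<bar>v j\<bar>)"
  define M where "M = real (Suc m)"
  have M: "0 < M" by (simp add: M_def)
  assume "\<not> ennreal ((\<Sum>j<n. \<bar>v j\<bar>) / real (Suc m)) \<le> Lip (lincomb n v \<phi>) x"
  then have less: "Lip (lincomb n v \<phi>) x < ennreal (S / M)" by (simp add: S_def M_def not_le)
  define r where "r = enn2real (Lip (lincomb n v \<phi>) x)"
  have "Lip (lincomb n v \<phi>) x < top" using less by (rule less_trans) simp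
  then have r: "Lip (lincomb n v \<phi>) x = ennreal r" "0 \<le> r" by (auto simp: r_def)
  then have gap: "0 < S / M - r" using less by (simp add: ennreal_less_iff)
  \<comment> \<open>A perturbation of 1-norm \<open>e\<close> shifts the two sides by at most
    \<open>e / M\<close> and \<open>L * e\<close>, together exactly the gap.\<close>
  define e where "e = (S / M - r) / (1 / M + L)"
  have "0 < 1 / M + L" using M \<phi>(2) by (simp add: add_pos_nonneg)
  then have e: "0 < e" "e * (1 / M + L) = S / M - r" using gap by (auto simp: e_def)
  obtain v' where v': "v' \<in> rational_vectors n" "(\<Sum>j<n. \<bar>v' j - v j\<bar>) < e" using rational_vectors_dense[OF e(1)] by blast
  let ?d = "\<Sum>j<n. \<bar>v' j - v j\<bar>"
  have "Lip (lincomb n (\<lambda>j. v' j - v j) \<phi>) x \<le> ennreal (L * ?d)" by (rule Lip_lincomb_le[OF \<phi>])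
  then have "Lip (\<lambda>y. lincomb n v \<phi> y + lincomb n (\<lambda>j. v' j - v j) \<phi> y) x \<le> ennreal (r + L * ?d)"
    using r \<phi>(2) by (intro Lip_add_le) (auto intro!: mult_nonneg_nonneg sum_nonneg)
  then have "Lip (lincomb n v' \<phi>) x \<le> ennreal (r + L * ?d)" by (simp add: lincomb_add[symmetric])
  with rat[OF v'(1)] have "ennreal ((\<Sum>j<n. \<bar>v' j\<bar>) / M) \<le> ennreal (r + L * ?d)" unfolding M_def by (rule order.trans)
  then have "(\<Sum>j<n. \<bar>v' j\<bar>) / M \<le> r + L * ?d"
    using r \<phi>(2) by (subst (asm) ennreal_le_iff) (auto intro!: add_nonneg_nonneg mult_nonneg_nonneg sum_nonneg)
  moreover have "S - ?d \<le> (\<Sum>j<n. \<bar>v' j\<bar>)"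
    unfolding S_def sum_subtractf[symmetric] by (intro sum_mono) linarith
  then have "(S - ?d) / M \<le> (\<Sum>j<n. \<bar>v' j\<bar>) / M" using M by (intro divide_right_mono) auto
  ultimately have "S / M - r \<le> ?d * (1 / M + L)" by (simp add: algebra_simps diff_divide_distrib)
  also have "\<dots> < e * (1 / M + L)" using v'(2) \<open>0 < 1 / M + L\<close> by (rule mult_strict_right_mono)
  finally show False using e(2) by simp
qed

lemma continuous_on_lincomb:
  assumes "\<And>j. j < n \<Longrightarrow> L-lipschitz_on UNIV (\<phi> j)"
  shows "continuous_on UNIV (lincomb n v \<phi>)"
  unfolding lincomb_def using lipschitz_on_continuous_on[OF assms] by (intro continuous_intros) auto

lemma indep_set_borel:
  fixes \<phi> :: "nat \<Rightarrow> 'a::metric_space \<Rightarrow> real"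
  assumes \<phi>: "\<And>j. j < n \<Longrightarrow> L-lipschitz_on UNIV (\<phi> j)" "0 \<le> L"
  shows "indep_set n \<phi> m \<in> sets borel"
proof -
  define A where "A v = {x. ennreal ((\<Sum>j<n. \<bar>v j\<bar>) / real (Suc m)) \<le> Lip (lincomb n v \<phi>) x}" for v
  have "indep_set n \<phi> m = (\<Inter>v\<in>rational_vectors n. A v)"
    using indep_setI_rational[OF \<phi>] by (auto simp: A_def indep_set_def)
  moreover have "A v \<in> sets borel" for v
  proof -
    have [measurable]: "Lip (lincomb n v \<phi>) \<in> borel_measurable borel"
      by (intro Lip_borel_measurable continuous_on_lincomb[OF \<phi>(1)])
    show ?thesis unfolding A_def by measurable
  qed
  ultimately show ?thesis using countable_rational_vectors[of n] by (auto intro!: sets.countable_INT'')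
qed


section \<open>Independent families with more members than the dimension allows\<close>

text \<open>The factors \<open>lam ^ k\<close> turn the triangular family of directions into a nearly diagonal one.\<close>
lemma triangular_fragment:
  fixes \<phi> :: "nat \<Rightarrow> 'a::metric_space \<Rightarrow> real" and \<gamma> :: "real \<Rightarrow> 'a"
  assumes \<phi>: "\<And>j. j < n \<Longrightarrow> L-lipschitz_on UNIV (\<phi> j)" "0 \<le> L"
    and \<gamma>: "1-lipschitz_on UNIV \<gamma>"
    and a: "0 < a" and \<epsilon>: "0 < \<epsilon>" "\<epsilon> \<le> a / 2" "\<epsilon> * lam ^ n \<le> \<delta> * (a / 2)"
    and lam: "1 \<le> lam" "L \<le> \<delta> * lam * (a / 2)" and \<delta>: "0 < \<delta>"
    and tri: "\<And>k. k < n \<Longrightarrow> (\<Sum>j<n. \<bar>vs k j\<bar>) = 1" "a < \<bar>\<Sum>j<n. vs i j * w j\<bar>"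
      "\<And>k. k < n \<Longrightarrow> i < k \<Longrightarrow> (\<Sum>j<n. vs k j * w j) = 0"
    and i: "i < n"
    and frag: "\<And>j. j < n \<Longrightarrow> \<bar>\<phi> j (\<gamma> s) - \<phi> j (\<gamma> t) - w j * (s - t)\<bar> \<le> \<epsilon> * \<bar>s - t\<bar>"
  defines "\<psi> \<equiv> \<lambda>k x. lam ^ k * lincomb n (vs k) \<phi> x"
  shows "lam ^ i * (a / 2) * \<bar>s - t\<bar> \<le> \<bar>\<psi> i (\<gamma> s) - \<psi> i (\<gamma> t)\<bar>"
    and "\<And>k. k < n \<Longrightarrow> k \<noteq> i \<Longrightarrow> \<bar>\<psi> k (\<gamma> s) - \<psi> k (\<gamma> t)\<bar> \<le> \<delta> * \<bar>\<psi> i (\<gamma> s) - \<psi> i (\<gamma> t)\<bar>"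
proof -
  define D where "D k = lincomb n (vs k) \<phi> (\<gamma> s) - lincomb n (vs k) \<phi> (\<gamma> t)" for k
  have \<psi>D: "\<bar>\<psi> k (\<gamma> s) - \<psi> k (\<gamma> t)\<bar> = lam ^ k * \<bar>D k\<bar>" for k
    using lam(1) by (simp add: \<psi>_def D_def abs_mult flip: right_diff_distrib)
  have Dw: "\<bar>D k - (\<Sum>j<n. vs k j * w j) * (s - t)\<bar> \<le> \<epsilon> * \<bar>s - t\<bar>" if k: "k < n" for k
  proof -
    have "D k - (\<Sum>j<n. vs k j * w j) * (s - t) = (\<Sum>j<n. vs k j * (\<phi> j (\<gamma> s) - \<phi> j (\<gamma> t) - w j * (s - t)))"
      by (simp add: D_def lincomb_def sum_distrib_right sum_subtractf right_diff_distrib mult.assoc)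
    then show ?thesis using lincomb_diff_bound[OF tri(1)[OF k] frag] by simp
  qed
  have DL: "\<bar>D k\<bar> \<le> L * \<bar>s - t\<bar>" if k: "k < n" for k
  proof -
    have "L-lipschitz_on UNIV (\<lambda>t. lincomb n (vs k) \<phi> (\<gamma> t))"
      by (rule lipschitz_compose_curve[OF lipschitz_on_lincomb[OF \<phi> tri(1)[OF k]] \<gamma>])
    from lipschitz_onD[OF this, of s t] show ?thesis by (simp add: D_def dist_real_def)
  qed
  have Di: "(a / 2) * \<bar>s - t\<bar> \<le> \<bar>D i\<bar>"
  proof -
    let ?u = "\<Sum>j<n. vs i j * w j"
    have "a * \<bar>s - t\<bar> \<le> \<bar>?u * (s - t)\<bar>" using tri(2) by (simp add: abs_mult mult_right_mono)
    moreover have "\<epsilon> * \<bar>s - t\<bar> \<le> (a / 2) * \<bar>s - t\<bar>" using \<epsilon>(2) by (intro mult_right_mono) auto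
    moreover have "a * \<bar>s - t\<bar> = (a / 2) * \<bar>s - t\<bar> + (a / 2) * \<bar>s - t\<bar>" by simp
    ultimately show ?thesis using Dw[OF i] by linarith
  qed
  have lami: "1 \<le> lam ^ k" for k using lam(1) by (rule one_le_power)
  show "lam ^ i * (a / 2) * \<bar>s - t\<bar> \<le> \<bar>\<psi> i (\<gamma> s) - \<psi> i (\<gamma> t)\<bar>"
    unfolding \<psi>D mult.assoc using Di lami[of i] by (intro mult_left_mono) auto
  show "\<bar>\<psi> k (\<gamma> s) - \<psi> k (\<gamma> t)\<bar> \<le> \<delta> * \<bar>\<psi> i (\<gamma> s) - \<psi> i (\<gamma> t)\<bar>" if k: "k < n" "k \<noteq> i" for k
  proof -
    have "lam ^ k * \<bar>D k\<bar> \<le> \<delta> * (lam ^ i * (a / 2 * \<bar>s - t\<bar>))"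
    proof (cases "i < k")
      case True
      \<comment> \<open>For \<open>k > i\<close> the vector \<open>vs k\<close> annihilates
        \<open>w\<close>. Only the error \<epsilon> remains, and it was chosen small against every
        power of \<open>lam\<close> that occurs.\<close>
      then have "\<bar>D k\<bar> \<le> \<epsilon> * \<bar>s - t\<bar>" using Dw[OF k(1)] tri(3)[OF k(1)] by simp
      then have "lam ^ k * \<bar>D k\<bar> \<le> lam ^ n * (\<epsilon> * \<bar>s - t\<bar>)"
        using lam(1) k(1) lami by (intro mult_mono power_increasing) (auto intro: order.trans[OF zero_le_one])
      also have "\<dots> = (\<epsilon> * lam ^ n) * \<bar>s - t\<bar>" by simp
      also have "\<dots> \<le> \<delta> * (a / 2) * \<bar>s - t\<bar>" using \<epsilon>(3) by (intro mult_right_mono) auto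
      also have "\<dots> = \<delta> * (1 * (a / 2 * \<bar>s - t\<bar>))" by simp
      also have "\<dots> \<le> \<delta> * (lam ^ i * (a / 2 * \<bar>s - t\<bar>))"
        using lami[of i] \<delta> a by (intro mult_left_mono mult_right_mono) auto
      finally show ?thesis .
    next
      case False
      \<comment> \<open>For \<open>k < i\<close> only the Lipschitz bound is available, but
        \<open>\<psi> i\<close> carries at least one more factor \<open>lam\<close>, which outweighs
        \<open>L\<close>.\<close>
      then have ki: "Suc k \<le> i" using k(2) by simp
      have "lam ^ k * \<bar>D k\<bar> \<le> lam ^ k * ((\<delta> * lam * (a / 2)) * \<bar>s - t\<bar>)"
        using order.trans[OF DL[OF k(1)] mult_right_mono[OF lam(2)]] lami[of k] by (intro mult_left_mono) auto
      also have "\<dots> = \<delta> * (lam ^ Suc k * (a / 2 * \<bar>s - t\<bar>))" by simp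
      also have "\<dots> \<le> \<delta> * (lam ^ i * (a / 2 * \<bar>s - t\<bar>))"
        using power_increasing[OF ki lam(1)] \<delta> a by (intro mult_left_mono mult_right_mono) auto
      finally show ?thesis .
    qed
    also have "\<dots> \<le> \<delta> * (lam ^ i * \<bar>D i\<bar>)" using Di lami[of i] \<delta> by (intro mult_left_mono) auto
    finally show ?thesis unfolding \<psi>D .
  qed
qed

text \<open>The constants are chosen in the order \<delta>, \<open>a\<close>, \<open>lam\<close>,
  \<epsilon>. This is consistent because \<delta> precedes the rescaled maps \<psi>, whose Lipschitz
  constant \<open>lam ^ n * L\<close> depends on it.\<close>

lemma indep_set_null:
  fixes \<phi> :: "nat \<Rightarrow> 'a::metric_space \<Rightarrow> real" and \<nu> :: "'a measure"
  assumes \<nu>: "finite_measure \<nu>" "sets \<nu> = sets borel"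
    and H: "hausdorff_measure s (UNIV :: 'a set) = 0" "0 \<le> s" "s < real n"
    and dom: "Lip_dominated C \<nu>" and C: "0 < C"
    and \<phi>: "\<And>j. j < n \<Longrightarrow> L-lipschitz_on UNIV (\<phi> j)" and L: "1 \<le> L"
  shows "AE x in \<nu>. x \<notin> indep_set n \<phi> m"
proof -
  obtain \<delta> where \<delta>: "0 < \<delta>" and dec0: "\<forall>(\<nu> :: 'a measure) \<psi> L. finite_measure \<nu> \<longrightarrow> sets \<nu> = sets borel \<longrightarrow>
    (\<forall>j<n. L-lipschitz_on UNIV (\<psi> j)) \<longrightarrow>
    (\<exists>S. (\<forall>i. S i \<in> sets borel) \<and> (AE x in \<nu>. \<exists>i<n. x \<in> S i) \<and>
      (\<forall>i<n. coordinate_null n \<psi> \<delta> i (S i)))"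
    using curve_null_decomposition[OF H(2,3,1)] by (elim exE conjE) (rule that)
  \<comment> \<open>Since \<open>\<epsilon> <= a / 2\<close>, this makes
    \<open>C * (a + \<epsilon>)\<close> smaller than \<open>1 / (m + 1)\<close>, the contradiction
    needed near a hyperplane; it also keeps \<open>a + \<epsilon>\<close> below
    \<open>L\<close>.\<close>
  define a where "a = 1 / (4 * (C + 1) * real (Suc m))"
  have a: "0 < a" using C by (simp add: a_def)
  have a4: "4 * (C + 1) * real (Suc m) * a = 1" using C by (simp add: a_def)
  have a1: "a \<le> 1 / 4"
  proof -
    have "1 * 1 \<le> (C + 1) * real (Suc m)" using C by (intro mult_mono) auto
    then have "4 * a * 1 \<le> 4 * a * ((C + 1) * real (Suc m))" using a by (intro mult_left_mono) auto
    also have "4 * a * ((C + 1) * real (Suc m)) = 4 * (C + 1) * real (Suc m) * a" by (simp only: mult_ac)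
    finally show ?thesis using a4 by linarith
  qed
  define lam where "lam = max 1 (2 * L / (\<delta> * a))"
  have lam: "1 \<le> lam" "L \<le> \<delta> * lam * (a / 2)"
  proof -
    have "2 * L / (\<delta> * a) \<le> lam" by (simp add: lam_def)
    then have "2 * L \<le> lam * (\<delta> * a)" using \<delta> a by (simp add: pos_divide_le_eq)
    moreover have "\<delta> * lam * (a / 2) = lam * (\<delta> * a) / 2" by (simp add: mult_ac)
    ultimately show "L \<le> \<delta> * lam * (a / 2)" by linarith
  qed (simp add: lam_def)
  define \<epsilon> where "\<epsilon> = min (a / 2) (\<delta> * (a / 2) / lam ^ n)"
  have \<epsilon>: "0 < \<epsilon>" "\<epsilon> \<le> a / 2" "\<epsilon> * lam ^ n \<le> \<delta> * (a / 2)"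
  proof -
    have ln: "0 < lam ^ n" using lam(1) by simp
    show "0 < \<epsilon>" using ln \<delta> a by (simp add: \<epsilon>_def)
    show "\<epsilon> \<le> a / 2" by (simp add: \<epsilon>_def)
    have "\<epsilon> \<le> \<delta> * (a / 2) / lam ^ n" by (simp add: \<epsilon>_def)
    then show "\<epsilon> * lam ^ n \<le> \<delta> * (a / 2)" using ln by (simp add: pos_le_divide_eq)
  qed
  have aL: "a + \<epsilon> \<le> L" using a1 \<epsilon>(2) a L by linarith
  have small: "C * (a + \<epsilon>) < 1 / real (Suc m)"
  proof -
    have "C * (a + \<epsilon>) \<le> C * (2 * a)" using C \<epsilon>(2) a by (intro mult_left_mono) auto
    also have "\<dots> = 2 * C * a" by simp
    also have "\<dots> < 4 * (C + 1) * a" using C a by (intro mult_strict_right_mono) auto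
    also have "\<dots> = 1 / real (Suc m)" using a4 by (simp add: field_simps)
    finally show ?thesis .
  qed
  let ?W = "grid_directions n \<epsilon> L"
  define tri where "tri \<sigma> vs \<longleftrightarrow> (\<forall>i<n. \<sigma> i \<in> ?W \<and> (\<Sum>j<n. \<bar>vs i j\<bar>) = 1 \<and> a < \<bar>\<Sum>j<n. vs i j * \<sigma> i j\<bar>) \<and>
    (\<forall>i<n. \<forall>l<i. (\<Sum>j<n. vs i j * \<sigma> l j) = 0)" for \<sigma> vs :: "nat \<Rightarrow> nat \<Rightarrow> real"
  \<comment> \<open>Tuples are taken extensional over the finite grid, so only finitely many
    splittings have to be superimposed.\<close>
  define good where "good = {\<sigma> \<in> PiE {..<n} (\<lambda>_. ?W). \<exists>vs. tri \<sigma> vs}"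
  have fin: "finite good"
  proof (rule finite_subset)
    show "good \<subseteq> PiE {..<n} (\<lambda>_. ?W)" by (auto simp: good_def)
    show "finite (PiE {..<n} (\<lambda>_. ?W))" by (intro finite_PiE finite_grid_directions \<epsilon>(1)) auto
  qed
  have dec: "\<exists>S. (\<forall>i. S i \<in> sets borel) \<and> (AE x in \<nu>. \<exists>i<n. x \<in> S i) \<and> (\<forall>i<n. direction_null n \<phi> \<epsilon> (\<sigma> i) (S i))"
    if \<sigma>: "\<sigma> \<in> good" for \<sigma>
  proof -
    obtain vs where vs: "tri \<sigma> vs" using \<sigma> unfolding good_def by blast
    define \<psi> where "\<psi> = (\<lambda>k x. lam ^ k * lincomb n (vs k) \<phi> x)"
    have lip: "\<forall>j<n. (lam ^ n * L)-lipschitz_on UNIV (\<psi> j)"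
    proof (intro allI impI)
      fix k assume k: "k < n"
      have "L-lipschitz_on UNIV (lincomb n (vs k) \<phi>)"
        using \<phi> L vs k by (intro lipschitz_on_lincomb) (auto simp: tri_def)
      then have "(lam ^ k * L)-lipschitz_on UNIV (\<psi> k)"
        unfolding \<psi>_def using lam(1) by (intro lipschitz_on_cmult_real_nonneg) auto
      moreover have "lam ^ k * L \<le> lam ^ n * L" using lam(1) k L by (intro mult_right_mono power_increasing) auto
      ultimately show "(lam ^ n * L)-lipschitz_on UNIV (\<psi> k)" by (rule lipschitz_on_mono[OF _ order_refl])
    qed
    from mp[OF mp[OF mp[OF spec[OF spec[OF spec[OF dec0, of \<nu>], of \<psi>], of "lam ^ n * L"] \<nu>(1)] \<nu>(2)] lip]
    obtain S where S: "\<forall>i. S i \<in> sets borel" "AE x in \<nu>. \<exists>i<n. x \<in> S i"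
      and Sn: "\<forall>i<n. coordinate_null n \<psi> \<delta> i (S i)"
      by (elim exE conjE) (rule that)
    have "direction_null n \<phi> \<epsilon> (\<sigma> i) (S i)" if i: "i < n" for i
      unfolding direction_null_def
    proof (intro allI impI)
      fix \<gamma> :: "real \<Rightarrow> 'a" and T
      assume \<gamma>: "1-lipschitz_on UNIV \<gamma>" and T: "T \<subseteq> {0..1}" "\<gamma> ` T \<subseteq> S i"
        and fr: "\<forall>t\<in>T. \<forall>s\<in>T. \<forall>j<n. \<bar>\<phi> j (\<gamma> s) - \<phi> j (\<gamma> t) - \<sigma> i j * (s - t)\<bar> \<le> \<epsilon> * \<bar>s - t\<bar>"
      have L0: "0 \<le> L" using L by simp
      have t1: "(\<Sum>j<n. \<bar>vs k j\<bar>) = 1" if "k < n" for k using vs that by (simp add: tri_def)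
      have t2: "a < \<bar>\<Sum>j<n. vs i j * \<sigma> i j\<bar>" using vs i by (simp add: tri_def)
      have t3: "(\<Sum>j<n. vs k j * \<sigma> i j) = 0" if "k < n" "i < k" for k using vs that by (simp add: tri_def)
      have fr': "\<bar>\<phi> j (\<gamma> s) - \<phi> j (\<gamma> t) - \<sigma> i j * (s - t)\<bar> \<le> \<epsilon> * \<bar>s - t\<bar>" if "t \<in> T" "s \<in> T" "j < n" for s t j
        using fr that by blast
      note tf = triangular_fragment[where n = n and \<phi> = \<phi> and L = L and \<gamma> = \<gamma> and a = a and \<epsilon> = \<epsilon> and lam = lam
          and \<delta> = \<delta> and vs = vs and i = i and w = "\<sigma> i", OF \<phi> L0 \<gamma> a \<epsilon> lam \<delta> t1 t2 t3 i fr']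
      show "negligible T"
      proof (rule Sn[unfolded coordinate_null_def, rule_format, OF i \<gamma> T(1) _ T(2)])
        show "0 < lam ^ i * (a / 2)" using lam(1) a by simp
        show "lam ^ i * (a / 2) * \<bar>t - t'\<bar> \<le> \<bar>\<psi> i (\<gamma> t) - \<psi> i (\<gamma> t')\<bar>" if "t \<in> T" "t' \<in> T" for t t'
          unfolding \<psi>_def by (rule tf(1)) (use that in auto)
        show "\<bar>\<psi> j (\<gamma> t) - \<psi> j (\<gamma> t')\<bar> \<le> \<delta> * \<bar>\<psi> i (\<gamma> t) - \<psi> i (\<gamma> t')\<bar>"
          if "t \<in> T" "t' \<in> T" "j < n" "j \<noteq> i" for t t' j
          unfolding \<psi>_def by (rule tf(2)) (use that in auto)
      qed
    qed
    then show ?thesis using S by blast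
  qed
  \<comment> \<open>\<open>P\<close> is cut by the decompositions of all good tuples in turn. In a piece for which none is left,
    the directions that are not null contain no good tuple, so they lie near a hyperplane.\<close>
  have main: "\<forall>P. P \<in> sets borel \<and> P \<subseteq> indep_set n \<phi> m \<and> (\<forall>\<sigma>\<in>good - G. \<exists>i<n. direction_null n \<phi> \<epsilon> (\<sigma> i) P) \<longrightarrow>
    (AE x in \<nu>. x \<notin> P)" if "finite G" for G
    using that
  proof (induction G rule: finite_induct)
    case empty
    show ?case
    proof (intro allI impI)
      fix P assume P: "P \<in> sets borel \<and> P \<subseteq> indep_set n \<phi> m \<and> (\<forall>\<sigma>\<in>good - {}. \<exists>i<n. direction_null n \<phi> \<epsilon> (\<sigma> i) P)"
      define J where "J = {w\<in>?W. \<not> direction_null n \<phi> \<epsilon> w P}"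
      have "\<exists>v. (\<Sum>j<n. \<bar>v j\<bar>) = 1 \<and> (\<forall>w\<in>J. \<bar>\<Sum>j<n. v j * w j\<bar> \<le> a)"
      proof (rule ccontr)
        assume "\<not> ?thesis"
        then have far: "\<exists>w\<in>J. a < \<bar>\<Sum>j<n. v j * w j\<bar>" if "(\<Sum>j<n. \<bar>v j\<bar>) = 1" for v
          using that by (meson not_le)
        have "\<exists>ws vs. (\<forall>i<n. ws i \<in> J \<and> (\<Sum>j<n. \<bar>vs i j\<bar>) = 1 \<and> a < \<bar>\<Sum>j<n. vs i j * ws i j\<bar>) \<and>
          (\<forall>i<n. \<forall>l<i. (\<Sum>j<n. vs i j * ws l j) = 0)"
          by (rule near_hyperplane_or_triangular[OF order_refl]) (rule far)
        then obtain ws vs where wv: "(\<forall>i<n. ws i \<in> J \<and> (\<Sum>j<n. \<bar>vs i j\<bar>) = 1 \<and> a < \<bar>\<Sum>j<n. vs i j * ws i j\<bar>) \<and>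
          (\<forall>i<n. \<forall>l<i. (\<Sum>j<n. vs i j * ws l j) = 0)" by (elim exE)
        define \<sigma> where "\<sigma> = restrict ws {..<n}"
        have "tri \<sigma> vs" using wv unfolding tri_def \<sigma>_def J_def by simp
        moreover have "\<sigma> \<in> PiE {..<n} (\<lambda>_. ?W)" using wv by (auto simp: \<sigma>_def J_def)
        ultimately have "\<sigma> \<in> good" unfolding good_def by blast
        then obtain i where "i < n" "direction_null n \<phi> \<epsilon> (\<sigma> i) P" using P by blast
        moreover have "\<sigma> i \<in> J" using wv \<open>i < n\<close> by (simp add: \<sigma>_def)
        ultimately show False by (simp add: J_def)
      qed
      then obtain v where v: "(\<Sum>j<n. \<bar>v j\<bar>) = 1" "\<And>w. w \<in> J \<Longrightarrow> \<bar>\<Sum>j<n. v j * w j\<bar> \<le> a" by blast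
      show "AE x in \<nu>. x \<notin> P"
        by (rule null_of_near_hyperplane[OF dom C \<phi> \<epsilon>(1) aL less_imp_le[OF a] small v(1)])
          (use v(2) P in \<open>auto simp: J_def\<close>)
    qed
  next
    case (insert \<sigma> G)
    show ?case
    proof (intro allI impI)
      fix P assume P: "P \<in> sets borel \<and> P \<subseteq> indep_set n \<phi> m \<and>
        (\<forall>\<tau>\<in>good - insert \<sigma> G. \<exists>i<n. direction_null n \<phi> \<epsilon> (\<tau> i) P)"
      show "AE x in \<nu>. x \<notin> P"
      proof (cases "\<sigma> \<in> good")
        case False
        then have "good - G = good - insert \<sigma> G" by blast
        then show ?thesis using insert.IH P by simp
      next
        case True
        from dec[OF True] obtain S where S: "\<forall>i. S i \<in> sets borel" "AE x in \<nu>. \<exists>i<n. x \<in> S i"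
          "\<forall>i<n. direction_null n \<phi> \<epsilon> (\<sigma> i) (S i)" by (elim exE conjE)
        have "AE x in \<nu>. x \<notin> P \<inter> S i" if i: "i < n" for i
        proof (rule insert.IH[rule_format], intro conjI ballI)
          show "P \<inter> S i \<in> sets borel" using P S(1) by auto
          show "P \<inter> S i \<subseteq> indep_set n \<phi> m" using P by auto
          fix \<tau> assume \<tau>: "\<tau> \<in> good - G"
          show "\<exists>k<n. direction_null n \<phi> \<epsilon> (\<tau> k) (P \<inter> S i)"
          proof (cases "\<tau> = \<sigma>")
            case True
            then show ?thesis using S(3) i direction_null_mono[of n \<phi> \<epsilon> "\<sigma> i" "S i" "P \<inter> S i"] by blast
          next
            case False
            then obtain k where "k < n" "direction_null n \<phi> \<epsilon> (\<tau> k) P" using P \<tau> by blast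
            then show ?thesis using direction_null_mono[of n \<phi> \<epsilon> "\<tau> k" P "P \<inter> S i"] by blast
          qed
        qed
        then have "AE x in \<nu>. \<forall>i\<in>{..<n}. x \<notin> P \<inter> S i" by (subst AE_ball_countable) auto
        with S(2) show ?thesis by eventually_elim auto
      qed
    qed
  qed
  have "indep_set n \<phi> m \<in> sets borel" by (rule indep_set_borel[OF \<phi>]) (use L in auto)
  then show ?thesis using main[OF fin] by auto
qed

subsection \<open>Charts\<close>

text \<open>Turns differentiability of \<open>f\<close> into the vanishing of \<open>Lip\<close> of
  a remainder, to which the rules for sums and multiples apply.\<close>

lemma tendsto_0_iff_Lip:
  fixes g :: "'a::metric_space \<Rightarrow> real"
  shows "((\<lambda>y. \<bar>g y - g x\<bar> / dist y x) \<longlongrightarrow> 0) (at x) \<longleftrightarrow> Lip g x \<le> ennreal 0"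
proof -
  have neq: "\<forall>\<^sub>F y in at x. y \<noteq> x" by (rule eventually_neq_at_within)
  show ?thesis
  proof
    assume *: "((\<lambda>y. \<bar>g y - g x\<bar> / dist y x) \<longlongrightarrow> 0) (at x)"
    show "Lip g x \<le> ennreal 0"
    proof (subst Lip_le_iff, simp, intro allI impI)
      fix e :: real assume "0 < e"
      then have "\<forall>\<^sub>F y in at x. dist (\<bar>g y - g x\<bar> / dist y x) 0 < e" using * unfolding tendsto_iff by blast
      then show "\<forall>\<^sub>F y in at x. \<bar>g y - g x\<bar> \<le> (0 + e) * dist y x"
        using neq by eventually_elim (simp add: dist_real_def pos_divide_less_eq)
    qed
  next
    assume *: "Lip g x \<le> ennreal 0"
    show "((\<lambda>y. \<bar>g y - g x\<bar> / dist y x) \<longlongrightarrow> 0) (at x)"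
      unfolding tendsto_iff
    proof (intro allI impI)
      fix e :: real assume e: "0 < e"
      have "\<forall>\<^sub>F y in at x. \<bar>g y - g x\<bar> \<le> (0 + e / 2) * dist y x"
        using * e Lip_le_iff[of 0 g x] half_gt_zero[OF e] by blast
      then show "\<forall>\<^sub>F y in at x. dist (\<bar>g y - g x\<bar> / dist y x) 0 < e"
        using neq
      proof eventually_elim
        case (elim y)
        then have "\<bar>g y - g x\<bar> / dist y x \<le> e / 2" by (simp add: pos_divide_le_eq)
        then have "\<bar>g y - g x\<bar> / dist y x < e" using e by linarith
        then show ?case by (simp add: dist_real_def)
      qed
    qed
  qed
qed

lemma mem_Rn_iff: "u \<in> Rn n \<longleftrightarrow> (\<forall>j\<ge>n. u j = 0)"
  by (simp add: topspace_Euclidean_space)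

definition linear_form :: "nat \<Rightarrow> (nat \<Rightarrow> real) \<Rightarrow> (nat \<Rightarrow> real) \<Rightarrow> real" where
  "linear_form n a = restrict (\<lambda>u. \<Sum>j<n. a j * u j) (Rn n)"

lemma linear_form_in: "linear_form n a \<in> linear_forms n"
proof -
  have "(\<lambda>j. u j + v j) \<in> Rn n" if "u \<in> Rn n" "v \<in> Rn n" for u v using that by (simp add: mem_Rn_iff)
  moreover have "(\<lambda>j. c * v j) \<in> Rn n" if "v \<in> Rn n" for c v using that by (simp add: mem_Rn_iff)
  ultimately show ?thesis
    by (auto simp: linear_forms_def linear_form_def distrib_left sum.distrib sum_distrib_left mult.left_commute)
qed

lemma linear_formsE:
  assumes D: "D \<in> linear_forms n"
  obtains a where "D = linear_form n a"
proof -
  define e where "e j = (\<lambda>i. if i = j then 1 else 0 :: real)" for j :: nat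
  define a where "a j = D (e j)" for j
  have add: "D (\<lambda>j. u j + v j) = D u + D v" if "u \<in> Rn n" "v \<in> Rn n" for u v
    using D that by (auto simp: linear_forms_def)
  have cm: "D (\<lambda>j. c * v j) = c * D v" if "v \<in> Rn n" for c v
    using D that by (auto simp: linear_forms_def)
  have "D u = (\<Sum>j<n. a j * u j)" if u: "u \<in> Rn n" for u
  proof -
    have "D (\<lambda>i. if i < m then u i else 0) = (\<Sum>j<m. a j * u j)" if "m \<le> n" for m
      using that
    proof (induction m)
      case 0
      have "D (\<lambda>j. 0 * u j) = 0 * D u" by (rule cm[OF u])
      then show ?case by simp
    next
      case (Suc m)
      have em: "e m \<in> Rn n" using Suc.prems by (simp add: mem_Rn_iff e_def)
      have "(\<lambda>i. if i < Suc m then u i else 0) = (\<lambda>i. (if i < m then u i else 0) + u m * e m i)"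
        by (auto simp: e_def fun_eq_iff less_Suc_eq)
      then have "D (\<lambda>i. if i < Suc m then u i else 0) = D (\<lambda>i. (if i < m then u i else 0) + u m * e m i)" by simp
      also have "\<dots> = D (\<lambda>i. if i < m then u i else 0) + D (\<lambda>i. u m * e m i)"
        by (rule add) (use Suc.prems em in \<open>auto simp: mem_Rn_iff\<close>)
      also have "\<dots> = (\<Sum>j<Suc m. a j * u j)" using Suc cm[OF em, of "u m"] by (simp add: a_def)
      finally show ?case .
    qed
    from this[of n] have "D (\<lambda>i. if i < n then u i else 0) = (\<Sum>j<n. a j * u j)" by simp
    moreover have "(\<lambda>i. if i < n then u i else 0) = u" using u by (auto simp: mem_Rn_iff fun_eq_iff)
    ultimately show ?thesis by simp
  qed
  moreover have "D \<in> extensional (Rn n)" using D by (simp add: linear_forms_def)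
  ultimately have "D = linear_form n a"
    unfolding linear_form_def by (intro extensionalityI[of _ "Rn n"]) auto
  then show ?thesis by (rule that)
qed

definition chart :: "nat \<Rightarrow> (nat \<Rightarrow> 'a \<Rightarrow> real) \<Rightarrow> 'a \<Rightarrow> nat \<Rightarrow> real" where
  "chart n \<phi> x j = (if j < n then \<phi> j x else 0)"

lemma linear_form_chart:
  "linear_form n a (\<lambda>j. chart n \<phi> y j - chart n \<phi> x j) = lincomb n a \<phi> y - lincomb n a \<phi> x"
proof -
  have "(\<lambda>j. chart n \<phi> y j - chart n \<phi> x j) \<in> Rn n" by (simp add: mem_Rn_iff chart_def)
  then show ?thesis
    by (simp add: linear_form_def lincomb_def chart_def right_diff_distrib sum_subtractf)
qed

lemma lipschitz_map_chart:
  assumes \<phi>: "\<And>j. j < n \<Longrightarrow> L-lipschitz_on UNIV (\<phi> j)"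
  shows "lipschitz_map n (chart n \<phi>)"
  unfolding lipschitz_map_def
proof (intro conjI exI allI)
  show "range (chart n \<phi>) \<subseteq> Rn n" by (auto simp: mem_Rn_iff chart_def)
  fix x y
  have "L2_set (\<lambda>j. chart n \<phi> x j - chart n \<phi> y j) {..<n} \<le> (\<Sum>j<n. \<bar>chart n \<phi> x j - chart n \<phi> y j\<bar>)"
    by (rule L2_set_le_sum_abs)
  also have "\<dots> \<le> (\<Sum>j<n. L * dist x y)"
    using lipschitz_onD[OF \<phi>] by (intro sum_mono) (auto simp: chart_def dist_real_def)
  also have "\<dots> = (real n * L) * dist x y" by simp
  finally show "L2_set (\<lambda>j. chart n \<phi> x j - chart n \<phi> y j) {..<n} \<le> (real n * L) * dist x y" .
qed

lemma indep_set_bound: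
  assumes "x \<in> indep_set n \<phi> m" "Lip (lincomb n v \<phi>) x \<le> ennreal r" "0 \<le> r"
  shows "(\<Sum>j<n. \<bar>v j\<bar>) \<le> real (Suc m) * r"
proof -
  have "ennreal ((\<Sum>j<n. \<bar>v j\<bar>) / real (Suc m)) \<le> Lip (lincomb n v \<phi>) x"
    using assms(1) unfolding indep_set_def by blast
  also note assms(2)
  finally have "ennreal ((\<Sum>j<n. \<bar>v j\<bar>) / real (Suc m)) \<le> ennreal r" .
  then have "(\<Sum>j<n. \<bar>v j\<bar>) / real (Suc m) \<le> r" by (simp only: ennreal_le_iff[OF assms(3)])
  then show ?thesis by (simp add: pos_divide_le_eq mult.commute del: of_nat_Suc)
qed

text \<open>Dependence yields a combination of \<phi> and \<open>f\<close> that is nearly constant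
  to first order. Independence of \<phi> keeps the coefficient \<open>c\<close> of \<open>f\<close>
  from being small compared with the others, so dividing by \<open>c\<close> solves for
  \<open>f\<close> with a controlled error.\<close>

lemma approximate_coefficients:
  fixes \<phi> :: "nat \<Rightarrow> 'a::metric_space \<Rightarrow> real"
  assumes \<phi>: "\<And>j. j < n \<Longrightarrow> L-lipschitz_on UNIV (\<phi> j)" "0 \<le> L" and f: "L-lipschitz_on UNIV f"
    and ind: "x \<in> indep_set n \<phi> m0" and dep: "x \<notin> indep_set (Suc n) (\<phi>(n := f)) m"
    and m: "2 * real (Suc m0) \<le> real (Suc m)"
  shows "\<exists>a. Lip (\<lambda>y. f y - lincomb n a \<phi> y) x \<le> ennreal ((2 * real (Suc m0) * (1 + L) + 1) / real (Suc m))"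
proof -
  define M0 where "M0 = real (Suc m0)"
  define M where "M = real (Suc m)"
  have M: "1 \<le> M0" "2 * M0 \<le> M" using m by (auto simp: M0_def M_def)
  obtain v where "\<not> ennreal ((\<Sum>j<Suc n. \<bar>v j\<bar>) / real (Suc m)) \<le> Lip (lincomb (Suc n) v (\<phi>(n := f))) x"
    using dep unfolding indep_set_def by blast
  then have less: "Lip (lincomb (Suc n) v (\<phi>(n := f))) x < ennreal ((\<Sum>j<Suc n. \<bar>v j\<bar>) / M)"
    unfolding M_def not_le .
  define S where "S = (\<Sum>j<n. \<bar>v j\<bar>)"
  define c where "c = v n"
  have S0: "0 \<le> S" by (simp add: S_def sum_nonneg)
  have SS: "(\<Sum>j<Suc n. \<bar>v j\<bar>) = S + \<bar>c\<bar>" by (simp add: S_def c_def)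
  have lc: "lincomb (Suc n) v (\<phi>(n := f)) = (\<lambda>y. lincomb n v \<phi> y + c * f y)"
    by (rule ext) (simp add: lincomb_def c_def)
  have le: "Lip (\<lambda>y. lincomb n v \<phi> y + c * f y) x \<le> ennreal ((S + \<bar>c\<bar>) / M)"
    using less unfolding lc SS by simp
  have "Lip (\<lambda>y. - c * f y) x \<le> ennreal (\<bar>- c\<bar> * L)"
    by (rule Lip_cmult_le[OF \<phi>(2) Lip_le_lipschitz[OF f]])
  then have "Lip (\<lambda>y. (lincomb n v \<phi> y + c * f y) + (- c * f y)) x \<le> ennreal ((S + \<bar>c\<bar>) / M + \<bar>- c\<bar> * L)"
    using le S0 M \<phi>(2) by (intro Lip_add_le) auto
  then have "Lip (lincomb n v \<phi>) x \<le> ennreal ((S + \<bar>c\<bar>) / M + \<bar>c\<bar> * L)" by simp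
  then have "S \<le> M0 * ((S + \<bar>c\<bar>) / M + \<bar>c\<bar> * L)"
    unfolding S_def M0_def by (rule indep_set_bound[OF ind]) (use S0 M \<phi>(2) in \<open>simp add: S_def[symmetric]\<close>)
  also have "\<dots> = M0 / M * (S + \<bar>c\<bar>) + M0 * L * \<bar>c\<bar>" by (simp add: algebra_simps add_divide_distrib)
  \<comment> \<open>The bound \<open>M >= 2 * M0\<close> makes the coefficient of \<open>S\<close>
    at most one half, so that it can be absorbed on the left.\<close>
  also have "\<dots> \<le> 1 / 2 * (S + \<bar>c\<bar>) + M0 * L * \<bar>c\<bar>"
    using M S0 by (intro add_right_mono mult_right_mono) (auto simp: divide_le_eq)
  finally have half: "S \<le> 1 / 2 * (S + \<bar>c\<bar>) + M0 * L * \<bar>c\<bar>" .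
  have "S \<le> p + 2 * q" if "S \<le> 1 / 2 * (S + p) + q" for p q using that by (simp add: field_simps)
  from this[OF half] have "S \<le> \<bar>c\<bar> + 2 * (M0 * L * \<bar>c\<bar>)" .
  also have "\<dots> = (1 + 2 * M0 * L) * \<bar>c\<bar>" by (simp add: algebra_simps)
  also have "\<dots> \<le> (2 * M0 * (1 + L)) * \<bar>c\<bar>" using M by (intro mult_right_mono) (auto simp: algebra_simps)
  finally have SB: "S \<le> 2 * M0 * (1 + L) * \<bar>c\<bar>" .
  have c: "c \<noteq> 0"
  proof
    assume "c = 0"
    then have "S + \<bar>c\<bar> = 0" using SB S0 by simp
    then show False using less unfolding SS by simp
  qed
  define a where "a j = - (1 / c) * v j" for j
  have "Lip (\<lambda>y. 1 / c * (lincomb n v \<phi> y + c * f y)) x \<le> ennreal (\<bar>1 / c\<bar> * ((S + \<bar>c\<bar>) / M))"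
    using le S0 M by (intro Lip_cmult_le) auto
  also have "(\<lambda>y. 1 / c * (lincomb n v \<phi> y + c * f y)) = (\<lambda>y. f y - lincomb n a \<phi> y)"
    unfolding a_def lincomb_cmult using c by (auto simp: field_simps)
  also have "\<bar>1 / c\<bar> * ((S + \<bar>c\<bar>) / M) \<le> (2 * M0 * (1 + L) + 1) / M"
  proof -
    have "(S + \<bar>c\<bar>) / \<bar>c\<bar> \<le> 2 * M0 * (1 + L) + 1" using SB c by (simp add: pos_divide_le_eq algebra_simps)
    then have "(S + \<bar>c\<bar>) / \<bar>c\<bar> / M \<le> (2 * M0 * (1 + L) + 1) / M" using M by (intro divide_right_mono) auto
    then show ?thesis by (simp add: abs_divide field_simps)
  qed
  then have "ennreal (\<bar>1 / c\<bar> * ((S + \<bar>c\<bar>) / M)) \<le> ennreal ((2 * M0 * (1 + L) + 1) / M)" by (rule ennreal_leI)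
  finally show ?thesis unfolding M0_def M_def by blast
qed

text \<open>Independence bounds coefficients by \<open>Lip\<close> of their combination. For
  differences of approximate coefficients this gives a Cauchy sequence, whose limit is the
  derivative; for two exact derivatives it gives uniqueness.\<close>

lemma differentiable_of_dependent:
  fixes \<phi> :: "nat \<Rightarrow> 'a::metric_space \<Rightarrow> real"
  assumes \<phi>: "\<And>j. j < n \<Longrightarrow> L-lipschitz_on UNIV (\<phi> j)" "0 \<le> L" and f: "L-lipschitz_on UNIV f"
    and ind: "x \<in> indep_set n \<phi> m0" and dep: "\<And>m. x \<notin> indep_set (Suc n) (\<phi>(n := f)) m"
  shows "differentiable_wrt n (chart n \<phi>) f x"
proof -
  define M0 where "M0 = real (Suc m0)"
  define B where "B = 2 * M0 * (1 + L) + 1"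
  have M0: "1 \<le> M0" by (simp add: M0_def)
  have B: "0 < B" using M0 \<phi>(2) by (simp add: B_def add_pos_pos add_nonneg_pos)
  \<comment> \<open>The index is shifted by \<open>2 * m0 + 1\<close> so that it always satisfies
    the size condition of \<open>approximate_coefficients\<close>.\<close>
  define r where "r m = B / real (Suc (m + 2 * m0 + 1))" for m :: nat
  have r0: "0 \<le> r m" for m using B by (simp add: r_def)
  have "\<exists>a. Lip (\<lambda>y. f y - lincomb n a \<phi> y) x \<le> ennreal (r m)" for m
    unfolding r_def B_def M0_def
    using of_nat_mono[of "2 * Suc m0" "Suc (m + 2 * m0 + 1)", where 'a = real]
    by (intro approximate_coefficients[OF \<phi> f ind dep]) auto
  then obtain a where a: "\<And>m. Lip (\<lambda>y. f y - lincomb n (a m) \<phi> y) x \<le> ennreal (r m)" by metis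
  have rlim: "r \<longlonglongrightarrow> 0"
  proof -
    have "(\<lambda>m. B / real (Suc m)) \<longlonglongrightarrow> 0" by (rule LIMSEQ_Suc[OF lim_const_over_n])
    from LIMSEQ_ignore_initial_segment[OF this, of "2 * m0 + 1"] show ?thesis by (simp add: r_def[abs_def] add.assoc)
  qed
  have diff: "Lip (lincomb n (\<lambda>j. u j - w j) \<phi>) x \<le> ennreal (p + q)"
    if "Lip (\<lambda>y. f y - lincomb n u \<phi> y) x \<le> ennreal p" "Lip (\<lambda>y. f y - lincomb n w \<phi> y) x \<le> ennreal q" "0 \<le> p" "0 \<le> q"
    for u w p q
  proof -
    have "Lip (\<lambda>y. (- 1) * (f y - lincomb n u \<phi> y)) x \<le> ennreal (\<bar>- 1\<bar> * p)" by (rule Lip_cmult_le[OF that(3,1)])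
    then have "Lip (\<lambda>y. (- 1) * (f y - lincomb n u \<phi> y)) x \<le> ennreal p" by simp
    then have "Lip (\<lambda>y. (- 1) * (f y - lincomb n u \<phi> y) + (f y - lincomb n w \<phi> y)) x \<le> ennreal (p + q)"
      using that by (intro Lip_add_le)
    moreover have "(\<lambda>y. (- 1) * (f y - lincomb n u \<phi> y) + (f y - lincomb n w \<phi> y)) = lincomb n (\<lambda>j. u j - w j) \<phi>"
      by (rule ext) (simp add: lincomb_def left_diff_distrib sum_subtractf)
    ultimately show ?thesis by simp
  qed
  have near: "\<bar>a m j - a l j\<bar> \<le> M0 * (r m + r l)" if "j < n" for j m l
  proof -
    have "\<bar>a m j - a l j\<bar> \<le> (\<Sum>j<n. \<bar>a m j - a l j\<bar>)" using that by (intro member_le_sum[of j _ "\<lambda>j. \<bar>a m j - a l j\<bar>"]) auto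
    also have "\<dots> \<le> M0 * (r m + r l)"
      unfolding M0_def using r0 by (intro indep_set_bound[OF ind] diff a) auto
    finally show ?thesis .
  qed
  have "\<exists>b. (\<lambda>m. a m j) \<longlonglongrightarrow> b" if j: "j < n" for j
  proof -
    have "Cauchy (\<lambda>m. a m j)"
    proof (rule metric_CauchyI)
      fix e :: real assume "0 < e"
      then have "0 < e / (2 * M0)" using M0 by simp
      then have "\<forall>\<^sub>F m in sequentially. r m < e / (2 * M0)" using order_tendstoD(2)[OF rlim] by blast
      then obtain N where N: "\<And>m. m \<ge> N \<Longrightarrow> r m < e / (2 * M0)" by (auto simp: eventually_sequentially)
      have "dist (a m j) (a l j) < e" if "m \<ge> N" "l \<ge> N" for m l
      proof -
        have "M0 * (r m + r l) < M0 * (e / (2 * M0) + e / (2 * M0))"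
          using N[OF that(1)] N[OF that(2)] M0 by (intro mult_strict_left_mono add_strict_mono) auto
        also have "\<dots> = e" using M0 by simp
        finally show ?thesis using near[OF j, of m l] by (simp add: dist_real_def)
      qed
      then show "\<exists>M. \<forall>m\<ge>M. \<forall>n\<ge>M. dist (a m j) (a n j) < e" by blast
    qed
    then show ?thesis by (simp add: Cauchy_convergent_iff convergent_def)
  qed
  then obtain b where b: "\<And>j. j < n \<Longrightarrow> (\<lambda>m. a m j) \<longlonglongrightarrow> b j" by metis
  have nearb: "\<bar>a m j - b j\<bar> \<le> M0 * r m" if j: "j < n" for j m
  proof (rule LIMSEQ_le[of "\<lambda>l. \<bar>a m j - a l j\<bar>" _ "\<lambda>l. M0 * (r m + r l)"])
    show "(\<lambda>l. \<bar>a m j - a l j\<bar>) \<longlonglongrightarrow> \<bar>a m j - b j\<bar>" by (intro tendsto_intros b j)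
    have "(\<lambda>l. M0 * (r m + r l)) \<longlonglongrightarrow> M0 * (r m + 0)" by (intro tendsto_intros rlim)
    then show "(\<lambda>l. M0 * (r m + r l)) \<longlonglongrightarrow> M0 * r m" by simp
  qed (use near[OF j] in auto)
  have bLip: "Lip (\<lambda>y. f y - lincomb n b \<phi> y) x \<le> ennreal 0"
  proof (rule ennreal_le_epsilon)
    fix e :: real assume e: "0 < e"
    have "(\<lambda>m. r m + L * (real n * (M0 * r m))) \<longlonglongrightarrow> 0 + L * (real n * (M0 * 0))" by (intro tendsto_intros rlim)
    then have "\<forall>\<^sub>F m in sequentially. r m + L * (real n * (M0 * r m)) < e" using e by (intro order_tendstoD(2)) auto
    then obtain m where m: "r m + L * (real n * (M0 * r m)) < e"
      using eventually_happens'[OF sequentially_bot] by blast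
    have "Lip (lincomb n (\<lambda>j. a m j - b j) \<phi>) x \<le> ennreal (L * (\<Sum>j<n. \<bar>a m j - b j\<bar>))" by (rule Lip_lincomb_le[OF \<phi>])
    also have "\<dots> \<le> ennreal (L * (real n * (M0 * r m)))"
    proof (intro ennreal_leI mult_left_mono \<phi>(2))
      have "(\<Sum>j<n. \<bar>a m j - b j\<bar>) \<le> (\<Sum>j<n. M0 * r m)" by (intro sum_mono nearb) auto
      then show "(\<Sum>j<n. \<bar>a m j - b j\<bar>) \<le> real n * (M0 * r m)" by simp
    qed
    finally have "Lip (\<lambda>y. (f y - lincomb n (a m) \<phi> y) + lincomb n (\<lambda>j. a m j - b j) \<phi> y) x \<le> ennreal (r m + L * (real n * (M0 * r m)))"
      using a r0 M0 \<phi>(2) by (intro Lip_add_le) auto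
    also have "(\<lambda>y. (f y - lincomb n (a m) \<phi> y) + lincomb n (\<lambda>j. a m j - b j) \<phi> y) = (\<lambda>y. f y - lincomb n b \<phi> y)"
      by (rule ext) (simp add: lincomb_def left_diff_distrib sum_subtractf)
    also have "ennreal (r m + L * (real n * (M0 * r m))) \<le> ennreal 0 + ennreal e" using m by (simp add: ennreal_leI)
    finally show "Lip (\<lambda>y. f y - lincomb n b \<phi> y) x \<le> ennreal 0 + ennreal e" .
  qed
  have lim_iff: "((\<lambda>y. \<bar>f y - f x - linear_form n c (\<lambda>j. chart n \<phi> y j - chart n \<phi> x j)\<bar> / dist y x) \<longlongrightarrow> 0) (at x)
    \<longleftrightarrow> Lip (\<lambda>y. f y - lincomb n c \<phi> y) x \<le> ennreal 0" for c
    unfolding tendsto_0_iff_Lip[symmetric] linear_form_chart by (simp add: algebra_simps)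
  show ?thesis
    unfolding differentiable_wrt_def
  proof (rule ex1I[of _ "linear_form n b"])
    show "linear_form n b \<in> linear_forms n \<and>
      ((\<lambda>y. \<bar>f y - f x - linear_form n b (\<lambda>j. chart n \<phi> y j - chart n \<phi> x j)\<bar> / dist y x) \<longlongrightarrow> 0) (at x)"
      unfolding lim_iff using bLip linear_form_in by blast
  next
    fix D assume D: "D \<in> linear_forms n \<and>
      ((\<lambda>y. \<bar>f y - f x - D (\<lambda>j. chart n \<phi> y j - chart n \<phi> x j)\<bar> / dist y x) \<longlongrightarrow> 0) (at x)"
    then obtain c where c: "D = linear_form n c" using linear_formsE by blast
    then have cL: "Lip (\<lambda>y. f y - lincomb n c \<phi> y) x \<le> ennreal 0" using D lim_iff by blast
    have "(\<Sum>j<n. \<bar>c j - b j\<bar>) \<le> real (Suc m0) * (0 + 0)"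
      by (intro indep_set_bound[OF ind] diff cL bLip) auto
    then have "(\<Sum>j<n. \<bar>c j - b j\<bar>) = 0" by (simp add: sum_nonneg order_antisym)
    then have "c j = b j" if "j < n" for j using that by (simp add: sum_nonneg_eq_0_iff)
    then have "linear_form n c = linear_form n b"
      unfolding linear_form_def by (intro arg_cong2[where f = restrict] ext sum.cong) auto
    then show "D = linear_form n b" using c by simp
  qed
qed

section \<open>Exhaustion by independent families and the final decomposition\<close>

lemma equivalent_finite_measure:
  assumes "metric_measure_space \<mu>"
  shows "\<exists>\<nu>. finite_measure \<nu> \<and> sets \<nu> = sets borel \<and> (\<forall>P. (AE x in \<nu>. P x) \<longleftrightarrow> (AE x in \<mu>. P x))"
proof -
  have \<mu>: "sets \<mu> = sets borel" "sigma_finite_measure \<mu>" using assms by (auto simp: metric_measure_space_def)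
  interpret sigma_finite_measure \<mu> by (rule \<mu>(2))
  \<comment> \<open>A strictly positive integrable density keeps the null sets, and hypothesis and
    conclusion of the theorem see the measure only through these. Finiteness is needed for the
    masses of cells and for exhaustion.\<close>
  obtain h where h: "h \<in> borel_measurable \<mu>" "integral\<^sup>N \<mu> h \<noteq> \<infinity>" "\<And>x. x \<in> space \<mu> \<Longrightarrow> 0 < h x"
    using Ex_finite_integrable_function by blast
  have "emeasure (density \<mu> h) (space (density \<mu> h)) = integral\<^sup>N \<mu> h"
    using h(1) by (subst emeasure_density) (auto intro!: nn_integral_cong)
  then have "finite_measure (density \<mu> h)" using h(2) by (intro finite_measureI) simp
  moreover have "(AE x in density \<mu> h. P x) \<longleftrightarrow> (AE x in \<mu>. P x)" for P
    unfolding AE_density[OF h(1)] by (rule AE_cong) (use h(3) in auto)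
  ultimately show ?thesis using \<mu>(1) by (intro exI[of _ "density \<mu> h"]) auto
qed

lemma common_lipschitz_constant:
  fixes n :: nat
  assumes "\<And>j. j < n \<Longrightarrow> lipschitz_fun (\<phi> j)"
  shows "\<exists>L\<ge>1. \<forall>j<n. L-lipschitz_on UNIV (\<phi> j)"
  using assms
proof (induction n)
  case (Suc n)
  have "\<exists>L\<ge>1. \<forall>j<n. L-lipschitz_on UNIV (\<phi> j)" by (rule Suc.IH) (use Suc.prems in simp)
  then obtain L where L: "1 \<le> L" "\<forall>j<n. L-lipschitz_on UNIV (\<phi> j)" by blast
  obtain L' where L': "L'-lipschitz_on UNIV (\<phi> n)" using Suc.prems[of n] by (auto simp: lipschitz_fun_def)
  show ?case
  proof (intro exI[of _ "max L L'"] conjI allI impI)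
    fix j assume "j < Suc n"
    then consider "L-lipschitz_on UNIV (\<phi> j)" | "L'-lipschitz_on UNIV (\<phi> j)"
      using L(2) L' by (auto simp: less_Suc_eq)
    then show "(max L L')-lipschitz_on UNIV (\<phi> j)"
      by cases (erule lipschitz_on_mono; simp)+
  qed (use L in auto)
qed auto

definition indep_union :: "nat \<Rightarrow> (nat \<Rightarrow> nat \<Rightarrow> 'a::metric_space \<Rightarrow> real) \<Rightarrow> 'a set" where
  "indep_union n \<Phi> = (\<Union>l. \<Union>m. indep_set n (\<Phi> l) m)"

lemma indep_set_lipschitz_borel:
  assumes "\<And>j. j < n \<Longrightarrow> lipschitz_fun (\<phi> j)"
  shows "indep_set n \<phi> m \<in> sets borel"
proof -
  have "\<exists>L\<ge>1. \<forall>j<n. L-lipschitz_on UNIV (\<phi> j)" by (rule common_lipschitz_constant[OF assms])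
  then obtain L where "1 \<le> L" "\<forall>j<n. L-lipschitz_on UNIV (\<phi> j)" by blast
  then show ?thesis by (intro indep_set_borel[of n L]) auto
qed

text \<open>Exhaustion: among all sequences of families one is taken whose independence sets cover
  the largest measure. An independence set sticking out of it in positive measure could be
  prepended, contradicting maximality.\<close>

lemma maximal_indep_union:
  fixes \<nu> :: "'a::metric_space measure"
  assumes \<nu>: "finite_measure \<nu>" "sets \<nu> = sets borel"
  shows "\<exists>\<Phi>. (\<forall>l. \<forall>j<n. lipschitz_fun (\<Phi> l j)) \<and>
    (\<forall>\<phi> m. (\<forall>j<n. lipschitz_fun (\<phi> j)) \<longrightarrow> (AE x in \<nu>. x \<in> indep_set n \<phi> m \<longrightarrow> x \<in> indep_union n \<Phi>))"
proof -
  interpret finite_measure \<nu> by fact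
  define adm where "adm \<Phi> \<longleftrightarrow> (\<forall>l. \<forall>j<n. lipschitz_fun (\<Phi> l j))" for \<Phi> :: "nat \<Rightarrow> nat \<Rightarrow> 'a \<Rightarrow> real"
  have meas: "indep_union n \<Phi> \<in> sets \<nu>" if "adm \<Phi>" for \<Phi>
    unfolding indep_union_def \<nu>(2) using that by (intro sets.countable_UN indep_set_lipschitz_borel image_subsetI) (auto simp: adm_def intro!: sets.countable_UN indep_set_lipschitz_borel)
  define val where "val \<Phi> = measure \<nu> (indep_union n \<Phi>)" for \<Phi>
  define S where "S = Sup (val ` Collect adm)"
  have "adm (\<lambda>l j x. 0)" unfolding adm_def lipschitz_fun_def by (auto intro!: exI[of _ 0] lipschitz_on_constant)
  then have ne: "val ` Collect adm \<noteq> {}" by blast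
  have bdd: "bdd_above (val ` Collect adm)"
    by (rule bdd_aboveI[of _ "measure \<nu> (space \<nu>)"]) (auto simp: val_def intro: bounded_measure)
  have upper: "val \<Phi> \<le> S" if "adm \<Phi>" for \<Phi>
    unfolding S_def using bdd that by (intro cSup_upper) auto
  have "\<exists>\<Phi>. adm \<Phi> \<and> S - 1 / real (Suc k) < val \<Phi>" for k
  proof -
    have "S - 1 / real (Suc k) < Sup (val ` Collect adm)" by (simp add: S_def)
    from less_cSupD[OF ne this] show ?thesis by auto
  qed
  then obtain F where F: "\<And>k. adm (F k)" "\<And>k. S - 1 / real (Suc k) < val (F k)" by metis
  \<comment> \<open>Interleaving countably many nearly optimal sequences gives a single one that
    attains the supremum.\<close>
  define \<Phi> where "\<Phi> l = F (fst (prod_decode l)) (snd (prod_decode l))" for l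
  have adm: "adm \<Phi>" using F(1) by (auto simp: adm_def \<Phi>_def)
  have sub: "indep_union n (F k) \<subseteq> indep_union n \<Phi>" for k
  proof
    fix x assume "x \<in> indep_union n (F k)"
    then obtain l m where "x \<in> indep_set n (F k l) m" by (auto simp: indep_union_def)
    then have "x \<in> indep_set n (\<Phi> (prod_encode (k, l))) m" by (simp add: \<Phi>_def)
    then show "x \<in> indep_union n \<Phi>" by (auto simp: indep_union_def)
  qed
  have "S \<le> val \<Phi>"
  proof (rule field_le_epsilon)
    fix e :: real assume "0 < e"
    then obtain k where "1 / real (Suc k) < e" using nat_approx_posE by blast
    moreover have "val (F k) \<le> val \<Phi>" unfolding val_def by (rule finite_measure_mono[OF sub meas[OF adm]])
    ultimately show "S \<le> val \<Phi> + e" using F(2)[of k] by linarith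
  qed
  have "AE x in \<nu>. x \<in> indep_set n \<phi> m \<longrightarrow> x \<in> indep_union n \<Phi>" if \<phi>: "\<forall>j<n. lipschitz_fun (\<phi> j)" for \<phi> m
  proof -
    define \<Psi> where "\<Psi> l = (case l of 0 \<Rightarrow> \<phi> | Suc l \<Rightarrow> \<Phi> l)" for l
    have "adm \<Psi>" using adm \<phi> by (auto simp: adm_def \<Psi>_def split: nat.split)
    have A: "indep_set n \<phi> m \<in> sets \<nu>" unfolding \<nu>(2) using \<phi> by (intro indep_set_lipschitz_borel) auto
    have "indep_set n \<phi> m \<union> indep_union n \<Phi> \<subseteq> indep_union n \<Psi>"
    proof
      fix x assume "x \<in> indep_set n \<phi> m \<union> indep_union n \<Phi>"
      then consider "x \<in> indep_set n (\<Psi> 0) m" | l m' where "x \<in> indep_set n (\<Psi> (Suc l)) m'"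
        by (auto simp: \<Psi>_def indep_union_def)
      then show "x \<in> indep_union n \<Psi>" by cases (auto simp only: indep_union_def)
    qed
    then have "measure \<nu> (indep_set n \<phi> m \<union> indep_union n \<Phi>) \<le> val \<Psi>"
      unfolding val_def by (rule finite_measure_mono[OF _ meas[OF \<open>adm \<Psi>\<close>]])
    also have "\<dots> \<le> val \<Phi>" using upper[OF \<open>adm \<Psi>\<close>] \<open>S \<le> val \<Phi>\<close> by linarith
    finally have "measure \<nu> (indep_set n \<phi> m \<union> indep_union n \<Phi>) \<le> measure \<nu> (indep_union n \<Phi>)" by (simp add: val_def)
    moreover have "measure \<nu> (indep_set n \<phi> m \<union> indep_union n \<Phi>) =
      measure \<nu> (indep_union n \<Phi>) + measure \<nu> (indep_set n \<phi> m - indep_union n \<Phi>)"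
      using finite_measure_Union'[OF meas[OF adm] A] by (simp add: Un_commute)
    ultimately have "measure \<nu> (indep_set n \<phi> m - indep_union n \<Phi>) = 0"
      using measure_nonneg[of \<nu> "indep_set n \<phi> m - indep_union n \<Phi>"] by linarith
    then have "indep_set n \<phi> m - indep_union n \<Phi> \<in> null_sets \<nu>"
      using A meas[OF adm] by (intro null_setsI) (auto simp: emeasure_eq_measure)
    then have "AE x in \<nu>. x \<notin> indep_set n \<phi> m - indep_union n \<Phi>" by (rule AE_not_in)
    then show ?thesis by eventually_elim auto
  qed
  then show ?thesis using adm unfolding adm_def by blast
qed

lemma indep_set_0: "indep_set 0 \<phi> m = UNIV"
  by (simp add: indep_set_def)

lemma hausdorff_dim_less_nat:
  assumes "\<not> of_nat n \<le> hausdorff_dim (A :: 'a::metric_space set)"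
  obtains s where "0 \<le> s" "s < real n" "hausdorff_measure s A = 0"
proof -
  have "(INF s \<in> {s::real. 0 \<le> s \<and> hausdorff_measure s A = 0}. ennreal s) < of_nat n"
    using assms by (simp add: hausdorff_dim_def not_le)
  then obtain s where s: "0 \<le> s" "hausdorff_measure s A = 0" "ennreal s < of_nat n"
    unfolding INF_less_iff by blast
  then have "s < real n" by (simp add: ennreal_of_nat_eq_real_of_nat ennreal_less_iff)
  then show ?thesis using that s by blast
qed

text \<open>A point is assigned the largest \<open>k\<close> for which it lies in the exhausting
  union of \<open>k\<close>-member families. Adding any \<open>f\<close> then gives a dependent
  family almost everywhere: by maximality of the next union if \<open>k < K\<close>, and by
  \<open>indep_set_null\<close> if \<open>k = K\<close>.\<close>

lemma lds_decomposition_exists: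
  fixes \<mu> \<nu> :: "'a::polish_space measure"
  assumes \<nu>: "finite_measure \<nu>" "sets \<nu> = sets borel" and ae: "\<And>P. (AE x in \<nu>. P x) \<longleftrightarrow> (AE x in \<mu>. P x)"
    and dim: "hausdorff_dim (UNIV :: 'a set) < \<infinity>"
    and dom: "Lip_dominated C \<nu>" and C: "0 < C"
  shows "\<exists>U n \<phi>. lds_decomposition \<mu> U n \<phi> \<and> (\<forall>i. of_nat (n i) \<le> hausdorff_dim (UNIV :: 'a set))"
proof -
  let ?dim = "hausdorff_dim (UNIV :: 'a set)"
  define Ks where "Ks = {k::nat. of_nat k \<le> ?dim}"
  obtain d where d: "?dim = ennreal d" "0 \<le> d" using dim by (cases "?dim") auto
  have "Ks \<subseteq> {..nat \<lceil>d\<rceil>}"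
  proof
    fix k assume "k \<in> Ks"
    then have "ennreal (real k) \<le> ennreal d" by (simp add: Ks_def d ennreal_of_nat_eq_real_of_nat)
    then have "real k \<le> d" using d(2) by simp
    then show "k \<in> {..nat \<lceil>d\<rceil>}" unfolding atMost_iff by linarith
  qed
  then have finK: "finite Ks" by (rule finite_subset) simp
  have K0: "0 \<in> Ks" by (simp add: Ks_def)
  \<comment> \<open>\<open>K\<close> is the integer part of the dimension, so \<open>K + 1\<close>
    exceeds the dimension and leaves room for an exponent \<open>s < K + 1\<close> of vanishing
    measure.\<close>
  define K where "K = Max Ks"
  have KK: "K \<in> Ks" unfolding K_def using finK K0 by (intro Max_in) auto
  have le_dim: "of_nat k \<le> ?dim" if "k \<le> K" for k
  proof -
    have "(of_nat k :: ennreal) \<le> of_nat K" using that by simp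
    also have "\<dots> \<le> ?dim" using KK by (simp add: Ks_def)
    finally show ?thesis .
  qed
  have "Suc K \<notin> Ks"
  proof
    assume "Suc K \<in> Ks"
    then have "Suc K \<le> K" unfolding K_def using finK by (intro Max_ge)
    then show False by simp
  qed
  then obtain s where s: "0 \<le> s" "s < real (Suc K)" "hausdorff_measure s (UNIV :: 'a set) = 0"
    using hausdorff_dim_less_nat[of "Suc K" "UNIV :: 'a set"] unfolding Ks_def by blast
  obtain \<Phi> where \<Phi>: "\<And>k. (\<forall>l. \<forall>j<k. lipschitz_fun (\<Phi> k l j)) \<and>
    (\<forall>\<phi> m. (\<forall>j<k. lipschitz_fun (\<phi> j)) \<longrightarrow> (AE x in \<nu>. x \<in> indep_set k \<phi> m \<longrightarrow> x \<in> indep_union k (\<Phi> k)))"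
    using maximal_indep_union[OF \<nu>] by metis
  define kk where "kk i = fst (prod_decode i)" for i
  define ll where "ll i = snd (prod_decode i)" for i
  \<comment> \<open>The index codes the size and the position of a family, while the constant
    \<open>m\<close> is absorbed by a union. Pieces of different families of one size may overlap,
    hence the later use of \<open>disjointed\<close>.\<close>
  define A where "A i = (if kk i \<le> K then (\<Union>m. indep_set (kk i) (\<Phi> (kk i) (ll i)) m) -
    (\<Union>k\<in>{kk i<..K}. indep_union k (\<Phi> k)) else {})" for i
  have bor: "indep_set k (\<Phi> k l) m \<in> sets borel" for k l m
    using \<Phi>[of k] by (intro indep_set_lipschitz_borel) auto
  have Ab: "A i \<in> sets borel" for i
    unfolding A_def indep_union_def using bor by (auto intro!: sets.Diff sets.finite_UN sets.countable_UN)
  have Acov: "(\<Union>i. A i) = UNIV"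
  proof (rule UNIV_eq_I[symmetric])
    fix x
    define Q where "Q = {k. k \<le> K \<and> x \<in> indep_union k (\<Phi> k)}"
    have Q: "finite Q" by (simp add: Q_def)
    \<comment> \<open>Every point is independent for the empty family, which starts the choice of a
      largest size.\<close>
    have "0 \<in> Q" by (simp add: Q_def indep_union_def indep_set_0)
    define k where "k = Max Q"
    have kQ: "k \<in> Q" unfolding k_def using Q \<open>0 \<in> Q\<close> by (intro Max_in) auto
    have kmax: "k' \<le> k" if "k' \<in> Q" for k' unfolding k_def using Q that by (rule Max_ge)
    obtain l m where lm: "x \<in> indep_set k (\<Phi> k l) m" using kQ by (auto simp: Q_def indep_union_def)
    have "x \<in> A (prod_encode (k, l))"
      using kQ lm kmax by (force simp: A_def kk_def ll_def Q_def)
    then show "x \<in> (\<Union>i. A i)" by blast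
  qed
  \<comment> \<open>Indices coding a size above \<open>K\<close> have an empty piece; giving them
    dimension 0 keeps the bound by the Hausdorff dimension valid for every index.\<close>
  define n where "n i = (if kk i \<le> K then kk i else 0)" for i
  define \<phi> where "\<phi> i = chart (n i) (\<Phi> (n i) (ll i))" for i
  have "lds_decomposition \<mu> (disjointed A) n \<phi>"
    unfolding lds_decomposition_def
  proof (intro conjI allI impI)
    show "disjointed A i \<in> sets borel" for i using sets.range_disjointed_sets[of A borel] Ab by auto
    show "disjoint_family (disjointed A)" by (rule disjoint_family_disjointed)
    show "(\<Union>i. disjointed A i) = UNIV" using Acov by (simp add: UN_disjointed_eq)
    show "lipschitz_map (n i) (\<phi> i)" for i
    proof -
      have "\<exists>L\<ge>1. \<forall>j<n i. L-lipschitz_on UNIV (\<Phi> (n i) (ll i) j)"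
        by (rule common_lipschitz_constant) (use \<Phi>[of "n i"] in blast)
      then obtain L where "\<forall>j<n i. L-lipschitz_on UNIV (\<Phi> (n i) (ll i) j)" by blast
      then show ?thesis unfolding \<phi>_def by (intro lipschitz_map_chart) auto
    qed
  next
    fix f :: "'a \<Rightarrow> real" and i
    assume f: "lipschitz_fun f"
    show "AE x in \<mu>. x \<in> disjointed A i \<longrightarrow> differentiable_wrt (n i) (\<phi> i) f x"
    proof (cases "kk i \<le> K")
      case False
      then have "disjointed A i = {}" using disjointed_subset[of A i] by (auto simp: A_def)
      then show ?thesis by simp
    next
      case True
      define k where "k = kk i"
      define \<psi> where "\<psi> = \<Phi> k (ll i)"
      have \<psi>f: "lipschitz_fun ((\<psi>(k := f)) j)" if "j < Suc k" for j
        using f \<Phi>[of k] that by (auto simp: \<psi>_def less_Suc_eq)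
      have "\<exists>L\<ge>1. \<forall>j<Suc k. L-lipschitz_on UNIV ((\<psi>(k := f)) j)"
        by (rule common_lipschitz_constant[OF \<psi>f])
      then obtain L where L: "1 \<le> L" "\<forall>j<Suc k. L-lipschitz_on UNIV ((\<psi>(k := f)) j)" by blast
      have "AE x in \<nu>. x \<in> A i \<longrightarrow> x \<notin> indep_set (Suc k) (\<psi>(k := f)) m" for m
      proof (cases "k = K")
        case True
        have "AE x in \<nu>. x \<notin> indep_set (Suc k) (\<psi>(k := f)) m"
          by (rule indep_set_null[OF \<nu> s(3,1) _ dom C _ L(1)]) (use s(2) True L(2) in auto)
        then show ?thesis by eventually_elim auto
      next
        case False
        then have kK: "Suc k \<in> {kk i<..K}" using True by (auto simp: k_def)
        have "AE x in \<nu>. x \<in> indep_set (Suc k) (\<psi>(k := f)) m \<longrightarrow> x \<in> indep_union (Suc k) (\<Phi> (Suc k))"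
          using \<Phi>[of "Suc k"] \<psi>f by blast
        then show ?thesis
        proof eventually_elim
          case (elim x)
          show ?case
          proof (intro impI notI)
            assume x: "x \<in> A i" "x \<in> indep_set (Suc k) (\<psi>(k := f)) m"
            then have "x \<in> indep_union (Suc k) (\<Phi> (Suc k))" using elim by blast
            then show False using x(1) kK unfolding A_def by auto
          qed
        qed
      qed
      then have "AE x in \<nu>. \<forall>m. x \<in> A i \<longrightarrow> x \<notin> indep_set (Suc k) (\<psi>(k := f)) m" by (subst AE_all_countable) blast
      then have "AE x in \<mu>. \<forall>m. x \<in> A i \<longrightarrow> x \<notin> indep_set (Suc k) (\<psi>(k := f)) m" unfolding ae .
      then show ?thesis
      proof eventually_elim
        case (elim x)
        show ?case
        proof
          assume "x \<in> disjointed A i"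
          then have xA: "x \<in> A i" using disjointed_subset[of A i] by blast
          then obtain m where m: "x \<in> indep_set k \<psi> m" using True by (auto simp: A_def k_def \<psi>_def)
          have lip: "L-lipschitz_on UNIV (\<psi> j)" if "j < k" for j using spec[OF L(2), of j] that by simp
          have lipf: "L-lipschitz_on UNIV f" using spec[OF L(2), of k] by simp
          have "differentiable_wrt k (chart k \<psi>) f x"
            by (rule differentiable_of_dependent[OF lip _ lipf m]) (use L(1) elim xA in auto)
          then show "differentiable_wrt (n i) (\<phi> i) f x" using True by (simp add: n_def \<phi>_def k_def \<psi>_def)
        qed
      qed
    qed
  qed
  moreover have "of_nat (n i) \<le> ?dim" for i using le_dim[of "n i"] by (simp add: n_def)
  ultimately show ?thesis by blast
qed

theorem theorem1p4:
  fixes \<mu> :: "'a::polish_space measure"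
  assumes "metric_measure_space \<mu>"
    and "hausdorff_dim (UNIV :: 'a set) < \<infinity>"
    and "\<exists>C::real. C \<ge> 1 \<and>
           (\<forall>f \<rho>. lipschitz_fun f \<and> upper_gradient f \<rho> \<longrightarrow>
              (AE x in \<mu>. Lip f x \<le> ennreal (C * \<rho> x)))"
  shows "lipschitz_differentiability_space \<mu> \<and>
         (\<exists>U n \<phi>. lds_decomposition \<mu> U n \<phi> \<and>
            (\<forall>i. of_nat (n i) \<le> hausdorff_dim (UNIV :: 'a set)))"
proof -
  obtain \<nu> where \<nu>: "finite_measure \<nu>" "sets \<nu> = sets borel" "\<And>P. (AE x in \<nu>. P x) \<longleftrightarrow> (AE x in \<mu>. P x)"
    using equivalent_finite_measure[OF assms(1)] by blast
  obtain C where C: "1 \<le> C" "\<forall>f \<rho>. lipschitz_fun f \<and> upper_gradient f \<rho> \<longrightarrow>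
      (AE x in \<mu>. Lip f x \<le> ennreal (C * \<rho> x))"
    using assms(3) by blast
  have "Lip_dominated C \<nu>" unfolding Lip_dominated_def \<nu>(3) by (rule C(2))
  then have "\<exists>U n \<phi>. lds_decomposition \<mu> U n \<phi> \<and> (\<forall>i. of_nat (n i) \<le> hausdorff_dim (UNIV :: 'a set))"
    using C(1) by (intro lds_decomposition_exists[OF \<nu> assms(2)]) auto
  then show ?thesis unfolding lipschitz_differentiability_space_def by blast
qed

end
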